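(* Let $d,q\in\mathbb{N}^*$, $\kappa\in\mathbb{R}$, $p\in\mathbb{N}$, let $s\in\mathbb{N}^*$ with $s>d/2$, and let $(Q_1,\dots,Q_q)\in C^\infty(\mathbb{T}^d,\mathbb{R}^q)$ be such that $1\in\mathcal{H}_0$ and $\mathcal{H}_\infty$ is dense in $H^s(\mathbb{T}^d,\mathbb{R})$, where $\mathcal H_0$ and $\mathcal H_\infty$ are the spaces built from $Q_1,\dots,Q_q$ as defined in the context. Consider $$\partial_t\psi=\big(\Delta-\kappa\psi^p+\langle u(t),Q(x)\rangle\big)\psi,\qquad\psi(0,\cdot)=\psi_0,\qquad x\in\mathbb{T}^d,\ t>0,$$ with $Q=(Q_1,\dots,Q_q,\mu_1,\mu_2)$, $\mu_1,\mu_2:\mathbb{T}^d\to\mathbb{R}$ bounded measurable, and denote its solution by $\psi(t;\psi_0,u)$. (i) Let $\psi_0,\psi_1\in H^s(\mathbb{T}^d,\mathbb{R})$ be such that $\mathrm{sign}(\psi_0)=\mathrm{sign}(\psi_1)$. For any $\epsilon>0$ and $T>0$ there exist $\tau\in(0,T]$ and $(u_1,\dots,u_q)\in L^2((0,\tau),\mathbb{R}^q)$ for which the solution $\psi(t;\psi_0,u)$ with control $u=(u_1,\dots,u_q,0,0)$ is well-defined in $[0,\tau]$ and satisfies $\|\psi(\tau;\psi_0,u)-\psi_1\|_{L^2}<\epsilon$. (ii) Let $\psi_0,\psi_1\in H^s(\mathbb{T}^d,\mathbb{R})$ be such that $\psi_0,\psi_1>0$ (or $\psi_0,\psi_1<0$).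 For any $\epsilon>0$ and $T>0$ there exists $(u_1,\dots,u_q)\in L^2((0,T),\mathbb{R}^q)$ such that the solution $\psi(t;\psi_0,u)$ with control $u=(u_1,\dots,u_q,0,0)$ is well-defined in $[0,T]$ and satisfies $\|\psi(T;\psi_0,u)-\psi_1\|_{H^s}<\epsilon$.
   Context: $\mathbb{N}=\{0,1,2,\dots\}$, $\mathbb{N}^*=\mathbb{N}\setminus\{0\}$, $\mathbb{T}^d=\mathbb{R}^d/2\pi\mathbb{Z}^d$. Saturation spaces. For $\varphi\in C^1(\mathbb{T}^d,\mathbb{R})$ set $\mathbb{B}(\varphi)(x)=\sum_{j=1}^d(\partial_{x_j}\varphi(x))^2$. Let $\mathcal{H}_0=\mathrm{span}_{\mathbb{R}}\{Q_1,\dots,Q_q\}$. For $j\in\mathbb{N}^*$, $\mathcal{H}_j$ is the largest vector space whose elements can all be written as $\varphi_0+\sum_{k=1}^n\mathbb{B}(\varphi_k)$ with $n\in\mathbb{N}$ and $\varphi_0,\dots,\varphi_n\in\mathcal{H}_{j-1}$ (the sum is zero for $n=0$). Finally $\mathcal{H}_\infty=\bigcup_{j\ge0}\mathcal{H}_j$. "Solution" means mild solution: $\psi\in C^0([0,T],H^s(\mathbb{T}^d,\mathbb{R}))$ with $\psi(t)=e^{t\Delta}\psi_0+\int_0^t e^{(t-r)\Delta}\big(\langle u(r),Q\rangle\psi(r)-\kappa\psi(r)^{p+1}\big)dr$; it is unique when it exists, and "well-defined in $[0,T]$" means that it exists on $[0,T]$. Elements of $H^s$ are identified with their continuous representatives;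 equality of signs is pointwise on $\mathbb{T}^d$ with $\mathrm{sign}$ taking values in $\{-1,0,1\}$ and $\mathrm{sign}(0)=0$, and $\psi_j>0$ means $\psi_j(x)>0$ for all $x$. *)

theory Defs
  imports "HOL-Analysis.Analysis" "HOL-Library.Function_Algebras"
begin

text \<open>Functions on the torus \<open>\<real>\<^sup>d / 2\<pi>\<int>\<^sup>d\<close> are rendered as functions on \<open>real ^ 'd\<close> that are
  \<open>2\<pi>\<close>-periodic in every coordinate. The dimension \<open>d\<close> is \<open>CARD('d)\<close>. Real-valued functions
  carry the pointwise vector space structure.\<close>

instantiation "fun" :: (type, real_vector) real_vector
begin

definition scaleR_fun :: "real \<Rightarrow> ('a \<Rightarrow> 'b) \<Rightarrow> 'a \<Rightarrow> 'b" where
  "scaleR_fun c f = (\<lambda>x. c *\<^sub>R f x)"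

instance
  by standard (auto simp: scaleR_fun_def fun_eq_iff scaleR_add_right scaleR_add_left)

end

definition periodic :: "(real ^ 'd \<Rightarrow> real) \<Rightarrow> bool" where
  "periodic f \<longleftrightarrow> (\<forall>x i. f (x + axis i (2 * pi)) = f x)"

subsection \<open>Smooth functions and saturation spaces\<close>

definition partial_deriv :: "'d \<Rightarrow> (real ^ 'd \<Rightarrow> real) \<Rightarrow> real ^ 'd \<Rightarrow> real" where
  "partial_deriv i f x = frechet_derivative f (at x) (axis i 1)"

fun class_C :: "nat \<Rightarrow> (real ^ 'd \<Rightarrow> real) \<Rightarrow> bool" where
  "class_C 0 f \<longleftrightarrow> continuous_on UNIV f"
| "class_C (Suc k) f \<longleftrightarrow> (\<forall>x. f differentiable (at x)) \<and> (\<forall>i. class_C k (partial_deriv i f))"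

definition smooth :: "(real ^ 'd \<Rightarrow> real) \<Rightarrow> bool" where
  "smooth f \<longleftrightarrow> (\<forall>k. class_C k f)"

definition BB :: "(real ^ 'd \<Rightarrow> real) \<Rightarrow> real ^ 'd \<Rightarrow> real" where
  "BB \<phi> x = (\<Sum>i\<in>UNIV. (partial_deriv i \<phi> x)\<^sup>2)"

definition BB_sums :: "(real ^ 'd \<Rightarrow> real) set \<Rightarrow> (real ^ 'd \<Rightarrow> real) set" where
  "BB_sums H = {\<phi>0 + (\<Sum>k\<in>{1..n}. BB (\<phi> k)) | \<phi>0 \<phi> (n::nat). \<phi>0 \<in> H \<and> (\<forall>k\<in>{1..n}. \<phi> k \<in> H)}"

primrec saturation :: "(nat \<Rightarrow> real ^ 'd \<Rightarrow> real) \<Rightarrow> nat \<Rightarrow> nat \<Rightarrow> (real ^ 'd \<Rightarrow> real) set" where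
  "saturation Q q 0 = span (Q ` {1..q})"
| "saturation Q q (Suc j) = (GREATEST V. subspace V \<and> V \<subseteq> BB_sums (saturation Q q j))"

definition saturation_inf :: "(nat \<Rightarrow> real ^ 'd \<Rightarrow> real) \<Rightarrow> nat \<Rightarrow> (real ^ 'd \<Rightarrow> real) set" where
  "saturation_inf Q q = (\<Union>j. saturation Q q j)"

text \<open>The largest subspace in the recursion exists, because \<open>BB_sums\<close> of a subspace is closed
  under addition.\<close>

lemma BB_sums_add:
  assumes "subspace H" "f \<in> BB_sums H" "g \<in> BB_sums H"
  shows "f + g \<in> BB_sums H"
proof -
  obtain f0 \<phi> and n :: nat where f: "f = f0 + (\<Sum>k\<in>{1..n}. BB (\<phi> k))" "f0 \<in> H"
    "\<forall>k\<in>{1..n}. \<phi> k \<in> H"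
    using assms(2) unfolding BB_sums_def by auto
  obtain g0 \<gamma> and m :: nat where g: "g = g0 + (\<Sum>k\<in>{1..m}. BB (\<gamma> k))" "g0 \<in> H"
    "\<forall>k\<in>{1..m}. \<gamma> k \<in> H"
    using assms(3) unfolding BB_sums_def by auto
  define \<theta> where "\<theta> k = (if k \<le> n then \<phi> k else \<gamma> (k - n))" for k
  have "(\<Sum>k\<in>{1..n+m}. BB (\<theta> k)) = (\<Sum>k\<in>{1..n}. BB (\<theta> k)) + (\<Sum>k\<in>{n+1..n+m}. BB (\<theta> k))"
    by (rule sum.ub_add_nat) simp
  also have "(\<Sum>k\<in>{1..n}. BB (\<theta> k)) = (\<Sum>k\<in>{1..n}. BB (\<phi> k))"
    by (rule sum.cong) (auto simp: \<theta>_def)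
  also have "(\<Sum>k\<in>{n+1..n+m}. BB (\<theta> k)) = (\<Sum>k\<in>{1..m}. BB (\<gamma> k))"
    by (rule sum.reindex_bij_witness[where i = "\<lambda>k. k + n" and j = "\<lambda>k. k - n"])
       (auto simp: \<theta>_def)
  finally have "f + g = (f0 + g0) + (\<Sum>k\<in>{1..n+m}. BB (\<theta> k))"
    by (simp only: f(1) g(1) add.assoc add.left_commute)
  moreover have "f0 + g0 \<in> H" using assms(1) f g by (simp add: subspace_add)
  moreover have "\<theta> k \<in> H" if "k \<in> {1..n+m}" for k
  proof (cases "k \<le> n")
    case True
    then show ?thesis using that f(3) by (simp add: \<theta>_def)
  next
    case False
    then have "k - n \<in> {1..m}" using that by (simp, linarith)
    then show ?thesis using False g(3) by (simp add: \<theta>_def)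
  qed
  ultimately show ?thesis
    unfolding BB_sums_def by (intro CollectI exI[of _ "f0 + g0"] exI[of _ \<theta>] exI[of _ "n + m"]) simp
qed

lemma largest_subspace:
  assumes "subspace H"
  defines "M \<equiv> (GREATEST V. subspace V \<and> V \<subseteq> BB_sums H)"
  shows "subspace M" "M \<subseteq> BB_sums H" "\<And>V. subspace V \<Longrightarrow> V \<subseteq> BB_sums H \<Longrightarrow> V \<subseteq> M"
proof -
  define W where "W = \<Union>{V. subspace V \<and> V \<subseteq> BB_sums H}"
  have sum: "\<exists>V. subspace V \<and> V \<subseteq> BB_sums H \<and> x + y \<in> V"
    if "subspace U" "U \<subseteq> BB_sums H" "x \<in> U" "subspace V" "V \<subseteq> BB_sums H" "y \<in> V" for U V x y
  proof (intro exI conjI)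
    show "subspace {u + v |u v. u \<in> U \<and> v \<in> V}" using that by (intro subspace_sums)
    show "{u + v |u v. u \<in> U \<and> v \<in> V} \<subseteq> BB_sums H"
      using that BB_sums_add[OF assms(1)] by blast
    show "x + y \<in> {u + v |u v. u \<in> U \<and> v \<in> V}" using that by blast
  qed
  have zero: "{0} \<subseteq> BB_sums H"
    using subspace_0[OF assms(1)] unfolding BB_sums_def by (force intro!: exI[of _ "0::nat"])
  have zero': "subspace {0 :: real ^ 'a \<Rightarrow> real}" by (auto simp: subspace_def)
  have W: "subspace W" unfolding W_def
  proof (intro subspaceI, goal_cases)
    case 1
    show ?case using zero zero' by blast
  next
    case (2 x y)
    then obtain U V where "subspace U" "U \<subseteq> BB_sums H" "x \<in> U"
      "subspace V" "V \<subseteq> BB_sums H" "y \<in> V" by blast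
    from sum[OF this] show ?case by blast
  next
    case (3 c x)
    then obtain V where "subspace V" "V \<subseteq> BB_sums H" "x \<in> V" by blast
    then show ?case using subspace_scale[of V x c] by blast
  qed
  have "M = W" unfolding M_def
    by (rule Greatest_equality) (use W in \<open>auto simp: W_def\<close>)
  then show "subspace M" "M \<subseteq> BB_sums H"
    "\<And>V. subspace V \<Longrightarrow> V \<subseteq> BB_sums H \<Longrightarrow> V \<subseteq> M"
    using W by (auto simp: W_def)
qed

lemma subspace_saturation: "subspace (saturation Q q j)"
  by (induction j) (auto intro: largest_subspace(1))

subsection \<open>Sobolev spaces and the heat semigroup\<close>

definition torus_cell :: "(real ^ 'd) set" where
  "torus_cell = cbox 0 (\<chi> i. 2 * pi)"

definition L2_norm :: "(real ^ 'd \<Rightarrow> real) \<Rightarrow> real" where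
  "L2_norm f = sqrt (LINT x|lebesgue_on torus_cell. (f x)\<^sup>2)"

definition freq_sq :: "int ^ 'd \<Rightarrow> real" where
  "freq_sq k = (\<Sum>i\<in>UNIV. (real_of_int (k $ i))\<^sup>2)"

definition character :: "int ^ 'd \<Rightarrow> real ^ 'd \<Rightarrow> complex" where
  "character k x = cis (\<Sum>i\<in>UNIV. real_of_int (k $ i) * x $ i)"

definition fourier_coeff :: "(real ^ 'd \<Rightarrow> real) \<Rightarrow> int ^ 'd \<Rightarrow> complex" where
  "fourier_coeff f k =
     (LINT x|lebesgue_on torus_cell. complex_of_real (f x) * cnj (character k x)) / (2 * pi) ^ CARD('d)"

text \<open>Only used for \<open>s > d/2\<close>, where every class in \<open>H\<^sup>s\<close> has a unique continuous representative;
  the space consists of these representatives. The factor \<open>(2\<pi>)\<^sup>d\<close> in the norm makes the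
  case \<open>s = 0\<close> agree with the norm of \<open>L\<^sup>2\<close> for Lebesgue measure (Parseval).\<close>

definition sobolev :: "nat \<Rightarrow> (real ^ 'd \<Rightarrow> real) set" where
  "sobolev s = {f. periodic f \<and> continuous_on UNIV f \<and>
     (\<lambda>k. (1 + freq_sq k) ^ s * (norm (fourier_coeff f k))\<^sup>2) summable_on UNIV}"

definition sobolev_norm :: "nat \<Rightarrow> (real ^ 'd \<Rightarrow> real) \<Rightarrow> real" where
  "sobolev_norm s f =
     sqrt ((2 * pi) ^ CARD('d) * (\<Sum>\<^sub>\<infinity>k. (1 + freq_sq k) ^ s * (norm (fourier_coeff f k))\<^sup>2))"

text \<open>\<open>e\<^bsup>t\<Delta>\<^esup>\<close>, the Fourier multiplier with symbol \<open>exp (- t |k|\<^sup>2)\<close>. The series is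
  absolutely convergent for \<open>t > 0\<close>, and also for \<open>t = 0\<close> if \<open>f\<close> is in \<open>H\<^sup>s\<close> with \<open>s > d/2\<close>.\<close>

definition heat :: "real \<Rightarrow> (real ^ 'd \<Rightarrow> real) \<Rightarrow> real ^ 'd \<Rightarrow> real" where
  "heat t f x =
     Re (\<Sum>\<^sub>\<infinity>k. complex_of_real (exp (- t * freq_sq k)) * fourier_coeff f k * character k x)"

definition dense_in_sobolev :: "nat \<Rightarrow> (real ^ 'd \<Rightarrow> real) set \<Rightarrow> bool" where
  "dense_in_sobolev s A \<longleftrightarrow>
     (\<forall>f\<in>sobolev s. \<forall>\<epsilon>>0. \<exists>g\<in>A \<inter> sobolev s. sobolev_norm s (f - g) < \<epsilon>)"

subsection \<open>Mild solutions\<close>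

text \<open>The Bochner integral in \<open>H\<^sup>s\<close>. This is \<^const>\<open>has_bochner_integral\<close>, which is tied to a
  normed type, written for the carrier \<open>sobolev s\<close> and the norm \<open>sobolev_norm s\<close>.\<close>

definition has_sobolev_integral ::
  "nat \<Rightarrow> 'a measure \<Rightarrow> ('a \<Rightarrow> real ^ 'd \<Rightarrow> real) \<Rightarrow> (real ^ 'd \<Rightarrow> real) \<Rightarrow> bool" where
  "has_sobolev_integral s M F v \<longleftrightarrow>
     (AE r in M. F r \<in> sobolev s) \<and> v \<in> sobolev s \<and>
     (\<exists>\<sigma> :: nat \<Rightarrow> 'a \<Rightarrow> real ^ 'd \<Rightarrow> real.
        (\<forall>n. Bochner_Integration.simple_bochner_integrable M (\<sigma> n) \<and> \<sigma> n ` space M \<subseteq> sobolev s \<and>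
             (\<lambda>r. sobolev_norm s (F r - \<sigma> n r)) \<in> borel_measurable M) \<and>
        (\<lambda>n. \<integral>\<^sup>+r. ennreal (sobolev_norm s (F r - \<sigma> n r)) \<partial>M) \<longlonglongrightarrow> 0 \<and>
        (\<lambda>n. sobolev_norm s (Bochner_Integration.simple_bochner_integral M (\<sigma> n) - v)) \<longlonglongrightarrow> 0)"

text \<open>\<open>m\<close> is the number of potentials and controls, indexed by \<open>1, \<dots>, m\<close>.\<close>

definition mild_solution ::
  "nat \<Rightarrow> real \<Rightarrow> nat \<Rightarrow> nat \<Rightarrow> (nat \<Rightarrow> real ^ 'd \<Rightarrow> real) \<Rightarrow> real \<Rightarrow>
   (real ^ 'd \<Rightarrow> real) \<Rightarrow> (nat \<Rightarrow> real \<Rightarrow> real) \<Rightarrow> (real \<Rightarrow> real ^ 'd \<Rightarrow> real) \<Rightarrow> bool" where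
  "mild_solution s \<kappa> p m Q T \<psi>0 u \<psi> \<longleftrightarrow>
     (\<forall>t\<in>{0..T}. \<psi> t \<in> sobolev s) \<and>
     (\<forall>t\<in>{0..T}. ((\<lambda>r. sobolev_norm s (\<psi> r - \<psi> t)) \<longlongrightarrow> 0) (at t within {0..T})) \<and>
     (\<forall>t\<in>{0..T}. has_sobolev_integral s (lebesgue_on {0..t})
        (\<lambda>r. heat (t - r) (\<lambda>x. (\<Sum>j\<in>{1..m}. u j r * Q j x) * \<psi> r x - \<kappa> * \<psi> r x ^ (p + 1)))
        (\<psi> t - heat t \<psi>0))"

definition append2 :: "nat \<Rightarrow> (nat \<Rightarrow> 'b) \<Rightarrow> 'b \<Rightarrow> 'b \<Rightarrow> nat \<Rightarrow> 'b" where
  "append2 q f a b j = (if j \<le> q then f j else if j = q + 1 then a else b)"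

definition L2_on :: "real set \<Rightarrow> (real \<Rightarrow> real) \<Rightarrow> bool" where
  "L2_on S f \<longleftrightarrow> f \<in> borel_measurable (lebesgue_on S) \<and> integrable (lebesgue_on S) (\<lambda>t. (f t)\<^sup>2)"

definition bounded_measurable :: "(real ^ 'd \<Rightarrow> real) \<Rightarrow> bool" where
  "bounded_measurable \<mu> \<longleftrightarrow> periodic \<mu> \<and> \<mu> \<in> borel_measurable lebesgue \<and> bounded (range \<mu>)"

end

theory Submission
  imports Defs "HOL-Probability.Probability"
begin

text \<open>An element of \<open>H\<^sup>s\<close> is represented by the Hermitian sequence of its weighted Fourier coefficients,
  so that \<open>H\<^sup>s\<close> becomes a separable Banach algebra on which the heat semigroup is a Fourier multiplier
  and, equivalently, a Gaussian average of translations.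

  A state \<open>\<psi>\<close> can be steered in arbitrarily short time close to \<open>e\<^bsup>\<phi>\<^esup> \<psi>\<close> for every \<open>\<phi>\<close> in a saturation
  space. For \<open>\<phi> \<in> \<H>\<^sub>0\<close> one uses the constant control \<open>\<phi> / \<delta>\<close> for a time \<open>\<delta>\<close>. If \<open>e\<^bsup>\<plusminus>\<phi>/\<epsilon>\<^esup>\<close> is available,
  then so is \<open>e\<^bsup>B(\<phi>)\<^esup>\<close>: conjugating the heat semigroup at time \<open>\<epsilon>\<^sup>2\<close> by \<open>e\<^bsup>\<phi>/\<epsilon>\<^esup>\<close> gives the average
  of \<open>e\<^bsup>(\<phi>(x) - \<phi>(x + \<epsilon>v))/\<epsilon>\<^esup> \<psi>(x + \<epsilon>v)\<close> over a Gaussian \<open>v\<close>, which tends to \<open>e\<^bsup>B(\<phi>)\<^esup> \<psi>\<close>. By density every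
  multiplier \<open>e\<^bsup>\<phi>\<^esup>\<close> with \<open>\<phi> \<in> H\<^sup>s\<close> is reached. Here all steps are uniform over a ball of initial states, so
  that they can be concatenated, and solutions are produced near approximate ones by Picard iteration.

  For (i), \<open>((\<bar>\<psi>\<^sub>1\<bar> + \<eta>) / (\<bar>\<psi>\<^sub>0\<bar> + \<eta>)) \<psi>\<^sub>0\<close> tends to \<open>\<psi>\<^sub>1\<close> in \<open>L\<^sup>2\<close> as \<open>\<eta> \<rightarrow> 0\<close>. For (ii), positive elements of \<open>H\<^sup>s\<close>
  have a logarithm in \<open>H\<^sup>s\<close>; one steers \<open>\<psi>\<^sub>0\<close> to a constant, waits there with the control that
  cancels the nonlinearity, and then steers to \<open>\<psi>\<^sub>1\<close>.\<close>

subsection \<open>Hermitian square-summable families\<close>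

text \<open>Since the sign of \<open>\<kappa>\<close> and the exponent \<open>p\<close> are
  arbitrary, solutions may blow up, and no global existence result can be invoked. Existence on each
  short interval is therefore obtained together with the approximation: an explicit path that almost
  solves the equation has a true solution next to it. Conjugation by \<open>e^(a/\<epsilon>)\<close>
  multiplies the nonlinearity by \<open>e^(-p a/\<epsilon>)\<close>, which explodes where
  \<open>a\<close> is negative; this is why constants must be available as potentials. The limit
  yields \<open>e^(BB \<phi>)\<close> but never its inverse, because
  \<open>BB (- \<phi>) = BB \<phi>\<close>. The next round needs all real multiples of an exponent,
  and that is what the requirement that each saturation space be a vector space supplies. Bochner
  integrals live on a normed type while \<open>sobolev s\<close> is only a set, hence the detour
  through a type of sequences with an isometry \<open>ev\<close>. A positive function, scaled below
  1, is at distance less than 1 from the constant 1 in the sup norm, yet possibly far from it in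
  \<open>H^s\<close>. The logarithm series thus converges by a spectral radius argument, not by its
  norm.\<close>

typedef (overloaded) 'd hseq =
  "{a :: int ^ 'd \<Rightarrow> complex. (\<forall>k. a (- k) = cnj (a k)) \<and> (\<lambda>k. (norm (a k))\<^sup>2) summable_on UNIV}"
  morphisms coef hseq
  by (rule exI[of _ "\<lambda>_. 0"]) simp

lemma coef_uminus: "coef a (- k) = cnj (coef a k)"
  using coef[of a] by simp

lemma summable_coef: "(\<lambda>k. (norm (coef a k))\<^sup>2) summable_on UNIV"
  using coef[of a] by simp

lemma coef_hseq:
  assumes "\<And>k. f (- k) = cnj (f k)" "(\<lambda>k. (norm (f k))\<^sup>2) summable_on UNIV"
  shows "coef (hseq f) = f"
  using assms by (intro hseq_inverse) simp

lemma coef_eqI: "(\<And>k. coef a k = coef b k) \<Longrightarrow> a = b"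
  by (metis coef_inject ext)

lemma summable_on_norm_sq_add:
  fixes f g :: "'a \<Rightarrow> 'b::real_normed_vector"
  assumes "(\<lambda>k. (norm (f k))\<^sup>2) summable_on A" "(\<lambda>k. (norm (g k))\<^sup>2) summable_on A"
  shows "(\<lambda>k. (norm (f k + g k))\<^sup>2) summable_on A"
proof (rule summable_on_comparison_test)
  show "(\<lambda>k. 2 * (norm (f k))\<^sup>2 + 2 * (norm (g k))\<^sup>2) summable_on A"
    using assms by (intro summable_on_add summable_on_cmult_right)
  show "(norm (f k + g k))\<^sup>2 \<le> 2 * (norm (f k))\<^sup>2 + 2 * (norm (g k))\<^sup>2" for k
  proof -
    have "(norm (f k + g k))\<^sup>2 \<le> (norm (f k) + norm (g k))\<^sup>2"
      by (intro power_mono norm_triangle_ineq) auto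
    also have "\<dots> \<le> 2 * (norm (f k))\<^sup>2 + 2 * (norm (g k))\<^sup>2"
      using zero_le_power2[of "norm (f k) - norm (g k)"] by (simp add: power2_eq_square algebra_simps)
    finally show ?thesis .
  qed
qed simp

lemma abs_summable_on_inner:
  fixes f g :: "'a \<Rightarrow> 'b::real_inner"
  assumes "(\<lambda>k. (norm (f k))\<^sup>2) summable_on A" "(\<lambda>k. (norm (g k))\<^sup>2) summable_on A"
  shows "(\<lambda>k. norm (inner (f k) (g k))) summable_on A"
proof (rule Infinite_Sum.abs_summable_on_comparison_test')
  show "(\<lambda>k. (norm (f k))\<^sup>2 + (norm (g k))\<^sup>2) summable_on A"
    using assms by (intro summable_on_add)
  show "norm (inner (f k) (g k)) \<le> (norm (f k))\<^sup>2 + (norm (g k))\<^sup>2" for k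
  proof -
    have "norm (inner (f k) (g k)) \<le> norm (f k) * norm (g k)"
      by (simp add: Cauchy_Schwarz_ineq2)
    also have "\<dots> \<le> (norm (f k))\<^sup>2 + (norm (g k))\<^sup>2"
      using zero_le_power2[of "norm (f k) - norm (g k)"] mult_nonneg_nonneg[OF norm_ge_zero norm_ge_zero, of "f k" "g k"]
      by (simp add: power2_eq_square algebra_simps del: mult_nonneg_nonneg)
    finally show ?thesis .
  qed
qed

instantiation hseq :: (finite) real_inner
begin

definition zero_hseq :: "'a hseq" where "0 = hseq (\<lambda>_. 0)"
definition plus_hseq :: "'a hseq \<Rightarrow> 'a hseq \<Rightarrow> 'a hseq" where
  "a + b = hseq (\<lambda>k. coef a k + coef b k)"
definition minus_hseq :: "'a hseq \<Rightarrow> 'a hseq \<Rightarrow> 'a hseq" where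
  "a - b = hseq (\<lambda>k. coef a k - coef b k)"
definition uminus_hseq :: "'a hseq \<Rightarrow> 'a hseq" where "- a = hseq (\<lambda>k. - coef a k)"
definition scaleR_hseq :: "real \<Rightarrow> 'a hseq \<Rightarrow> 'a hseq" where
  "scaleR c a = hseq (\<lambda>k. c *\<^sub>R coef a k)"
definition inner_hseq :: "'a hseq \<Rightarrow> 'a hseq \<Rightarrow> real" where
  "inner a b = (\<Sum>\<^sub>\<infinity>k. inner (coef a k) (coef b k))"
definition norm_hseq :: "'a hseq \<Rightarrow> real" where "norm_hseq a = sqrt (inner a a)"
definition dist_hseq :: "'a hseq \<Rightarrow> 'a hseq \<Rightarrow> real" where "dist_hseq a b = norm (a - b)"
definition sgn_hseq :: "'a hseq \<Rightarrow> 'a hseq" where "sgn_hseq a = inverse (norm a) *\<^sub>R a"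
definition uniformity_hseq :: "('a hseq \<times> 'a hseq) filter" where
  "uniformity_hseq = (INF e\<in>{0<..}. principal {(x, y). dist x y < e})"
definition open_hseq :: "'a hseq set \<Rightarrow> bool" where
  "open_hseq U = (\<forall>x\<in>U. eventually (\<lambda>(x', y). x' = x \<longrightarrow> y \<in> U) uniformity)"

lemma coef_zero: "coef 0 k = 0"
  unfolding zero_hseq_def by (subst coef_hseq) auto

lemma coef_add: "coef (a + b) k = coef a k + coef b k"
  unfolding plus_hseq_def
  by (subst coef_hseq) (auto simp: coef_uminus intro!: summable_on_norm_sq_add summable_coef)

lemma coef_scaleR: "coef (c *\<^sub>R a) k = c *\<^sub>R coef a k"
  unfolding scaleR_hseq_def
  by (subst coef_hseq)
     (auto simp: coef_uminus power_mult_distrib intro!: summable_on_cmult_right summable_coef)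

lemma coef_neg: "coef (- a) k = - coef a k"
  unfolding uminus_hseq_def
  by (subst coef_hseq) (auto simp: coef_uminus intro!: summable_coef)

lemma coef_diff: "coef (a - b) k = coef a k - coef b k"
proof -
  have "a - b = a + (- b)"
    unfolding minus_hseq_def plus_hseq_def coef_neg by simp
  then show ?thesis by (simp add: coef_add coef_neg)
qed

instance
proof
  fix a b c :: "'a hseq" and r t :: real
  note [simp] = coef_zero coef_add coef_scaleR coef_neg coef_diff
  show "a + b + c = a + (b + c)" by (rule coef_eqI) simp
  show "a + b = b + a" by (rule coef_eqI) simp
  show "0 + a = a" by (rule coef_eqI) simp
  show "- a + a = 0" by (rule coef_eqI) simp
  show "a - b = a + - b" by (rule coef_eqI) simp
  show "r *\<^sub>R (a + b) = r *\<^sub>R a + r *\<^sub>R b" by (rule coef_eqI) (simp add: algebra_simps)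
  show "(r + t) *\<^sub>R a = r *\<^sub>R a + t *\<^sub>R a" by (rule coef_eqI) (simp add: algebra_simps)
  show "r *\<^sub>R t *\<^sub>R a = (r * t) *\<^sub>R a" by (rule coef_eqI) simp
  show "1 *\<^sub>R a = a" by (rule coef_eqI) simp
  have s: "(\<lambda>k. inner (coef a k) (coef b k)) summable_on UNIV" for a b :: "'a hseq"
    by (rule Infinite_Sum.abs_summable_summable[OF abs_summable_on_inner[OF summable_coef summable_coef]])
  show "inner a b = inner b a" unfolding inner_hseq_def by (simp add: inner_commute)
  show "inner (a + b) c = inner a c + inner b c"
    unfolding inner_hseq_def by (simp add: inner_add_left infsum_add s)
  show "inner (r *\<^sub>R a) b = r * inner a b"
    unfolding inner_hseq_def by (simp add: infsum_cmult_right')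
  show "inner a a \<ge> 0" unfolding inner_hseq_def by (simp add: infsum_nonneg)
  show "inner a a = 0 \<longleftrightarrow> a = 0"
  proof
    assume "inner a a = 0"
    then have "inner (coef a k) (coef a k) = 0" for k
      using s[of a a] unfolding inner_hseq_def by (intro nonneg_infsum_le_0D[where A = UNIV]) auto
    then show "a = 0" by (intro coef_eqI) simp
  qed (simp add: inner_hseq_def)
qed (auto simp: norm_hseq_def dist_hseq_def sgn_hseq_def uniformity_hseq_def open_hseq_def)

end

section \<open>Norm estimates, completeness and separability\<close>

lemma norm_hseq_sq: "(norm a)\<^sup>2 = (\<Sum>\<^sub>\<infinity>k. (norm (coef a k))\<^sup>2)" for a :: "'d::finite hseq"
  unfolding power2_norm_eq_inner inner_hseq_def ..

lemma norm_coef_le: "norm (coef a k) \<le> norm a" for a :: "'d::finite hseq"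
proof -
  have "(norm (coef a k))\<^sup>2 = (\<Sum>k\<in>{k}. (norm (coef a k))\<^sup>2)" by simp
  also have "\<dots> \<le> (norm a)\<^sup>2"
    unfolding norm_hseq_sq by (intro finite_sum_le_infsum summable_coef) auto
  finally show ?thesis by (rule power2_le_imp_le) simp
qed

lemma norm_hseq_leI:
  fixes a :: "'d::finite hseq"
  assumes "\<And>F. finite F \<Longrightarrow> (\<Sum>k\<in>F. (norm (coef a k))\<^sup>2) \<le> B\<^sup>2" "B \<ge> 0"
  shows "norm a \<le> B"
proof (rule power2_le_imp_le)
  show "(norm a)\<^sup>2 \<le> B\<^sup>2"
    unfolding norm_hseq_sq using assms(1) by (intro infsum_le_finite_sums summable_coef)
qed (rule assms(2))

lemma sum_norm_coef_le:
  fixes a :: "'d::finite hseq"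
  assumes "finite F"
  shows "(\<Sum>k\<in>F. (norm (coef a k))\<^sup>2) \<le> (norm a)\<^sup>2"
  unfolding norm_hseq_sq by (intro finite_sum_le_infsum summable_coef assms) auto

lemma bounded_linear_coef: "bounded_linear (\<lambda>a :: 'd::finite hseq. coef a k)"
  by (rule bounded_linear_intro[of _ 1]) (auto simp: coef_add coef_scaleR norm_coef_le)

text \<open>Coefficients converge one by one, and Cauchy bounds over finite sets of frequencies
  survive the limit. The same bound \<open>tail\<close> shows that the limit is square summable and
  that convergence holds in norm.\<close>

lemma hermitian_limit:
  fixes f :: "nat \<Rightarrow> 'd::finite hseq"
  assumes "Cauchy f"
  shows "\<exists>l. f \<longlonglongrightarrow> l"
proof -
  have "\<exists>c. (\<lambda>n. coef (f n) k) \<longlonglongrightarrow> c" for k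
    using bounded_linear.Cauchy[OF bounded_linear_coef assms, of k] Cauchy_convergent
    unfolding convergent_def by blast
  then obtain g where g: "\<And>k. (\<lambda>n. coef (f n) k) \<longlonglongrightarrow> g k" by metis
  have tail: "(\<Sum>k\<in>F. (norm (coef (f n) k - g k))\<^sup>2) \<le> e\<^sup>2"
    if e: "e \<ge> 0" "\<And>m. m \<ge> n \<Longrightarrow> norm (f n - f m) \<le> e" and F: "finite F" for n e F
  proof (rule LIMSEQ_le_const2)
    show "(\<lambda>m. \<Sum>k\<in>F. (norm (coef (f n) k - coef (f m) k))\<^sup>2) \<longlonglongrightarrow>
        (\<Sum>k\<in>F. (norm (coef (f n) k - g k))\<^sup>2)"
      by (intro tendsto_intros g)
    have "(\<Sum>k\<in>F. (norm (coef (f n) k - coef (f m) k))\<^sup>2) \<le> e\<^sup>2" if "m \<ge> n" for m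
      using sum_norm_coef_le[OF F, of "f n - f m"] power_mono[OF e(2)[OF that], of 2]
      by (simp add: coef_diff)
    then show "\<exists>N. \<forall>m\<ge>N. (\<Sum>k\<in>F. (norm (coef (f n) k - coef (f m) k))\<^sup>2) \<le> e\<^sup>2" by blast
  qed
  have herm: "g (- k) = cnj (g k)" for k
    using g[of "- k"] tendsto_cnj[OF g[of k]] by (auto simp: coef_uminus intro: LIMSEQ_unique)
  obtain N where N: "\<And>m n. m \<ge> N \<Longrightarrow> n \<ge> N \<Longrightarrow> norm (f m - f n) < 1"
    using assms unfolding Cauchy_iff by (metis zero_less_one)
  have "(\<lambda>k. (norm (coef (f N) k - g k))\<^sup>2) summable_on UNIV"
  proof (rule nonneg_bdd_above_summable_on)
    show "bdd_above (sum (\<lambda>k. (norm (coef (f N) k - g k))\<^sup>2) ` {F. F \<subseteq> UNIV \<and> finite F})"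
      using tail[of 1 N] N by (intro bdd_aboveI[of _ "1\<^sup>2"]) (auto intro: less_imp_le)
  qed simp
  from summable_on_norm_sq_add[OF summable_coef[of "- f N"] this]
  have "(\<lambda>k. (norm (g k))\<^sup>2) summable_on UNIV"
    by (simp add: coef_neg norm_minus_commute)
  then have cg: "coef (hseq g) = g" using herm by (intro coef_hseq)
  have "f \<longlonglongrightarrow> hseq g"
  proof (rule LIMSEQ_I)
    fix e :: real assume "e > 0"
    then have e: "e / 2 > 0" by simp
    obtain M where M: "\<And>m n. m \<ge> M \<Longrightarrow> n \<ge> M \<Longrightarrow> norm (f m - f n) < e / 2"
      using assms e unfolding Cauchy_iff by metis
    have "norm (f n - hseq g) \<le> e / 2" if "n \<ge> M" for n
    proof (rule norm_hseq_leI)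
      fix F :: "(int ^ 'd) set" assume "finite F"
      moreover have "norm (f n - f m) \<le> e / 2" if "m \<ge> n" for m
        using M[of n m] that \<open>n \<ge> M\<close> by simp
      ultimately show "(\<Sum>k\<in>F. (norm (coef (f n - hseq g) k))\<^sup>2) \<le> (e / 2)\<^sup>2"
        using tail[of "e / 2" n F] e by (simp add: coef_diff cg)
    qed (use e in simp)
    moreover have "e / 2 < e" using e by simp
    ultimately show "\<exists>M. \<forall>n\<ge>M. norm (f n - hseq g) < e"
      by (meson le_less_trans)
  qed
  then show ?thesis by blast
qed

instance hseq :: (finite) banach
  by standard (use hermitian_limit in \<open>auto simp: convergent_def\<close>)

lemma finite_approx_summable:
  fixes f :: "'a \<Rightarrow> real"
  assumes "f summable_on UNIV" "\<And>k. f k \<ge> 0" "e > 0"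
  obtains F where "finite F" "\<And>G. finite G \<Longrightarrow> G \<inter> F = {} \<Longrightarrow> sum f G < e"
proof -
  obtain F where F: "finite F" "dist (sum f F) (infsum f UNIV) \<le> e / 2"
    using infsum_finite_approximation[OF assms(1), of "e / 2"] assms(3) by auto
  show ?thesis
  proof (rule that[OF F(1)])
    fix G assume G: "finite G" "G \<inter> F = {}"
    have "sum f G + sum f F = sum f (G \<union> F)" using G F(1) by (simp add: sum.union_disjoint)
    also have "\<dots> \<le> infsum f UNIV" using G F(1) assms by (intro finite_sum_le_infsum) auto
    finally show "sum f G < e" using F(2) assms(3) unfolding dist_real_def by linarith
  qed
qed

lemma coef_tail:
  fixes a :: "'d::finite hseq"
  assumes "e > 0"
  obtains F where "finite F" "\<And>G. finite G \<Longrightarrow> G \<inter> F = {} \<Longrightarrow> (\<Sum>k\<in>G. (norm (coef a k))\<^sup>2) < e"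
  using finite_approx_summable[OF summable_coef[of a] _ assms] by auto

lemma coef_hseq_finite:
  assumes "\<And>k. f (- k) = cnj (f k)" "finite {k. f k \<noteq> 0}"
  shows "coef (hseq f) = f"
  using assms by (intro coef_hseq finite_nonzero_values_imp_summable_on) auto

text \<open>Separability: sequences with finite support and rational entries are dense. A rational
  approximation of the entries is symmetrised to make it Hermitian.\<close>

lemma hseq_separable: "\<exists>D :: 'd::finite hseq set. countable D \<and> (\<forall>a. \<forall>e>0. \<exists>x\<in>D. norm (a - x) < e)"
proof -
  \<comment> \<open>Decodes a list of frequencies with the rational real and imaginary parts of
    their values; such lists form a countable type.\<close>
  define R :: "((int ^ 'd) \<times> rat \<times> rat) list \<Rightarrow> int ^ 'd \<Rightarrow> complex" where
    "R l k = (case map_of l k of None \<Rightarrow> 0 | Some (r, t) \<Rightarrow> Complex (of_rat r) (of_rat t))" for l k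
  define D where "D = hseq ` (\<lambda>(l, m) k. (R l k + R m k) / 2) ` (UNIV :: (_ \<times> _) set)"
  have "countable D" unfolding D_def by (intro countable_image) auto
  moreover have "\<exists>x\<in>D. norm (a - x) < e" if "e > 0" for a :: "'d hseq" and e
  proof -
    obtain F where F: "finite F"
      "\<And>G. finite G \<Longrightarrow> G \<inter> F = {} \<Longrightarrow> (\<Sum>k\<in>G. (norm (coef a k))\<^sup>2) < e\<^sup>2 / 8"
      using coef_tail[of "e\<^sup>2 / 8" a] \<open>e > 0\<close> by auto
    define S where "S = F \<union> uminus ` F"
    have S: "finite S" "\<And>k. - k \<in> S \<longleftrightarrow> k \<in> S"
      using F(1) unfolding S_def by (auto simp: image_iff) (metis minus_minus)+
    \<comment> \<open>The errors on \<open>S\<close> then sum to at most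
      \<open>e\<^sup>2 / 4\<close>; with the tail \<open>e\<^sup>2 / 8\<close> the total stays below
      \<open>e\<^sup>2\<close>.\<close>
    define d where "d = e / (2 * sqrt (real (card S) + 1))"
    have "d > 0" using \<open>e > 0\<close> by (simp add: d_def add_nonneg_pos)
    have "\<exists>r t. norm (coef a k - Complex (of_rat r) (of_rat t)) < d" for k
    proof -
      obtain r where r: "Re (coef a k) - d / 2 < of_rat r" "of_rat r < Re (coef a k) + d / 2"
        using of_rat_dense[of "Re (coef a k) - d / 2" "Re (coef a k) + d / 2"] \<open>d > 0\<close> by auto
      obtain t where t: "Im (coef a k) - d / 2 < of_rat t" "of_rat t < Im (coef a k) + d / 2"
        using of_rat_dense[of "Im (coef a k) - d / 2" "Im (coef a k) + d / 2"] \<open>d > 0\<close> by auto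
      have "norm (coef a k - Complex (of_rat r) (of_rat t)) \<le>
          \<bar>Re (coef a k - Complex (of_rat r) (of_rat t))\<bar> + \<bar>Im (coef a k - Complex (of_rat r) (of_rat t))\<bar>"
        by (rule cmod_le)
      also have "\<dots> < d" using r t by simp
      finally show ?thesis by blast
    qed
    then obtain r t where rt: "\<And>k. norm (coef a k - Complex (of_rat (r k)) (of_rat (t k))) < d"
      by metis
    obtain ks where ks: "set ks = S" "distinct ks" using finite_distinct_list S(1) by blast
    define q where "q k = (if k \<in> S then Complex (of_rat (r k)) (of_rat (t k)) else 0)" for k
    define h where "h k = (q k + cnj (q (- k))) / 2" for k
    define l where "l = map (\<lambda>k. (k, r k, t k)) ks"
    \<comment> \<open>\<open>l\<close> codes \<open>q\<close> and \<open>m\<close> codes the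
      reflected conjugate \<open>cnj (q (- k))\<close>, so the symmetrised \<open>h\<close> is still
      given by a pair of lists.\<close>
    define m where "m = map (\<lambda>k. (k, r (- k), - t (- k))) ks"
    have map_of_map: "map_of (map (\<lambda>k. (k, f k)) xs) k = (if k \<in> set xs then Some (f k) else None)"
      for f :: "int ^ 'd \<Rightarrow> rat \<times> rat" and xs k
      by (induction xs) auto
    have "R l k = q k" for k
      unfolding R_def l_def q_def map_of_map using ks by auto
    moreover have "R m k = cnj (q (- k))" for k
      unfolding R_def m_def q_def map_of_map using ks S(2) by (auto simp: complex_cnj of_rat_minus)
    ultimately have "h = (\<lambda>(l, m) k. (R l k + R m k) / 2) (l, m)"
      by (simp add: h_def fun_eq_iff)
    then have "hseq h \<in> D" unfolding D_def by blast
    moreover have "norm (a - hseq h) < e"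
    proof -
      have hz: "h k = 0" if "k \<notin> S" for k using that S(2) by (simp add: h_def q_def)
      have ch: "coef (hseq h) = h"
      proof (rule coef_hseq_finite)
        show "h (- k) = cnj (h k)" for k by (simp add: h_def)
        show "finite {k. h k \<noteq> 0}" by (rule finite_subset[OF _ S(1)]) (use hz in blast)
      qed
      have hd: "norm (coef a k - h k) \<le> d" if "k \<in> S" for k
      proof -
        have "coef a k - h k = ((coef a k - q k) + cnj (coef a (- k) - q (- k))) / 2"
          unfolding h_def coef_uminus by (simp add: field_simps)
        also have "norm \<dots> \<le> (norm (coef a k - q k) + norm (cnj (coef a (- k) - q (- k)))) / 2"
          by (simp add: norm_divide divide_right_mono norm_triangle_ineq)
        also have "\<dots> \<le> d"
          using rt[of k] rt[of "- k"] that S(2) unfolding q_def complex_mod_cnj by simp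
        finally show ?thesis .
      qed
      have "norm (a - hseq h) \<le> sqrt (e\<^sup>2 / 8 + e\<^sup>2 / 4)"
      proof (rule norm_hseq_leI)
        fix G :: "(int ^ 'd) set" assume G: "finite G"
        have "(\<Sum>k\<in>G. (norm (coef (a - hseq h) k))\<^sup>2) =
            (\<Sum>k\<in>G - S. (norm (coef (a - hseq h) k))\<^sup>2) + (\<Sum>k\<in>G \<inter> S. (norm (coef (a - hseq h) k))\<^sup>2)"
          using G by (subst sum.union_disjoint[symmetric]) (auto intro: sum.cong)
        also have "(\<Sum>k\<in>G - S. (norm (coef (a - hseq h) k))\<^sup>2) = (\<Sum>k\<in>G - S. (norm (coef a k))\<^sup>2)"
          by (intro sum.cong) (auto simp: coef_diff ch hz)
        also have "\<dots> \<le> e\<^sup>2 / 8" using F(2)[of "G - S"] G unfolding S_def by force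
        also have "(\<Sum>k\<in>G \<inter> S. (norm (coef (a - hseq h) k))\<^sup>2) \<le> (\<Sum>k\<in>G \<inter> S. d\<^sup>2)"
          by (intro sum_mono power_mono) (auto simp: coef_diff ch hd)
        also have "\<dots> \<le> real (card S) * d\<^sup>2"
          using S(1) by (simp add: mult_right_mono card_mono)
        also have "\<dots> \<le> e\<^sup>2 / 4"
        proof -
          have "d\<^sup>2 = e\<^sup>2 / (4 * (real (card S) + 1))"
            by (simp add: d_def power_divide power_mult_distrib)
          then have "real (card S) * d\<^sup>2 + d\<^sup>2 = e\<^sup>2 / 4" by (simp add: field_simps)
          then show ?thesis using zero_le_power2[of d] by linarith
        qed
        finally show "(\<Sum>k\<in>G. (norm (coef (a - hseq h) k))\<^sup>2) \<le> (sqrt (e\<^sup>2 / 8 + e\<^sup>2 / 4))\<^sup>2" by simp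
      qed simp
      also have "\<dots> < e" using \<open>e > 0\<close> by (intro real_less_lsqrt) (auto simp: power2_eq_square)
      finally show ?thesis .
    qed
    ultimately show ?thesis by blast
  qed
  ultimately show ?thesis by blast
qed

text \<open>Bochner integrals with values in \<open>'d hseq\<close> ask for this class. Balls of
  radius \<open>1 / Suc n\<close> around a countable dense set form a basis.\<close>

instance hseq :: (finite) second_countable_topology
proof
  obtain D :: "'a hseq set" where D: "countable D" "\<And>a e. e > 0 \<Longrightarrow> \<exists>x\<in>D. norm (a - x) < e"
    using hseq_separable by blast
  define B where "B = (\<lambda>(x, n). ball x (1 / real (Suc n))) ` (D \<times> (UNIV :: nat set))"
  have "countable B" unfolding B_def by (intro countable_image countable_SIGMA D) auto
  moreover have "topological_basis B"
  proof (rule topological_basisI)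
    fix U :: "'a hseq set" and a assume U: "open U" "a \<in> U"
    then obtain e where e: "e > 0" "ball a e \<subseteq> U" by (auto simp: open_contains_ball)
    obtain n where n: "1 / real (Suc n) < e / 2"
      using nat_approx_posE[of "e / 2"] e by auto
    obtain x where x: "x \<in> D" "norm (a - x) < 1 / real (Suc n)" using D(2)[of "1 / real (Suc n)" a] by auto
    have "ball x (1 / real (Suc n)) \<subseteq> U"
    proof
      fix y assume y: "y \<in> ball x (1 / real (Suc n))"
      have "dist a y \<le> dist a x + dist x y" by (rule dist_triangle)
      also have "\<dots> < e" using x(2) y n by (simp add: dist_norm)
      finally show "y \<in> U" using e(2) by auto
    qed
    then show "\<exists>B'\<in>B. a \<in> B' \<and> B' \<subseteq> U"
      using x unfolding B_def
      by (intro bexI[of _ "ball x (1 / real (Suc n))"]) (auto simp: dist_norm norm_minus_commute)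
  qed (auto simp: B_def)
  ultimately show "\<exists>B :: 'a hseq set set. countable B \<and> open = generate_topology B"
    using topological_basis_imp_subbasis by blast
qed

subsection \<open>Sums over the lattice\<close>

lemma summable_on_int_powr:
  assumes "r > 1 / 2"
  shows "(\<lambda>n :: int. (1 + (real_of_int n)\<^sup>2) powr (- r)) summable_on UNIV"
proof -
  let ?f = "\<lambda>n :: int. (1 + (real_of_int n)\<^sup>2) powr (- r)"
  have nat: "(\<lambda>n :: nat. ?f (int n)) summable_on UNIV"
  proof -
    have "summable (\<lambda>n :: nat. ?f (int n))"
    proof (rule summable_comparison_test_ev)
      show "summable (\<lambda>n. real n powr (- 2 * r))" using assms by (simp add: summable_real_powr_iff)
      have "norm (?f (int n)) \<le> real n powr (- 2 * r)" if "n \<ge> 1" for n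
      proof -
        have "?f (int n) \<le> ((real n)\<^sup>2) powr (- r)"
          using that assms by (intro powr_mono2') auto
        also have "\<dots> = real n powr (- 2 * r)"
          using that by (simp add: powr_powr flip: powr_numeral)
        finally show ?thesis by simp
      qed
      then show "\<forall>\<^sub>F n in sequentially. norm (?f (int n)) \<le> real n powr (- 2 * r)"
        by (auto simp: eventually_sequentially)
    qed
    then show ?thesis by (subst summable_on_UNIV_nonneg_real_iff) auto
  qed
  have "?f summable_on range int"
    using nat by (subst summable_on_reindex) (auto simp: o_def)
  moreover have "?f summable_on range (\<lambda>n. - int n)"
    using nat by (subst summable_on_reindex) (auto simp: o_def inj_on_def)
  ultimately have "?f summable_on (range int \<union> range (\<lambda>n. - int n))"
    by (rule summable_on_union)
  moreover have "range int \<union> range (\<lambda>n. - int n) = UNIV"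
  proof -
    have "n \<in> range int \<union> range (\<lambda>n. - int n)" for n
      by (cases n rule: int_cases2) auto
    then show ?thesis by blast
  qed
  ultimately show ?thesis by simp
qed

text \<open>A finite set of lattice points lies in a box, and over a box the sum of products is a
  product of one-dimensional sums.\<close>

lemma summable_on_prod_vec:
  fixes g :: "'a \<Rightarrow> real"
  assumes "g summable_on UNIV" "\<And>n. g n \<ge> 0"
  shows "(\<lambda>k :: 'a ^ 'd::finite. \<Prod>i\<in>UNIV. g (k $ i)) summable_on UNIV"
proof (rule nonneg_bdd_above_summable_on)
  show "(\<Prod>i\<in>UNIV. g (k $ i)) \<ge> 0" for k :: "'a ^ 'd" using assms(2) by (simp add: prod_nonneg)
  have "(\<Sum>k\<in>F. \<Prod>i\<in>UNIV. g (k $ i)) \<le> (infsum g UNIV) ^ CARD('d)" if F: "finite F" for F :: "('a ^ 'd) set"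
  proof -
    define A where "A = (\<Union>i. (\<lambda>k. k $ i) ` F)"
    have A: "finite A" using F by (simp add: A_def)
    have "(\<Sum>k\<in>F. \<Prod>i\<in>UNIV. g (k $ i)) = (\<Sum>f\<in>(\<lambda>k. vec_nth k) ` F. \<Prod>i\<in>UNIV. g (f i))"
      by (subst sum.reindex) (auto simp: inj_on_def vec_nth_inject)
    also have "\<dots> \<le> (\<Sum>f\<in>PiE (UNIV :: 'd set) (\<lambda>_. A). \<Prod>i\<in>UNIV. g (f i))"
    proof (rule sum_mono2)
      show "finite (PiE (UNIV :: 'd set) (\<lambda>_. A))" using A by (intro finite_PiE) auto
    qed (auto simp: A_def prod_nonneg assms(2))
    also have "\<dots> = (\<Prod>i\<in>(UNIV :: 'd set). \<Sum>n\<in>A. g n)"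
      using A by (subst prod_sum_PiE) auto
    also have "\<dots> \<le> (\<Prod>i\<in>(UNIV :: 'd set). infsum g UNIV)"
      using A assms by (intro prod_mono conjI sum_nonneg finite_sum_le_infsum) auto
    finally show ?thesis by simp
  qed
  then show "bdd_above (sum (\<lambda>k :: 'a ^ 'd. \<Prod>i\<in>UNIV. g (k $ i)) ` {F. F \<subseteq> UNIV \<and> finite F})"
    by (intro bdd_aboveI[of _ "(infsum g UNIV) ^ CARD('d)"]) auto
qed

lemma freq_sq_nonneg: "freq_sq k \<ge> 0"
  by (simp add: freq_sq_def sum_nonneg)

lemma freq_sq_uminus: "freq_sq (- k) = freq_sq k"
  by (simp add: freq_sq_def)

lemma coord_sq_le_freq_sq: "(real_of_int (k $ i))\<^sup>2 \<le> freq_sq k"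
  unfolding freq_sq_def by (rule member_le_sum) auto

text \<open>\<open>1 + freq_sq k\<close> dominates every \<open>1 + (k $ i)\<^sup>2\<close>, so the
  summand is at most a product of one-dimensional terms with exponent \<open>r = s / d\<close>,
  which exceeds 1/2.\<close>

lemma summable_on_lattice:
  assumes "real s > real CARD('d) / 2"
  shows "(\<lambda>k :: int ^ 'd::finite. 1 / (1 + freq_sq k) ^ s) summable_on UNIV"
proof (rule summable_on_comparison_test)
  define r where "r = real s / real CARD('d)"
  have r: "r > 1 / 2" "r \<ge> 0" using assms by (auto simp: r_def field_simps)
  show "(\<lambda>k :: int ^ 'd. \<Prod>i\<in>UNIV. (1 + (real_of_int (k $ i))\<^sup>2) powr (- r)) summable_on UNIV"
    by (intro summable_on_prod_vec summable_on_int_powr r) auto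
  show "1 / (1 + freq_sq k) ^ s \<le> (\<Prod>i\<in>UNIV. (1 + (real_of_int (k $ i))\<^sup>2) powr (- r))" for k :: "int ^ 'd"
  proof -
    have pos: "1 + freq_sq k > 0" using freq_sq_nonneg[of k] by linarith
    have "(1 + freq_sq k) powr (- r) \<le> (1 + (real_of_int (k $ i))\<^sup>2) powr (- r)" for i
      using r coord_sq_le_freq_sq[of k i] by (intro powr_mono2') (auto simp: add_pos_nonneg)
    then have "(\<Prod>i\<in>(UNIV :: 'd set). (1 + freq_sq k) powr (- r)) \<le> (\<Prod>i\<in>UNIV. (1 + (real_of_int (k $ i))\<^sup>2) powr (- r))"
      by (intro prod_mono) auto
    moreover have "((1 + freq_sq k) powr (- r)) ^ CARD('d) = 1 / (1 + freq_sq k) ^ s"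
    proof -
      have "((1 + freq_sq k) powr (- r)) ^ CARD('d) = ((1 + freq_sq k) powr (- r)) powr real CARD('d)"
        using pos by (subst powr_realpow) auto
      also have "\<dots> = (1 + freq_sq k) powr (- real s)" by (simp add: powr_powr r_def)
      finally show ?thesis using pos by (simp add: powr_minus powr_realpow divide_inverse)
    qed
    ultimately show ?thesis by simp
  qed
qed (simp add: freq_sq_nonneg add_nonneg_nonneg)

lemma has_sum_times_UNIV:
  fixes f :: "'a \<Rightarrow> 'c::{banach, real_normed_field}" and g :: "'b \<Rightarrow> 'c"
  assumes "(\<lambda>k. norm (f k)) summable_on UNIV" "(\<lambda>l. norm (g l)) summable_on UNIV"
  shows "((\<lambda>(k, l). f k * g l) has_sum (infsum f UNIV * infsum g UNIV)) (UNIV \<times> UNIV)"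
    and "(\<lambda>p. norm (case p of (k, l) \<Rightarrow> f k * g l)) summable_on (UNIV \<times> UNIV)"
proof -
  have eq: "norm (\<Sum>\<^sub>\<infinity>l. norm (f k * g l)) = norm (f k) * (\<Sum>\<^sub>\<infinity>l. norm (g l))" for k
    by (simp add: norm_mult infsum_cmult_right' abs_mult infsum_nonneg)
  show "(\<lambda>p. norm (case p of (k, l) \<Rightarrow> f k * g l)) summable_on (UNIV \<times> UNIV)"
    unfolding Infinite_Sum.abs_summable_on_Sigma_iff
    using assms eq by (auto simp: norm_mult intro!: summable_on_cmult_right summable_on_cmult_left)
  then have sm: "(\<lambda>(k, l). f k * g l) summable_on (UNIV \<times> UNIV)"
    by (rule Infinite_Sum.abs_summable_summable)
  have "infsum (\<lambda>(k, l). f k * g l) (UNIV \<times> UNIV) = (\<Sum>\<^sub>\<infinity>k. \<Sum>\<^sub>\<infinity>l. f k * g l)"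
    using infsum_Sigma'_banach[OF sm] by simp
  also have "\<dots> = infsum f UNIV * infsum g UNIV"
    by (simp add: infsum_cmult_right' infsum_cmult_left')
  finally show "((\<lambda>(k, l). f k * g l) has_sum (infsum f UNIV * infsum g UNIV)) (UNIV \<times> UNIV)"
    using sm by (simp add: has_sum_iff)
qed

text \<open>The double series of the product, reindexed by the bijection
  \<open>(m, k) \<mapsto> (k, m - k)\<close>.\<close>

lemma has_sum_convolution:
  fixes f g :: "'a::ab_group_add \<Rightarrow> 'c::{banach, real_normed_field}"
  assumes "(\<lambda>k. norm (f k)) summable_on UNIV" "(\<lambda>l. norm (g l)) summable_on UNIV"
  shows "((\<lambda>m. \<Sum>\<^sub>\<infinity>k. f k * g (m - k)) has_sum (infsum f UNIV * infsum g UNIV)) UNIV"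
    and "(\<lambda>k. norm (f k * g (m - k))) summable_on UNIV"
proof -
  have bij: "bij_betw (\<lambda>(m, k). (k, m - k)) (UNIV \<times> UNIV) (UNIV \<times> (UNIV :: 'a set))"
    by (rule bij_betw_byWitness[of _ "\<lambda>(k, l). (k + l, k)"]) auto
  have "(\<lambda>p. norm (case case p of (m, k) \<Rightarrow> (k, m - k) of (k, l) \<Rightarrow> f k * g l)) summable_on (UNIV \<times> UNIV)"
    using has_sum_times_UNIV(2)[OF assms]
    by (subst summable_on_reindex_bij_betw[OF bij, where f = "\<lambda>p. norm (case p of (k, l) \<Rightarrow> f k * g l)"])
  then have abs: "(\<lambda>p. norm (case p of (m, k) \<Rightarrow> f k * g (m - k))) summable_on (UNIV \<times> UNIV)"
    by (simp add: case_prod_beta)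
  show "(\<lambda>k. norm (f k * g (m - k))) summable_on UNIV"
    using abs unfolding Infinite_Sum.abs_summable_on_Sigma_iff by simp
  have hs: "((\<lambda>(m, k). f k * g (m - k)) has_sum (infsum f UNIV * infsum g UNIV)) (UNIV \<times> UNIV)"
    using has_sum_times_UNIV(1)[OF assms]
    by (subst (asm) has_sum_reindex_bij_betw[OF bij, symmetric]) (simp add: case_prod_unfold)
  then have sm: "(\<lambda>(m, k). f k * g (m - k)) summable_on (UNIV \<times> UNIV)"
    by (simp add: has_sum_iff)
  show "((\<lambda>m. \<Sum>\<^sub>\<infinity>k. f k * g (m - k)) has_sum (infsum f UNIV * infsum g UNIV)) UNIV"
    using infsum_Sigma'_banach[OF sm] summable_on_Sigma_banach[OF sm] hs
    by (simp add: has_sum_iff)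
qed

lemma infsum_Cauchy_Schwarz:
  fixes u v :: "'a \<Rightarrow> real"
  assumes "(\<lambda>k. (u k)\<^sup>2) summable_on A" "(\<lambda>k. (v k)\<^sup>2) summable_on A"
  shows "(\<lambda>k. \<bar>u k * v k\<bar>) summable_on A"
    and "(\<Sum>\<^sub>\<infinity>k\<in>A. \<bar>u k * v k\<bar>) \<le> sqrt (\<Sum>\<^sub>\<infinity>k\<in>A. (u k)\<^sup>2) * sqrt (\<Sum>\<^sub>\<infinity>k\<in>A. (v k)\<^sup>2)"
proof -
  let ?B = "sqrt (\<Sum>\<^sub>\<infinity>k\<in>A. (u k)\<^sup>2) * sqrt (\<Sum>\<^sub>\<infinity>k\<in>A. (v k)\<^sup>2)"
  have fin: "(\<Sum>k\<in>F. \<bar>u k * v k\<bar>) \<le> ?B" if F: "finite F" "F \<subseteq> A" for F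
  proof -
    have "(\<Sum>k\<in>F. \<bar>u k * v k\<bar>) \<le> L2_set u F * L2_set v F"
      using L2_set_mult_ineq[of u v F] by (simp add: abs_mult)
    also have "\<dots> \<le> ?B" unfolding L2_set_def
      using assms F by (intro mult_mono real_sqrt_le_mono finite_sum_le_infsum) (auto simp: infsum_nonneg sum_nonneg)
    finally show ?thesis .
  qed
  show "(\<lambda>k. \<bar>u k * v k\<bar>) summable_on A"
    using fin by (intro nonneg_bdd_above_summable_on bdd_aboveI[of _ ?B]) auto
  then show "(\<Sum>\<^sub>\<infinity>k\<in>A. \<bar>u k * v k\<bar>) \<le> ?B"
    using fin by (intro infsum_le_finite_sums)
qed

subsection \<open>Characters\<close>

lemma norm_character [simp]: "norm (character k x) = 1"
  by (simp add: character_def)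

lemma character_add: "character (k + l) x = character k x * character l x"
  by (simp add: character_def cis_mult sum.distrib ring_distribs)

lemma character_add_arg: "character k (x + y) = character k x * character k y"
  by (simp add: character_def cis_mult sum.distrib ring_distribs)

lemma character_zero [simp]: "character 0 x = 1"
  by (simp add: character_def)

lemma character_uminus: "character (- k) x = cnj (character k x)"
  by (simp add: character_def cis_cnj sum_negf)

lemma character_diff: "character (k - l) x = character k x * cnj (character l x)"
  using character_add[of k "- l" x] by (simp add: character_uminus)

lemma continuous_on_character [continuous_intros]:
  "continuous_on S f \<Longrightarrow> continuous_on S (\<lambda>x. character k (f x))"
  unfolding character_def by (intro continuous_intros)

lemma character_periodic: "character k (x + axis i (2 * pi)) = character k x"
proof -
  have "(\<Sum>j\<in>UNIV. real_of_int (k $ j) * axis i (2 * pi) $ j) = (\<Sum>j\<in>{i}. real_of_int (k $ j) * axis i (2 * pi) $ j)"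
    by (rule sum.mono_neutral_right) (auto simp: axis_def)
  then have "character k (axis i (2 * pi)) = cis (real_of_int (k $ i) * (2 * pi))"
    by (simp add: character_def axis_def)
  also have "\<dots> = 1" using cis_multiple_2pi[of "real_of_int (k $ i)"] by (simp add: mult.commute)
  finally show ?thesis by (simp add: character_add_arg)
qed

lemma integral_cis_int:
  "(LINT t|lborel. indicator {0..2 * pi} t *\<^sub>R cis (real_of_int n * t)) = (if n = 0 then 2 * pi else 0)"
proof (cases "n = 0")
  case False
  have "has_bochner_integral lborel (\<lambda>t. indicator {0..2 * pi} t *\<^sub>R cis (real_of_int n * t))
      (cis (real_of_int n * (2 * pi)) / (\<i> * n) - cis (real_of_int n * 0) / (\<i> * n))"
  proof (rule has_bochner_integral_FTC_Icc)
    show "((\<lambda>t. cis (real_of_int n * t) / (\<i> * n)) has_vector_derivative cis (real_of_int n * t)) (at t within {0..2 * pi})"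
      if "0 \<le> t" "t \<le> 2 * pi" for t
    proof -
      have "((\<lambda>z. exp (\<i> * (of_int n * z)) / (\<i> * of_int n)) has_field_derivative exp (\<i> * (of_int n * of_real t))) (at (of_real t))"
        using False by (auto intro!: derivative_eq_intros simp: field_simps)
      from has_vector_derivative_real_field[OF this]
      show ?thesis by (simp add: cis_conv_exp)
    qed
  qed (auto intro!: continuous_intros)
  moreover have "cis (real_of_int n * (2 * pi)) = 1"
    using cis_multiple_2pi[of "real_of_int n"] by (simp add: mult.commute)
  ultimately show ?thesis using False by (simp add: has_bochner_integral_iff)
qed (simp add: scaleR_conv_of_real)

lemma cis_sum: "finite A \<Longrightarrow> cis (\<Sum>i\<in>A. f i) = (\<Prod>i\<in>A. cis (f i))"
  by (induction A rule: finite_induct) (simp_all add: cis_mult[symmetric])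

text \<open>Lebesgue measure is the image of a product measure over \<open>Basis\<close>, on which
  both the indicator of the cell and the character factorise. The result is the orthogonality of
  characters.\<close>

lemma integral_character:
  "(LINT x|lebesgue_on torus_cell. character (k :: int ^ 'd::finite) x) = (if k = 0 then (2 * pi) ^ CARD('d) else 0)"
proof -
  let ?ax = "\<lambda>i :: 'd. axis i (1 :: real)"
  have inj: "inj ?ax" by (auto simp: inj_on_def axis_eq_axis)
  have B: "(Basis :: (real ^ 'd) set) = range ?ax" by (auto simp: Basis_vec_def)
  define n where "n b = k $ (inv ?ax b)" for b
  have n: "n (?ax i) = k $ i" for i unfolding n_def using inv_f_f[OF inj] by simp
  have cell: "(torus_cell :: (real ^ 'd) set) = {x. \<forall>i. x $ i \<in> {0..2 * pi}}"
    by (auto simp: torus_cell_def mem_box_cart)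
  have bor: "torus_cell \<in> sets (borel :: (real ^ 'd) measure)" by (simp add: torus_cell_def)
  have "(LINT x|lebesgue_on torus_cell. character k x) = (LINT x|lborel. indicator torus_cell x *\<^sub>R character k x)"
  proof -
    have "character k \<in> borel_measurable borel"
      by (intro borel_measurable_continuous_onI continuous_intros)
    then show ?thesis
      using bor by (subst integral_restrict_space) (auto simp: integral_completion)
  qed
  also have "\<dots> = (LINT f|(\<Pi>\<^sub>M b\<in>Basis. lborel). (\<Prod>b\<in>(Basis :: (real ^ 'd) set). indicator {0..2 * pi} (f b) *\<^sub>R cis (real_of_int (n b) * f b)))"
  proof -
    have "(\<lambda>x. indicator torus_cell x *\<^sub>R character k x) \<in> borel_measurable borel"
      using bor by (intro borel_measurable_scaleR borel_measurable_indicator borel_measurable_continuous_onI continuous_intros) auto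
    then have "(LINT x|lborel. indicator torus_cell x *\<^sub>R character k x) =
        (LINT f|(\<Pi>\<^sub>M b\<in>Basis. lborel). indicator torus_cell (\<Sum>b\<in>Basis. f b *\<^sub>R b) *\<^sub>R character k (\<Sum>b\<in>Basis. f b *\<^sub>R b))"
      by (subst lborel_eq) (intro integral_distr, auto)
    also have "\<dots> = (LINT f|(\<Pi>\<^sub>M b\<in>Basis. lborel). (\<Prod>b\<in>(Basis :: (real ^ 'd) set). indicator {0..2 * pi} (f b) *\<^sub>R cis (real_of_int (n b) * f b)))"
    proof (intro Bochner_Integration.integral_cong refl)
      fix f :: "real ^ 'd \<Rightarrow> real"
      have nth: "(\<Sum>b\<in>Basis. f b *\<^sub>R b) $ i = f (?ax i)" for i
      proof -
        have "(\<Sum>b\<in>Basis. f b *\<^sub>R b) $ i = (\<Sum>j\<in>UNIV. f (?ax j) * (?ax j $ i))"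
          unfolding B by (subst sum.reindex[OF inj]) simp
        also have "\<dots> = (\<Sum>j\<in>{i}. f (?ax j) * (?ax j $ i))"
          by (rule sum.mono_neutral_right) (auto simp: axis_def)
        finally show ?thesis by (simp add: axis_def)
      qed
      have ind: "indicator torus_cell (\<Sum>b\<in>Basis. f b *\<^sub>R b) = (\<Prod>i\<in>(UNIV :: 'd set). indicator {0..2 * pi} (f (?ax i)) :: real)"
      proof (cases "\<forall>i. f (?ax i) \<in> {0..2 * pi}")
        case True
        then have "(\<Sum>b\<in>Basis. f b *\<^sub>R b) \<in> torus_cell" unfolding cell mem_Collect_eq nth .
        then show ?thesis using True by simp
      next
        case False
        then have "(\<Prod>i\<in>(UNIV :: 'd set). indicator {0..2 * pi} (f (?ax i)) :: real) = 0"
          by (auto simp: prod_zero_iff indicator_def)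
        moreover have "(\<Sum>b\<in>Basis. f b *\<^sub>R b) \<notin> torus_cell"
          using False unfolding cell mem_Collect_eq nth .
        ultimately show ?thesis by simp
      qed
      show "indicator torus_cell (\<Sum>b\<in>Basis. f b *\<^sub>R b) *\<^sub>R character k (\<Sum>b\<in>Basis. f b *\<^sub>R b)
          = (\<Prod>b\<in>(Basis :: (real ^ 'd) set). indicator {0..2 * pi} (f b) *\<^sub>R cis (real_of_int (n b) * f b))"
      proof -
        have chr: "character k (\<Sum>b\<in>Basis. f b *\<^sub>R b) = (\<Prod>i\<in>UNIV. cis (real_of_int (k $ i) * f (?ax i)))"
          unfolding character_def nth by (simp add: cis_sum)
        have "(\<Prod>b\<in>(Basis :: (real ^ 'd) set). indicator {0..2 * pi} (f b) *\<^sub>R cis (real_of_int (n b) * f b))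
          = (\<Prod>i\<in>UNIV. of_real (indicator {0..2 * pi} (f (?ax i))) * cis (real_of_int (k $ i) * f (?ax i)))"
          unfolding B prod.reindex[OF inj] by (simp add: n scaleR_conv_of_real[where 'a = complex])
        then show ?thesis
          unfolding ind chr by (simp add: scaleR_conv_of_real[where 'a = complex] prod.distrib)
      qed
    qed
    finally show ?thesis .
  qed
  also have "\<dots> = (\<Prod>b\<in>(Basis :: (real ^ 'd) set). (LINT t|lborel. indicator {0..2 * pi} t *\<^sub>R cis (real_of_int (n b) * t)))"
  proof -
    interpret product_sigma_finite "\<lambda>_ :: real ^ 'd. lborel :: real measure" ..
    have "integrable lborel (\<lambda>t. indicator {0..2 * pi} t *\<^sub>R cis (real_of_int m * t))" for m
      using borel_integrable_compact[of "{0..2 * pi}" "\<lambda>t. cis (real_of_int m * t)"]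
      by (simp add: set_integrable_def continuous_intros)
    then show ?thesis by (intro product_integral_prod) auto
  qed
  also have "\<dots> = (\<Prod>i\<in>(UNIV :: 'd set). if k $ i = 0 then 2 * pi else 0)"
    unfolding B integral_cis_int by (subst prod.reindex[OF inj]) (simp add: n)
  also have "\<dots> = (if k = 0 then (2 * pi) ^ CARD('d) else 0)"
    by (auto simp: vec_eq_iff prod_zero_iff)
  finally show ?thesis .
qed

subsection \<open>Sobolev functions as weighted Fourier sequences\<close>

lemma cont_integrable_cell:
  fixes f :: "real ^ 'd::finite \<Rightarrow> 'b::euclidean_space"
  assumes "continuous_on UNIV f"
  shows "integrable (lebesgue_on torus_cell) f"
  unfolding torus_cell_def
  using assms by (intro continuous_imp_integrable) (auto intro: continuous_on_subset)

lemma measure_cell: "measure (lebesgue_on (torus_cell :: (real ^ 'd::finite) set)) (space (lebesgue_on torus_cell)) = (2 * pi) ^ CARD('d)"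
proof -
  have "measure lborel (cbox (0 :: real ^ 'd) (\<chi> i. 2 * pi)) = (2 * pi) ^ CARD('d)"
    by (subst content_cbox_cart) (auto simp: interval_ne_empty_cart)
  then show ?thesis by (simp add: torus_cell_def measure_restrict_space space_restrict_space)
qed

lemma norm_integral_cell_le:
  fixes f :: "real ^ 'd::finite \<Rightarrow> 'b::euclidean_space"
  assumes "\<And>x. norm (f x) \<le> B"
  shows "norm (LINT x|lebesgue_on torus_cell. f x) \<le> (2 * pi) ^ CARD('d) * B"
proof (cases "integrable (lebesgue_on torus_cell) f")
  case True
  interpret finite_measure "lebesgue_on (torus_cell :: (real ^ 'd) set)"
    by (rule finite_measureI)
       (simp add: torus_cell_def space_restrict_space emeasure_restrict_space emeasure_lborel_cbox_eq)
  have "norm (LINT x|lebesgue_on torus_cell. f x) \<le> (LINT x|lebesgue_on torus_cell. norm (f x))" by simp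
  also have "\<dots> \<le> (LINT x|lebesgue_on (torus_cell :: (real ^ 'd) set). B)"
    using True assms by (intro integral_mono) auto
  finally show ?thesis by (simp add: measure_cell[simplified])
next
  case False
  then show ?thesis using order_trans[OF norm_ge_zero assms]
    by (simp add: not_integrable_integral_eq)
qed

text \<open>Absolute summability makes the series converge uniformly, so it can be integrated
  termwise against a character; orthogonality keeps only the term \<open>k\<close>.\<close>

lemma fourier_coeff_of_uniform_sum:
  fixes f :: "real ^ 'd::finite \<Rightarrow> real"
  assumes cont: "continuous_on UNIV f"
    and sum: "\<And>x. ((\<lambda>k. c k * character k x) has_sum complex_of_real (f x)) UNIV"
    and abs: "(\<lambda>k. norm (c k)) summable_on UNIV"
  shows "fourier_coeff f k = c k"
proof -
  let ?M = "lebesgue_on (torus_cell :: (real ^ 'd) set)"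
  have vol: "(2 * pi) ^ CARD('d) > 0" by simp
  have ul: "uniform_limit UNIV (\<lambda>F x. \<Sum>l\<in>F. c l * character l x) (\<lambda>x. complex_of_real (f x)) (finite_subsets_at_top UNIV)"
    using abs sum by (intro Weierstrass_m_test_general'[where M = "\<lambda>k. norm (c k)"]) (auto simp: norm_mult)
  have "((\<lambda>F. LINT x|?M. (\<Sum>l\<in>F. c l * character l x) * cnj (character k x)) \<longlongrightarrow>
      (LINT x|?M. complex_of_real (f x) * cnj (character k x))) (finite_subsets_at_top UNIV)"
  proof (rule tendstoI)
    fix e :: real assume "e > 0"
    define e' where "e' = e / (2 * (2 * pi) ^ CARD('d))"
    have "e' > 0" using \<open>e > 0\<close> by (simp add: e'_def)
    from uniform_limitD[OF ul this]
    show "\<forall>\<^sub>F F in finite_subsets_at_top UNIV.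
        dist (LINT x|?M. (\<Sum>l\<in>F. c l * character l x) * cnj (character k x))
             (LINT x|?M. complex_of_real (f x) * cnj (character k x)) < e"
    proof eventually_elim
      case (elim F)
      have "(LINT x|?M. (\<Sum>l\<in>F. c l * character l x) * cnj (character k x)) -
          (LINT x|?M. complex_of_real (f x) * cnj (character k x)) =
          (LINT x|?M. (\<Sum>l\<in>F. c l * character l x) * cnj (character k x) - complex_of_real (f x) * cnj (character k x))"
        by (intro Bochner_Integration.integral_diff[symmetric] cont_integrable_cell continuous_intros cont)
      also have "norm \<dots> \<le> (2 * pi) ^ CARD('d) * e'"
        using elim by (intro norm_integral_cell_le)
          (auto simp: norm_mult dist_norm simp flip: left_diff_distrib intro: less_imp_le)
      also have "\<dots> < e" using \<open>e > 0\<close> vol by (simp add: e'_def field_simps)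
      finally show ?case by (simp add: dist_norm)
    qed
  qed
  moreover have "(LINT x|?M. (\<Sum>l\<in>F. c l * character l x) * cnj (character k x)) =
      (\<Sum>l\<in>F. if l = k then c k * (2 * pi) ^ CARD('d) else 0)" for F
  proof -
    have "(LINT x|?M. (\<Sum>l\<in>F. c l * character l x) * cnj (character k x)) =
        (LINT x|?M. (\<Sum>l\<in>F. c l * character (l - k) x))"
      by (simp add: sum_distrib_right character_diff mult.assoc)
    also have "\<dots> = (\<Sum>l\<in>F. LINT x|?M. c l * character (l - k) x)"
      by (intro Bochner_Integration.integral_sum cont_integrable_cell continuous_intros)
    also have "\<dots> = (\<Sum>l\<in>F. if l = k then c k * (2 * pi) ^ CARD('d) else 0)"
      by (intro sum.cong) (auto simp: integral_character)
    finally show ?thesis .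
  qed
  ultimately have "((\<lambda>l. if l = k then c k * (2 * pi) ^ CARD('d) else 0) has_sum
      (LINT x|?M. complex_of_real (f x) * cnj (character k x))) UNIV"
    by (simp add: has_sum_def)
  moreover have "((\<lambda>l. if l = k then c k * (2 * pi) ^ CARD('d) else 0) has_sum (c k * (2 * pi) ^ CARD('d))) UNIV"
    by (rule has_sum_finite_neutralI[of "{k}"]) auto
  ultimately have "(LINT x|?M. complex_of_real (f x) * cnj (character k x)) = c k * (2 * pi) ^ CARD('d)"
    by (rule has_sum_unique)
  then show ?thesis by (simp add: fourier_coeff_def)
qed

lemma fourier_coeff_uminus: "fourier_coeff f (- k) = cnj (fourier_coeff f k)"
proof -
  have "(LINT x|lebesgue_on torus_cell. complex_of_real (f x) * cnj (character (- k) x))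
      = (LINT x|lebesgue_on torus_cell. cnj (complex_of_real (f x) * cnj (character k x)))"
    by (simp add: character_uminus del: Bochner_Integration.integral_cnj)
  also have "\<dots> = cnj (LINT x|lebesgue_on torus_cell. complex_of_real (f x) * cnj (character k x))"
    by (rule Bochner_Integration.integral_cnj)
  finally show ?thesis by (simp add: fourier_coeff_def)
qed

lemma fourier_coeff_diff:
  assumes "continuous_on UNIV f" "continuous_on UNIV g"
  shows "fourier_coeff (\<lambda>x. f x - g x) k = fourier_coeff f k - fourier_coeff g k"
proof -
  have "(LINT x|lebesgue_on torus_cell. complex_of_real (f x - g x) * cnj (character k x)) =
      (LINT x|lebesgue_on torus_cell. complex_of_real (f x) * cnj (character k x) - complex_of_real (g x) * cnj (character k x))"
    by (simp add: left_diff_distrib)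
  also have "\<dots> = (LINT x|lebesgue_on torus_cell. complex_of_real (f x) * cnj (character k x))
      - (LINT x|lebesgue_on torus_cell. complex_of_real (g x) * cnj (character k x))"
    by (intro Bochner_Integration.integral_diff cont_integrable_cell continuous_intros assms)
  finally show ?thesis by (simp add: fourier_coeff_def diff_divide_distrib)
qed

lemma norm_fourier_coeff_le:
  fixes f :: "real ^ 'd::finite \<Rightarrow> real"
  assumes "\<And>x. \<bar>f x\<bar> \<le> B"
  shows "norm (fourier_coeff f k) \<le> B"
proof -
  have "norm (LINT x|lebesgue_on torus_cell. complex_of_real (f x) * cnj (character k x)) \<le> (2 * pi) ^ CARD('d) * B"
    by (intro norm_integral_cell_le) (simp add: norm_mult assms)
  moreover have "norm ((2 * complex_of_real pi) ^ CARD('d)) = (2 * pi) ^ CARD('d)"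
    by (simp add: norm_power norm_mult)
  ultimately show ?thesis by (simp add: fourier_coeff_def norm_divide divide_le_eq mult.commute)
qed

locale sobolev_exponent =
  fixes s :: nat and D :: "'d::finite itself"
  assumes s_gt: "real s > real CARD('d) / 2"
begin

text \<open>The whole Sobolev weight, with the factor \<open>(2 * pi) ^ d\<close>, is absorbed into
  the sequence, so that the norm of \<open>a\<close> equals \<open>sobolev_norm s (ev a)\<close>.
  \<open>fc\<close> recovers the plain Fourier coefficients.\<close>

definition wt :: "int ^ 'd \<Rightarrow> real" where
  "wt k = sqrt ((2 * pi) ^ CARD('d) * (1 + freq_sq k) ^ s)"

definition fc :: "'d hseq \<Rightarrow> int ^ 'd \<Rightarrow> complex" where
  "fc a k = coef a k / complex_of_real (wt k)"

definition ev :: "'d hseq \<Rightarrow> real ^ 'd \<Rightarrow> real" where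
  "ev a x = Re (\<Sum>\<^sub>\<infinity>k. fc a k * character k x)"

text \<open>By Cauchy-Schwarz this bounds the embedding of \<open>H^s\<close> into absolutely
  convergent Fourier series, and so into bounded functions. The series converges because
  \<open>s > d/2\<close>.\<close>

definition emb_const :: real where
  "emb_const = sqrt (\<Sum>\<^sub>\<infinity>k :: int ^ 'd. (1 / wt k)\<^sup>2)"

lemma wt_sq: "(wt k)\<^sup>2 = (2 * pi) ^ CARD('d) * (1 + freq_sq k) ^ s"
  unfolding wt_def by (simp add: freq_sq_nonneg)

lemma wt_pos: "wt k > 0"
  unfolding wt_def using freq_sq_nonneg[of k] by (simp add: add_pos_nonneg)

lemma wt_uminus: "wt (- k) = wt k"
  by (simp add: wt_def freq_sq_uminus)

lemma wt_neq_0 [simp]: "wt k \<noteq> 0"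
  using wt_pos[of k] by simp

lemma fc_uminus: "fc a (- k) = cnj (fc a k)"
  by (simp add: fc_def coef_uminus wt_uminus)

lemma coef_fc: "coef a k = complex_of_real (wt k) * fc a k"
  by (simp add: fc_def)

lemma fc_add: "fc (a + b) k = fc a k + fc b k"
  by (simp add: fc_def coef_add add_divide_distrib)

lemma fc_scaleR: "fc (c *\<^sub>R a) k = complex_of_real c * fc a k"
  by (simp add: fc_def coef_scaleR scaleR_conv_of_real)

lemma fc_eqI: "(\<And>k. fc a k = fc b k) \<Longrightarrow> a = b"
  by (intro coef_eqI) (simp add: coef_fc)

lemma inv_wt_sq_summable: "(\<lambda>k :: int ^ 'd. (1 / wt k)\<^sup>2) summable_on UNIV"
proof -
  have "(\<lambda>k :: int ^ 'd. 1 / (2 * pi) ^ CARD('d) * (1 / (1 + freq_sq k) ^ s)) summable_on UNIV"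
    by (intro summable_on_cmult_right summable_on_lattice s_gt)
  then show ?thesis by (simp add: power_divide wt_sq)
qed

lemma emb_const_nonneg: "emb_const \<ge> 0"
  unfolding emb_const_def by (simp add: infsum_nonneg)

lemma emb_const_sq: "emb_const\<^sup>2 = (\<Sum>\<^sub>\<infinity>k :: int ^ 'd. (1 / wt k)\<^sup>2)"
  unfolding emb_const_def by (simp add: infsum_nonneg)

lemma fc_abs_summable: "(\<lambda>k. norm (fc a k)) summable_on UNIV"
  and fc_abs_sum_le: "(\<Sum>\<^sub>\<infinity>k. norm (fc a k)) \<le> emb_const * norm a"
proof -
  have eq: "\<bar>norm (coef a k) * (1 / wt k)\<bar> = norm (fc a k)" for k
    using wt_pos[of k] by (simp add: fc_def norm_divide abs_mult)
  show "(\<lambda>k. norm (fc a k)) summable_on UNIV" "(\<Sum>\<^sub>\<infinity>k. norm (fc a k)) \<le> emb_const * norm a"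
    using infsum_Cauchy_Schwarz[OF summable_coef[of a] inv_wt_sq_summable]
    unfolding eq by (simp_all add: emb_const_def mult.commute flip: norm_hseq_sq)
qed

lemma fc_character_summable: "(\<lambda>k. fc a k * character k x) summable_on UNIV"
  by (rule Infinite_Sum.abs_summable_summable) (simp add: norm_mult fc_abs_summable)

text \<open>Hermitian symmetry makes the series invariant under conjugation, so its value is real
  and the \<open>Re\<close> in \<open>ev\<close> loses nothing.\<close>

lemma ev_has_sum: "((\<lambda>k. fc a k * character k x) has_sum complex_of_real (ev a x)) UNIV"
proof -
  let ?S = "\<Sum>\<^sub>\<infinity>k. fc a k * character k x"
  have "cnj ?S = (\<Sum>\<^sub>\<infinity>k. cnj (fc a k * character k x))" by (rule infsum_cnj[symmetric])
  also have "\<dots> = (\<Sum>\<^sub>\<infinity>k. fc a (- k) * character (- k) x)" by (simp add: fc_uminus character_uminus)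
  also have "\<dots> = ?S"
    by (rule infsum_reindex_bij_witness[where i = uminus and j = uminus]) auto
  finally have "complex_of_real (ev a x) = ?S"
    unfolding ev_def by (metis Reals_cnj_iff of_real_Re)
  then show ?thesis using fc_character_summable by simp
qed

lemma ev_eq_of_has_sum:
  assumes "((\<lambda>k. fc a k * character k x) has_sum complex_of_real c) UNIV"
  shows "ev a x = c"
  using has_sum_unique[OF ev_has_sum assms] of_real_eq_iff by blast

lemma ev_add: "ev (a + b) x = ev a x + ev b x"
proof (rule ev_eq_of_has_sum)
  show "((\<lambda>k. fc (a + b) k * character k x) has_sum complex_of_real (ev a x + ev b x)) UNIV"
    unfolding fc_add ring_distribs of_real_add by (intro has_sum_add ev_has_sum)
qed

lemma ev_scaleR: "ev (c *\<^sub>R a) x = c * ev a x"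
proof (rule ev_eq_of_has_sum)
  show "((\<lambda>k. fc (c *\<^sub>R a) k * character k x) has_sum complex_of_real (c * ev a x)) UNIV"
    unfolding fc_scaleR mult.assoc of_real_mult by (intro has_sum_cmult_right ev_has_sum)
qed

lemma ev_bound: "\<bar>ev a x\<bar> \<le> emb_const * norm a"
proof -
  have "norm (complex_of_real (ev a x)) \<le> (\<Sum>\<^sub>\<infinity>k. norm (fc a k))"
    by (rule norm_infsum_le[OF ev_has_sum]) (use fc_abs_summable in \<open>auto simp: norm_mult\<close>)
  also note fc_abs_sum_le
  finally show ?thesis by simp
qed

lemma bounded_linear_ev: "bounded_linear (\<lambda>a. ev a x)"
  using ev_bound by (intro bounded_linear_intro[of _ emb_const]) (auto simp: ev_add ev_scaleR mult.commute)

lemmas ev_zero [simp] = linear_0[OF bounded_linear.linear[OF bounded_linear_ev]]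
  and ev_diff = linear_diff[OF bounded_linear.linear[OF bounded_linear_ev]]
  and ev_neg = linear_neg[OF bounded_linear.linear[OF bounded_linear_ev]]
  and ev_sum = linear_sum[OF bounded_linear.linear[OF bounded_linear_ev]]

lemma continuous_on_ev: "continuous_on UNIV (ev a)"
proof -
  have "uniform_limit UNIV (\<lambda>F x. \<Sum>k\<in>F. fc a k * character k x) (\<lambda>x. complex_of_real (ev a x)) (finite_subsets_at_top UNIV)"
    using fc_abs_summable ev_has_sum
    by (intro Weierstrass_m_test_general'[where M = "\<lambda>k. norm (fc a k)"]) (auto simp: norm_mult)
  then have "continuous_on UNIV (\<lambda>x. complex_of_real (ev a x))"
    by (rule uniform_limit_theorem[rotated]) (auto intro!: always_eventually continuous_intros)
  from continuous_on_Re[OF this] show ?thesis by simp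
qed

lemma periodic_ev: "periodic (ev a)"
  unfolding periodic_def ev_def by (simp add: character_periodic)

lemma fourier_coeff_ev: "fourier_coeff (ev a) k = fc a k"
  by (rule fourier_coeff_of_uniform_sum[OF continuous_on_ev ev_has_sum fc_abs_summable])

lemma ev_inj: "ev a = ev b \<Longrightarrow> a = b"
  by (intro fc_eqI) (metis fourier_coeff_ev)

text \<open>Reduces identities between sequences to pointwise identities between real functions; the
  algebraic laws of \<open>mult\<close> and \<open>expX\<close> are obtained in this way.\<close>

lemma ev_eqI: "(\<And>x. ev a x = ev b x) \<Longrightarrow> a = b"
  by (rule ev_inj) (rule ext)

lemma norm_coef_sq: "(norm (coef a k))\<^sup>2 = (2 * pi) ^ CARD('d) * ((1 + freq_sq k) ^ s * (norm (fc a k))\<^sup>2)"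
  by (simp add: coef_fc norm_mult power_mult_distrib wt_sq mult.assoc)

lemma ev_in_sobolev: "ev a \<in> sobolev s"
proof -
  have "(\<lambda>k. 1 / (2 * pi) ^ CARD('d) * (norm (coef a k))\<^sup>2) summable_on UNIV"
    by (intro summable_on_cmult_right summable_coef)
  then show ?thesis
    by (simp add: sobolev_def periodic_ev continuous_on_ev fourier_coeff_ev norm_coef_sq)
qed

lemma sobolev_norm_ev: "sobolev_norm s (ev a) = norm a"
proof -
  have "sobolev_norm s (ev a) = sqrt ((norm a)\<^sup>2)"
    unfolding norm_hseq_sq norm_coef_sq sobolev_norm_def fourier_coeff_ev
    by (subst infsum_cmult_right') simp
  then show ?thesis by simp
qed

subsection \<open>Multiplication\<close>

definition mult :: "'d hseq \<Rightarrow> 'd hseq \<Rightarrow> 'd hseq" where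
  "mult a b = hseq (\<lambda>m. complex_of_real (wt m) * (\<Sum>\<^sub>\<infinity>k. fc a k * fc b (m - k)))"

text \<open>\<open>4 ^ s\<close> is the loss in \<open>wt_sq_le\<close>; the 2 counts its two
  summands, each of which contributes \<open>emb_const\<^sup>2\<close>.\<close>

definition mult_const :: real where
  "mult_const = sqrt (2 * 4 ^ s) * emb_const"

text \<open>As \<open>m = k + (m - k)\<close>, one of \<open>1 + freq_sq k\<close> and
  \<open>1 + freq_sq (m - k)\<close> is at least a quarter of \<open>1 + freq_sq m\<close>.\<close>

lemma wt_sq_le: "(wt m)\<^sup>2 \<le> 4 ^ s * ((wt k)\<^sup>2 + (wt (m - k))\<^sup>2)"
proof -
  have "freq_sq m \<le> 2 * freq_sq k + 2 * freq_sq (m - k)"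
  proof -
    have "(real_of_int (m $ i))\<^sup>2 \<le> 2 * (real_of_int (k $ i))\<^sup>2 + 2 * (real_of_int ((m - k) $ i))\<^sup>2" for i
    proof -
      have "(x + y)\<^sup>2 \<le> 2 * x\<^sup>2 + 2 * y\<^sup>2" for x y :: real
      proof -
        have "2 * x\<^sup>2 + 2 * y\<^sup>2 - (x + y)\<^sup>2 = (x - y)\<^sup>2" by (simp add: power2_eq_square algebra_simps)
        then show ?thesis using zero_le_power2[of "x - y"] by linarith
      qed
      from this[of "real_of_int (k $ i)" "real_of_int ((m - k) $ i)"] show ?thesis by simp
    qed
    then have "freq_sq m \<le> (\<Sum>i\<in>UNIV. 2 * (real_of_int (k $ i))\<^sup>2 + 2 * (real_of_int ((m - k) $ i))\<^sup>2)"
      unfolding freq_sq_def by (intro sum_mono)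
    then show ?thesis by (simp add: freq_sq_def sum.distrib sum_distrib_left)
  qed
  then have "1 + freq_sq m \<le> 4 * max (1 + freq_sq k) (1 + freq_sq (m - k))"
    by (cases "freq_sq k \<le> freq_sq (m - k)") (auto simp: max_def)
  then have "(1 + freq_sq m) ^ s \<le> (4 * max (1 + freq_sq k) (1 + freq_sq (m - k))) ^ s"
    by (intro power_mono) (auto simp: freq_sq_nonneg add_nonneg_nonneg)
  also have "\<dots> \<le> 4 ^ s * ((1 + freq_sq k) ^ s + (1 + freq_sq (m - k)) ^ s)"
    by (cases "freq_sq k \<le> freq_sq (m - k)")
       (auto simp: power_mult_distrib max_def freq_sq_nonneg add_nonneg_nonneg simp del: distrib_left_numeral)
  finally have "(2 * pi) ^ CARD('d) * (1 + freq_sq m) ^ s \<le>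
      (2 * pi) ^ CARD('d) * (4 ^ s * ((1 + freq_sq k) ^ s + (1 + freq_sq (m - k)) ^ s))"
    by (intro mult_left_mono) auto
  then show ?thesis unfolding wt_sq by (simp add: algebra_simps)
qed

text \<open>Cauchy-Schwarz with the weights split off: \<open>u\<close> collects the weighted
  coefficients and \<open>v\<close> the inverse weights. By \<open>wt_sq_le\<close>,
  \<open>(wt m)\<^sup>2\<close> times the sum of the \<open>(v k)\<^sup>2\<close> is bounded
  uniformly in \<open>m\<close>.\<close>

lemma norm_conv_sq_le:
  "(wt m * norm (\<Sum>\<^sub>\<infinity>k. fc a k * fc b (m - k)))\<^sup>2 \<le>
     mult_const\<^sup>2 * (\<Sum>\<^sub>\<infinity>k. (norm (coef a k))\<^sup>2 * (norm (coef b (m - k)))\<^sup>2)"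
proof -
  define u where "u k = norm (coef a k) * norm (coef b (m - k))" for k
  define v where "v k = 1 / (wt k * wt (m - k))" for k
  have su: "(\<lambda>k. (u k)\<^sup>2) summable_on UNIV"
    using has_sum_convolution(2)[of "\<lambda>k. (norm (coef a k))\<^sup>2" "\<lambda>k. (norm (coef b k))\<^sup>2" m]
    by (simp add: u_def power_mult_distrib summable_coef)
  have inv: "(\<lambda>k. (1 / wt (m - k))\<^sup>2) summable_on UNIV" "(\<Sum>\<^sub>\<infinity>k. (1 / wt (m - k))\<^sup>2) = emb_const\<^sup>2"
  proof -
    have bij: "bij_betw (\<lambda>k. m - k) UNIV (UNIV :: (int ^ 'd) set)"
      by (rule bij_betw_byWitness[of _ "\<lambda>k. m - k"]) auto
    show "(\<lambda>k. (1 / wt (m - k))\<^sup>2) summable_on UNIV"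
      using inv_wt_sq_summable by (subst summable_on_reindex_bij_betw[OF bij, where f = "\<lambda>k. (1 / wt k)\<^sup>2"])
    show "(\<Sum>\<^sub>\<infinity>k. (1 / wt (m - k))\<^sup>2) = emb_const\<^sup>2"
      unfolding emb_const_sq by (subst infsum_reindex_bij_betw[OF bij, where f = "\<lambda>k. (1 / wt k)\<^sup>2"]) simp
  qed
  have vle: "(wt m)\<^sup>2 * (v k)\<^sup>2 \<le> 4 ^ s * ((1 / wt (m - k))\<^sup>2 + (1 / wt k)\<^sup>2)" for k
  proof -
    have "(wt m)\<^sup>2 * (v k)\<^sup>2 \<le> 4 ^ s * ((wt k)\<^sup>2 + (wt (m - k))\<^sup>2) * (v k)\<^sup>2"
      by (intro mult_right_mono wt_sq_le) simp
    also have "\<dots> = 4 ^ s * ((1 / wt (m - k))\<^sup>2 + (1 / wt k)\<^sup>2)"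
      by (simp add: v_def power_divide power_mult_distrib field_simps)
    finally show ?thesis .
  qed
  have s1: "(\<lambda>k. 4 ^ s * ((1 / wt (m - k))\<^sup>2 + (1 / wt k)\<^sup>2)) summable_on UNIV"
    by (intro summable_on_cmult_right summable_on_add inv inv_wt_sq_summable)
  have swv: "(\<lambda>k. (wt m)\<^sup>2 * (v k)\<^sup>2) summable_on UNIV"
    by (rule summable_on_comparison_test[OF s1 vle]) simp
  then have sv: "(\<lambda>k. (v k)\<^sup>2) summable_on UNIV"
    by (subst (asm) summable_on_cmult_right') auto
  have "(wt m)\<^sup>2 * (\<Sum>\<^sub>\<infinity>k. (v k)\<^sup>2) = (\<Sum>\<^sub>\<infinity>k. (wt m)\<^sup>2 * (v k)\<^sup>2)"
    by (simp add: infsum_cmult_right')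
  also have "\<dots> \<le> (\<Sum>\<^sub>\<infinity>k. 4 ^ s * ((1 / wt (m - k))\<^sup>2 + (1 / wt k)\<^sup>2))"
    by (intro infsum_mono swv s1 vle)
  also have "\<dots> = mult_const\<^sup>2"
    by (simp add: infsum_cmult_right' infsum_add inv inv_wt_sq_summable mult_const_def power_mult_distrib
        flip: emb_const_sq)
  finally have sumv: "(wt m)\<^sup>2 * (\<Sum>\<^sub>\<infinity>k. (v k)\<^sup>2) \<le> mult_const\<^sup>2" .
  have eq: "norm (fc a k * fc b (m - k)) = \<bar>u k * v k\<bar>" for k
    using wt_pos[of k] wt_pos[of "m - k"] by (simp add: fc_def u_def v_def norm_mult norm_divide abs_mult)
  have "norm (\<Sum>\<^sub>\<infinity>k. fc a k * fc b (m - k)) \<le> (\<Sum>\<^sub>\<infinity>k. \<bar>u k * v k\<bar>)"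
    using norm_infsum_bound[of "\<lambda>k. fc a k * fc b (m - k)" UNIV] infsum_Cauchy_Schwarz(1)[OF su sv]
    unfolding eq by simp
  also have "\<dots> \<le> sqrt (\<Sum>\<^sub>\<infinity>k. (u k)\<^sup>2) * sqrt (\<Sum>\<^sub>\<infinity>k. (v k)\<^sup>2)"
    by (rule infsum_Cauchy_Schwarz(2)[OF su sv])
  finally have "(norm (\<Sum>\<^sub>\<infinity>k. fc a k * fc b (m - k)))\<^sup>2 \<le> (sqrt (\<Sum>\<^sub>\<infinity>k. (u k)\<^sup>2) * sqrt (\<Sum>\<^sub>\<infinity>k. (v k)\<^sup>2))\<^sup>2"
    by (intro power_mono) auto
  also have "\<dots> = (\<Sum>\<^sub>\<infinity>k. (u k)\<^sup>2) * (\<Sum>\<^sub>\<infinity>k. (v k)\<^sup>2)"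
    by (simp add: power_mult_distrib infsum_nonneg)
  finally have "(wt m)\<^sup>2 * (norm (\<Sum>\<^sub>\<infinity>k. fc a k * fc b (m - k)))\<^sup>2 \<le>
      ((wt m)\<^sup>2 * (\<Sum>\<^sub>\<infinity>k. (v k)\<^sup>2)) * (\<Sum>\<^sub>\<infinity>k. (u k)\<^sup>2)"
    using mult_left_mono[of _ _ "(wt m)\<^sup>2"] by (simp add: algebra_simps)
  also have "\<dots> \<le> mult_const\<^sup>2 * (\<Sum>\<^sub>\<infinity>k. (u k)\<^sup>2)"
    by (intro mult_right_mono sumv infsum_nonneg) auto
  finally show ?thesis by (simp add: power_mult_distrib u_def)
qed

text \<open>Summing \<open>norm_conv_sq_le\<close> over \<open>m\<close> gives the total mass of a
  convolution, which is \<open>(norm a)\<^sup>2 * (norm b)\<^sup>2\<close>. This is the algebra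
  property of \<open>H^s\<close>.\<close>

lemma mult_coef_aux:
  fixes a b :: "'d hseq"
  defines "c \<equiv> \<lambda>m. complex_of_real (wt m) * (\<Sum>\<^sub>\<infinity>k. fc a k * fc b (m - k))"
  shows "coef (mult a b) = c" and "norm (mult a b) \<le> mult_const * norm a * norm b"
proof -
  have hs: "((\<lambda>m. \<Sum>\<^sub>\<infinity>k. (norm (coef a k))\<^sup>2 * (norm (coef b (m - k)))\<^sup>2) has_sum ((norm a)\<^sup>2 * (norm b)\<^sup>2)) UNIV"
    unfolding norm_hseq_sq by (rule has_sum_convolution(1)) (simp_all add: summable_coef)
  have le: "(norm (c m))\<^sup>2 \<le> mult_const\<^sup>2 * (\<Sum>\<^sub>\<infinity>k. (norm (coef a k))\<^sup>2 * (norm (coef b (m - k)))\<^sup>2)" for m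
    using norm_conv_sq_le[of m a b] wt_pos[of m] by (simp add: c_def norm_mult)
  have ms: "(\<lambda>m. mult_const\<^sup>2 * (\<Sum>\<^sub>\<infinity>k. (norm (coef a k))\<^sup>2 * (norm (coef b (m - k)))\<^sup>2)) summable_on UNIV"
    using hs by (intro summable_on_cmult_right) (auto simp: has_sum_iff)
  have sc: "(\<lambda>m. (norm (c m))\<^sup>2) summable_on UNIV"
    by (rule summable_on_comparison_test[OF ms le]) simp
  have herm: "c (- m) = cnj (c m)" for m
  proof -
    have "(\<Sum>\<^sub>\<infinity>k. fc a k * fc b (- m - k)) = (\<Sum>\<^sub>\<infinity>k. fc a (- k) * fc b (- (m - k)))"
      by (rule infsum_reindex_bij_witness[where i = uminus and j = uminus]) auto
    also have "\<dots> = cnj (\<Sum>\<^sub>\<infinity>k. fc a k * fc b (m - k))"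
      unfolding fc_uminus by (simp flip: infsum_cnj)
    finally show ?thesis by (simp add: c_def wt_uminus)
  qed
  show cm: "coef (mult a b) = c"
    unfolding mult_def c_def[symmetric] using herm sc by (rule coef_hseq)
  have "(norm (mult a b))\<^sup>2 \<le> mult_const\<^sup>2 * ((norm a)\<^sup>2 * (norm b)\<^sup>2)"
  proof -
    have "(norm (mult a b))\<^sup>2 \<le> (\<Sum>\<^sub>\<infinity>m. mult_const\<^sup>2 * (\<Sum>\<^sub>\<infinity>k. (norm (coef a k))\<^sup>2 * (norm (coef b (m - k)))\<^sup>2))"
      unfolding norm_hseq_sq cm by (intro infsum_mono sc ms le)
    also have "\<dots> = mult_const\<^sup>2 * ((norm a)\<^sup>2 * (norm b)\<^sup>2)"
      using hs by (simp add: infsum_cmult_right' infsumI)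
    finally show ?thesis .
  qed
  then have "(norm (mult a b))\<^sup>2 \<le> (mult_const * norm a * norm b)\<^sup>2"
    by (simp add: power_mult_distrib mult.assoc)
  moreover have "mult_const * norm a * norm b \<ge> 0"
    by (simp add: mult_const_def emb_const_nonneg)
  ultimately show "norm (mult a b) \<le> mult_const * norm a * norm b"
    by (rule power2_le_imp_le)
qed

lemmas norm_mult_le = mult_coef_aux(2)

lemma fc_mult: "fc (mult a b) m = (\<Sum>\<^sub>\<infinity>k. fc a k * fc b (m - k))"
  unfolding fc_def[of "mult a b"] mult_coef_aux(1) by simp

lemma mult_const_nonneg: "mult_const \<ge> 0"
  by (simp add: mult_const_def emb_const_nonneg)

lemma ev_mult: "ev (mult a b) x = ev a x * ev b x"
proof -
  have abs: "(\<lambda>k. norm (fc a k * character k x)) summable_on UNIV" for a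
    by (simp add: norm_mult fc_abs_summable)
  have "(\<Sum>\<^sub>\<infinity>k. (fc a k * character k x) * (fc b (m - k) * character (m - k) x)) = fc (mult a b) m * character m x" for m
  proof -
    have "(\<Sum>\<^sub>\<infinity>k. (fc a k * character k x) * (fc b (m - k) * character (m - k) x)) =
        (\<Sum>\<^sub>\<infinity>k. (fc a k * fc b (m - k)) * (character k x * character (m - k) x))"
      by (simp add: mult_ac)
    also have "\<dots> = (\<Sum>\<^sub>\<infinity>k. (fc a k * fc b (m - k)) * character m x)"
      by (simp flip: character_add)
    finally show ?thesis by (simp add: infsum_cmult_left' fc_mult)
  qed
  then have "((\<lambda>m. fc (mult a b) m * character m x) has_sum
      (complex_of_real (ev a x) * complex_of_real (ev b x))) UNIV"
    using has_sum_convolution(1)[OF abs[of a] abs[of b]]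
    unfolding infsumI[OF ev_has_sum] by simp
  then show ?thesis by (intro ev_eq_of_has_sum) simp
qed

lemma bounded_bilinear_mult: "bounded_bilinear mult"
proof
  show "\<exists>K. \<forall>a b. norm (mult a b) \<le> norm a * norm b * K"
    using norm_mult_le by (intro exI[of _ mult_const]) (simp add: mult_ac)
qed (auto intro!: ev_eqI simp: ev_mult ev_add ev_scaleR algebra_simps)

definition single :: "int ^ 'd \<Rightarrow> complex \<Rightarrow> 'd hseq" where
  "single l z = hseq (\<lambda>k. complex_of_real (wt k) * ((if k = l then z else 0) + (if k = - l then cnj z else 0)))"

lemma fc_single: "fc (single l z) k = (if k = l then z else 0) + (if k = - l then cnj z else 0)"
proof -
  have "coef (single l z) = (\<lambda>k. complex_of_real (wt k) * ((if k = l then z else 0) + (if k = - l then cnj z else 0)))"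
    unfolding single_def
  proof (rule coef_hseq_finite)
    show "finite {k. complex_of_real (wt k) * ((if k = l then z else 0) + (if k = - l then cnj z else 0)) \<noteq> 0}"
      by (rule finite_subset[of _ "{l, - l}"]) auto
  qed (auto simp: wt_uminus)
  then show ?thesis by (simp add: fc_def)
qed

lemma ev_single: "ev (single l z) x = 2 * Re (z * character l x)"
proof -
  have h1: "((\<lambda>k. (if k = l then z else 0) * character k x) has_sum (z * character l x)) UNIV"
    by (rule has_sum_finite_neutralI[of "{l}"]) auto
  have h2: "((\<lambda>k. (if k = - l then cnj z else 0) * character k x) has_sum (cnj z * character (- l) x)) UNIV"
    by (rule has_sum_finite_neutralI[of "{- l}"]) auto
  have "((\<lambda>k. fc (single l z) k * character k x) has_sum (z * character l x + cnj (z * character l x))) UNIV"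
    using has_sum_add[OF h1 h2] by (simp add: fc_single ring_distribs character_uminus)
  then show ?thesis unfolding complex_add_cnj by (rule ev_eq_of_has_sum)
qed

text \<open>At frequency 0 the two terms of \<open>single\<close> coincide and add up, hence the
  half.\<close>

definition const :: "real \<Rightarrow> 'd hseq" where
  "const c = single 0 (complex_of_real (c / 2))"

lemma ev_const [simp]: "ev (const c) x = c"
  by (simp add: const_def ev_single)

end

subsection \<open>Periodic functions as functions on a compact torus\<close>

text \<open>Wraps the space onto a product of unit circles. Continuous periodic functions factor
  through this compact image, where Stone-Weierstrass applies.\<close>

definition torus_map :: "real ^ 'd \<Rightarrow> complex ^ 'd" where
  "torus_map x = (\<chi> i. cis (x $ i))"

lemma periodic_shift_axis:
  fixes n :: int
  assumes "periodic f"
  shows "f (x + axis i (2 * pi * of_int n)) = f x"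
proof -
  have nat: "f (x + axis i (2 * pi * real m)) = f x" for m :: nat and x
  proof (induction m)
    case 0
    then show ?case by (simp add: axis_def vec_eq_iff flip: zero_vec_def)
  next
    case (Suc m)
    have eq: "x + axis i (2 * pi * real (Suc m)) = (x + axis i (2 * pi * real m)) + axis i (2 * pi)"
      by (simp add: vec_eq_iff axis_def algebra_simps)
    show ?case unfolding eq using Suc assms unfolding periodic_def by simp
  qed
  show ?thesis
  proof (cases n rule: int_cases2)
    case (nonneg m)
    then show ?thesis using nat[of x m] by simp
  next
    case (nonpos m)
    have "(x + axis i (2 * pi * of_int n)) + axis i (2 * pi * real m) = x"
      using nonpos by (simp add: vec_eq_iff axis_def)
    then show ?thesis using nat[of "x + axis i (2 * pi * of_int n)" m] by (simp only:)
  qed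
qed

lemma periodic_shift:
  fixes n :: "'d::finite \<Rightarrow> int"
  assumes "periodic f"
  shows "f (x + (\<chi> i. 2 * pi * of_int (n i))) = f x"
proof -
  have "f (x + (\<Sum>i\<in>A. axis i (2 * pi * of_int (n i)))) = f x" if "finite A" for A
    using that
  proof (induction A)
    case (insert i A)
    have eq: "x + (\<Sum>i\<in>insert i A. axis i (2 * pi * of_int (n i))) =
        (x + (\<Sum>i\<in>A. axis i (2 * pi * of_int (n i)))) + axis i (2 * pi * of_int (n i))"
      using insert by (simp add: add_ac)
    show ?case unfolding eq periodic_shift_axis[OF assms] by (rule insert.IH)
  qed simp
  from this[OF finite] show ?thesis
  proof -
    have "(\<Sum>i\<in>UNIV. axis i (2 * pi * of_int (n i))) = (\<chi> i. 2 * pi * of_int (n i))"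
      by (simp add: vec_eq_iff axis_def)
    then show ?thesis using \<open>f (x + (\<Sum>i\<in>UNIV. axis i (2 * pi * of_int (n i)))) = f x\<close> by simp
  qed
qed

lemma periodic_torus_map_eq:
  fixes f :: "real ^ 'd::finite \<Rightarrow> real"
  assumes "periodic f" "torus_map x = torus_map y"
  shows "f x = f y"
proof -
  have "cis (x $ i) = cis (y $ i)" for i using assms(2) by (simp add: torus_map_def vec_eq_iff)
  then have "\<exists>n :: int. x $ i = y $ i + 2 * pi * n" for i
    by (subst sin_cos_eq_iff[symmetric]) (simp add: cis.ctr)
  then obtain n :: "'d \<Rightarrow> int" where "\<And>i. x $ i = y $ i + 2 * pi * n i" by metis
  then have "x = y + (\<chi> i. 2 * pi * of_int (n i))" by (simp add: vec_eq_iff)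
  then show ?thesis using periodic_shift[OF assms(1), of y n] by simp
qed

lemma torus_map_cell: "\<exists>y\<in>torus_cell. torus_map y = torus_map (x :: real ^ 'd::finite)"
proof -
  define y :: "real ^ 'd" where "y = (\<chi> i. x $ i - 2 * pi * of_int \<lfloor>x $ i / (2 * pi)\<rfloor>)"
  have "0 \<le> y $ i \<and> y $ i \<le> 2 * pi" for i
  proof -
    have "of_int \<lfloor>x $ i / (2 * pi)\<rfloor> * (2 * pi) \<le> x $ i"
      using of_int_floor_le[of "x $ i / (2 * pi)"] by (subst (asm) pos_le_divide_eq) auto
    moreover have "x $ i / (2 * pi) \<le> of_int \<lfloor>x $ i / (2 * pi)\<rfloor> + 1"
      by linarith
    ultimately show ?thesis by (simp add: y_def field_simps)
  qed
  then have "y \<in> torus_cell" by (simp add: torus_cell_def mem_box_cart)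
  moreover have "cis (y $ i) = cis (x $ i)" for i
    using sin_cos_eq_iff[of "x $ i" "y $ i"] by (auto simp: y_def cis.ctr)
  ultimately show ?thesis by (intro bexI[of _ y]) (auto simp: torus_map_def)
qed

lemma continuous_on_torus_map: "continuous_on S (torus_map :: real ^ 'd::finite \<Rightarrow> _)"
  unfolding torus_map_def by (intro continuous_intros)

lemma range_torus_map: "range torus_map = torus_map ` (torus_cell :: (real ^ 'd::finite) set)"
proof -
  have "torus_map x \<in> torus_map ` torus_cell" for x :: "real ^ 'd"
    using torus_map_cell[of x] by (metis imageI)
  then show ?thesis by blast
qed

lemma compact_torus: "compact (range (torus_map :: real ^ 'd::finite \<Rightarrow> _))"
  unfolding range_torus_map torus_cell_def by (intro compact_continuous_image continuous_on_torus_map compact_cbox)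

text \<open>The preimage of a closed set under \<open>F\<close> is the image of a compact part of
  the cell, hence closed; this is the continuity of \<open>F\<close>.\<close>

lemma periodic_factor:
  fixes f :: "real ^ 'd::finite \<Rightarrow> real"
  assumes "periodic f" "continuous_on UNIV f"
  obtains F where "continuous_on (range torus_map) F" "\<And>x. F (torus_map x) = f x"
proof
  define F where "F z = f (SOME x. torus_map x = z)" for z
  show F: "F (torus_map x) = f x" for x
    unfolding F_def by (rule periodic_torus_map_eq[OF assms(1)]) (rule someI, rule refl)
  have "closed (F -` B \<inter> range torus_map)" if "closed B" for B
  proof -
    have "F -` B \<inter> range torus_map = torus_map ` (f -` B \<inter> torus_cell)"
      using F by (auto simp: range_torus_map)
    moreover have "compact (f -` B \<inter> torus_cell)"
      unfolding torus_cell_def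
      using continuous_closed_vimage[of B f] that assms(2)
      by (intro closed_Int_compact compact_cbox) (auto simp: continuous_on_eq_continuous_at)
    ultimately show ?thesis
      by (simp add: compact_continuous_image continuous_on_torus_map compact_imp_closed)
  qed
  then show "continuous_on (range torus_map) F"
    using compact_imp_closed[OF compact_torus] by (subst continuous_on_closed_vimage) auto
qed

lemma periodic_bounded:
  fixes f :: "real ^ 'd::finite \<Rightarrow> real"
  assumes "periodic f" "continuous_on UNIV f"
  obtains B where "B > 0" "\<And>x. \<bar>f x\<bar> \<le> B"
proof -
  obtain F where F: "continuous_on (range torus_map) F" "\<And>x. F (torus_map x) = f x"
    using periodic_factor[OF assms] by blast
  have "bounded (F ` range torus_map)"
    by (intro compact_imp_bounded compact_continuous_image F compact_torus)
  then obtain B where "B > 0" "\<And>z. z \<in> F ` range torus_map \<Longrightarrow> norm z \<le> B"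
    unfolding bounded_pos by blast
  then show thesis using that[of B] F(2) by (metis image_eqI rangeI real_norm_def)
qed

lemma integral_zero_cell:
  fixes f :: "real ^ 'd::finite \<Rightarrow> real"
  assumes "continuous_on UNIV f" "(LINT x|lebesgue_on torus_cell. (f x)\<^sup>2) = 0" "x \<in> torus_cell"
  shows "f x = 0"
proof -
  have c: "continuous_on (cbox a b) (\<lambda>x. (f x)\<^sup>2)" for a b
    using assms(1) by (intro continuous_intros) (auto intro: continuous_on_subset)
  have int: "integrable (lebesgue_on torus_cell) (\<lambda>x. (f x)\<^sup>2)"
    by (intro cont_integrable_cell continuous_intros assms)
  have "integral torus_cell (\<lambda>x. (f x)\<^sup>2) = 0"
    using lebesgue_integral_eq_integral[OF int] assms(2) by (simp add: torus_cell_def)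
  then have "((\<lambda>x. (f x)\<^sup>2) has_integral 0) torus_cell"
    using integrable_continuous[OF c] unfolding torus_cell_def by (metis integrable_integral)
  then have int0: "((\<lambda>x. (f x)\<^sup>2) has_integral 0) (cbox 0 (\<chi> i. 2 * pi))"
    by (simp add: torus_cell_def)
  have "(\<chi> i. pi) \<in> box 0 (\<chi> i :: 'd. 2 * pi)" by (simp add: mem_box_cart)
  then have "box 0 (\<chi> i :: 'd. 2 * pi) \<noteq> {}" by blast
  from has_integral_0_cbox_imp_0[OF c _ int0 this] assms(3) show ?thesis
    by (simp add: torus_cell_def)
qed

subsection \<open>Fourier multipliers\<close>

text \<open>The symmetry says that \<open>fmul m\<close> maps real functions to real functions;
  \<open>B\<close> bounds its operator norm.\<close>

definition multiplier :: "real \<Rightarrow> (int ^ 'd::finite \<Rightarrow> complex) \<Rightarrow> bool" where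
  "multiplier B m \<longleftrightarrow> (\<forall>k. m (- k) = cnj (m k)) \<and> (\<forall>k. norm (m k) \<le> B)"

definition fmul :: "(int ^ 'd::finite \<Rightarrow> complex) \<Rightarrow> 'd hseq \<Rightarrow> 'd hseq" where
  "fmul m a = hseq (\<lambda>k. m k * coef a k)"

lemma multiplier_nonneg: "multiplier B m \<Longrightarrow> B \<ge> 0"
  unfolding multiplier_def by (meson norm_ge_zero order_trans)

lemma coef_fmul:
  assumes "multiplier B m"
  shows "coef (fmul m a) k = m k * coef a k"
proof -
  have "coef (fmul m a) = (\<lambda>k. m k * coef a k)"
    unfolding fmul_def
  proof (rule coef_hseq)
    show "(\<lambda>k. (norm (m k * coef a k))\<^sup>2) summable_on UNIV"
    proof (rule summable_on_comparison_test)
      show "(\<lambda>k. B\<^sup>2 * (norm (coef a k))\<^sup>2) summable_on UNIV"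
        by (intro summable_on_cmult_right summable_coef)
      show "(norm (m k * coef a k))\<^sup>2 \<le> B\<^sup>2 * (norm (coef a k))\<^sup>2" for k
        using assms unfolding multiplier_def norm_mult power_mult_distrib
        by (intro mult_right_mono power_mono) auto
    qed simp
  qed (use assms in \<open>auto simp: multiplier_def coef_uminus\<close>)
  then show ?thesis by simp
qed

lemma norm_fmul_le:
  fixes a :: "'d::finite hseq"
  assumes "multiplier B m"
  shows "norm (fmul m a) \<le> B * norm a"
proof (rule norm_hseq_leI)
  fix F :: "(int ^ 'd) set" assume F: "finite F"
  have "(\<Sum>k\<in>F. (norm (coef (fmul m a) k))\<^sup>2) \<le> (\<Sum>k\<in>F. B\<^sup>2 * (norm (coef a k))\<^sup>2)"
    using assms unfolding coef_fmul[OF assms] norm_mult power_mult_distrib multiplier_def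
    by (intro sum_mono mult_right_mono power_mono) auto
  also have "\<dots> \<le> B\<^sup>2 * (norm a)\<^sup>2"
    unfolding sum_distrib_left[symmetric] by (intro mult_left_mono sum_norm_coef_le F) auto
  finally show "(\<Sum>k\<in>F. (norm (coef (fmul m a) k))\<^sup>2) \<le> (B * norm a)\<^sup>2"
    by (simp add: power_mult_distrib)
qed (use multiplier_nonneg[OF assms] in simp)

lemma bounded_linear_fmul:
  fixes m :: "int ^ 'd::finite \<Rightarrow> complex"
  assumes "multiplier B m"
  shows "bounded_linear (fmul m)"
proof (rule bounded_linear_intro)
  show "norm (fmul m a) \<le> norm a * B" for a using norm_fmul_le[OF assms, of a] by (simp add: mult.commute)
qed (auto intro!: coef_eqI simp: coef_fmul[OF assms] coef_add coef_scaleR algebra_simps)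

lemma multiplier_mult:
  assumes "multiplier B m" "multiplier C n"
  shows "multiplier (B * C) (\<lambda>k. m k * n k)"
  using assms multiplier_nonneg[OF assms(1)] unfolding multiplier_def by (auto simp: norm_mult intro!: mult_mono)

lemma fmul_fmul:
  assumes "multiplier B m" "multiplier C n"
  shows "fmul m (fmul n a) = fmul (\<lambda>k. m k * n k) a"
  by (rule coef_eqI)
     (simp add: coef_fmul[OF assms(1)] coef_fmul[OF assms(2)] coef_fmul[OF multiplier_mult[OF assms]])

text \<open>Finitely many frequencies carry almost all of \<open>a\<close>, and there the symbols
  converge; elsewhere they differ by at most \<open>2 * B\<close>.\<close>

lemma fmul_tendsto:
  fixes a :: "'d::finite hseq"
  assumes m: "\<And>n. multiplier B (m n)" and m0: "multiplier B m0"
    and lim: "\<And>k. ((\<lambda>n. m n k) \<longlongrightarrow> m0 k) F"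
  shows "((\<lambda>n. fmul (m n) a) \<longlongrightarrow> fmul m0 a) F"
proof (rule tendstoI)
  fix e :: real assume e: "e > 0"
  have B: "B \<ge> 0" by (rule multiplier_nonneg[OF m0])
  \<comment> \<open>Ensures \<open>4 * B\<^sup>2 * r \<le> e\<^sup>2 / 4\<close>, also for
    \<open>B = 0\<close>.\<close>
  define r where "r = e\<^sup>2 / (4 * (4 * B\<^sup>2 + 1))"
  have r: "r > 0" using e by (simp add: r_def add_nonneg_pos)
  obtain K where K: "finite K" "\<And>G. finite G \<Longrightarrow> G \<inter> K = {} \<Longrightarrow> (\<Sum>k\<in>G. (norm (coef a k))\<^sup>2) < r"
    using coef_tail[OF r] by blast
  have "((\<lambda>n. \<Sum>k\<in>K. (norm ((m n k - m0 k) * coef a k))\<^sup>2) \<longlongrightarrow> (\<Sum>k\<in>K. (norm ((m0 k - m0 k) * coef a k))\<^sup>2)) F"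
    by (intro tendsto_intros lim)
  then have "\<forall>\<^sub>F n in F. (\<Sum>k\<in>K. (norm ((m n k - m0 k) * coef a k))\<^sup>2) < e\<^sup>2 / 4"
    using e by (intro order_tendstoD) auto
  then show "\<forall>\<^sub>F n in F. dist (fmul (m n) a) (fmul m0 a) < e"
  proof eventually_elim
    case (elim n)
    have "norm (fmul (m n) a - fmul m0 a) \<le> sqrt (e\<^sup>2 / 2)"
    proof (rule norm_hseq_leI)
      fix G :: "(int ^ 'd) set" assume G: "finite G"
      let ?f = "\<lambda>k. (norm ((m n k - m0 k) * coef a k))\<^sup>2"
      have "(\<Sum>k\<in>G. (norm (coef (fmul (m n) a - fmul m0 a) k))\<^sup>2) = sum ?f G"
        by (simp add: coef_diff coef_fmul[OF m] coef_fmul[OF m0] left_diff_distrib)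
      also have "\<dots> \<le> sum ?f (K \<union> (G - K))" using G K(1) by (intro sum_mono2) auto
      also have "\<dots> = sum ?f K + sum ?f (G - K)" using G K(1) by (intro sum.union_disjoint) auto
      also have "sum ?f (G - K) \<le> (\<Sum>k\<in>G - K. (2 * B)\<^sup>2 * (norm (coef a k))\<^sup>2)"
      proof (rule sum_mono)
        fix k
        have "norm (m n k - m0 k) \<le> 2 * B"
          using norm_triangle_ineq4[of "m n k" "m0 k"] m[of n] m0 unfolding multiplier_def
          by (smt (verit))
        then show "?f k \<le> (2 * B)\<^sup>2 * (norm (coef a k))\<^sup>2"
          unfolding norm_mult power_mult_distrib[of "norm _"] by (intro mult_right_mono power_mono) auto
      qed
      also have "\<dots> \<le> 4 * B\<^sup>2 * r"
        unfolding sum_distrib_left[symmetric] using less_imp_le[OF K(2)[of "G - K"]] G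
        by (auto simp: power_mult_distrib intro!: mult_left_mono)
      also have "4 * B\<^sup>2 * r \<le> e\<^sup>2 / 4"
      proof -
        have "4 * B\<^sup>2 + 1 > 0" by (simp add: add_nonneg_pos)
        then have "r * (4 * (4 * B\<^sup>2 + 1)) = e\<^sup>2" by (simp add: r_def)
        then show ?thesis using r by (simp add: algebra_simps)
      qed
      finally show "(\<Sum>k\<in>G. (norm (coef (fmul (m n) a - fmul m0 a) k))\<^sup>2) \<le> (sqrt (e\<^sup>2 / 2))\<^sup>2"
        using elim by simp
    qed simp
    also have "\<dots> < e" using e by (intro real_less_lsqrt) (auto simp: power2_eq_square)
    finally show ?case by (simp add: dist_norm)
  qed
qed

definition heatX :: "real \<Rightarrow> 'd::finite hseq \<Rightarrow> 'd hseq" where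
  "heatX t = fmul (\<lambda>k. complex_of_real (exp (- t * freq_sq k)))"

definition translate :: "real ^ 'd::finite \<Rightarrow> 'd hseq \<Rightarrow> 'd hseq" where
  "translate v = fmul (\<lambda>k. character k v)"

lemma multiplier_heat: "t \<ge> 0 \<Longrightarrow> multiplier 1 (\<lambda>k. complex_of_real (exp (- t * freq_sq k)))"
  by (simp add: multiplier_def freq_sq_uminus freq_sq_nonneg)

lemma multiplier_character: "multiplier 1 (\<lambda>k. character k v)"
  by (simp add: multiplier_def character_uminus)

lemma norm_heatX_le: "t \<ge> 0 \<Longrightarrow> norm (heatX t a) \<le> norm a" for a :: "'d::finite hseq"
  unfolding heatX_def using norm_fmul_le[OF multiplier_heat] by simp

lemma norm_translate_le: "norm (translate v a) \<le> norm a" for a :: "'d::finite hseq"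
  unfolding translate_def using norm_fmul_le[OF multiplier_character] by simp

lemma bounded_linear_heatX: "t \<ge> 0 \<Longrightarrow> bounded_linear (heatX t :: 'd::finite hseq \<Rightarrow> _)"
  unfolding heatX_def by (rule bounded_linear_fmul[OF multiplier_heat])

lemma heatX_heatX: "s \<ge> 0 \<Longrightarrow> t \<ge> 0 \<Longrightarrow> heatX s (heatX t a) = heatX (s + t) a"
  unfolding heatX_def
  by (subst fmul_fmul[OF multiplier_heat multiplier_heat]) (simp_all add: ring_distribs exp_diff exp_minus field_simps flip: exp_add of_real_mult)

lemma heatX_0 [simp]: "heatX 0 a = a"
  unfolding heatX_def by (rule coef_eqI) (simp only: coef_fmul[OF multiplier_heat[OF order_refl]], simp)

lemma translate_tendsto:
  fixes v :: "'b \<Rightarrow> real ^ 'd::finite"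
  assumes "(v \<longlongrightarrow> w) F"
  shows "((\<lambda>n. translate (v n) a) \<longlongrightarrow> translate w a) F"
  unfolding translate_def
proof (rule fmul_tendsto[OF multiplier_character multiplier_character])
  show "((\<lambda>n. character k (v n)) \<longlongrightarrow> character k w) F" for k
    unfolding character_def using assms by (intro tendsto_intros)
qed

text \<open>Joint continuity in time and state: multiplier convergence at the fixed
  \<open>a\<close>, and contraction for the difference \<open>x n - a\<close>.\<close>

lemma heatX_tendsto:
  fixes a :: "'d::finite hseq"
  assumes t: "(t \<longlongrightarrow> t0) F" "\<And>n. t n \<ge> 0" "t0 \<ge> 0" and x: "(x \<longlongrightarrow> a) F"
  shows "((\<lambda>n. heatX (t n) (x n)) \<longlongrightarrow> heatX t0 a) F"
proof -
  have "((\<lambda>n. heatX (t n) a) \<longlongrightarrow> heatX t0 a) F"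
    unfolding heatX_def using t
    by (intro fmul_tendsto[where B = 1] multiplier_heat tendsto_intros) auto
  moreover have "((\<lambda>n. heatX (t n) (x n - a)) \<longlongrightarrow> 0) F"
  proof (rule Lim_null_comparison)
    show "\<forall>\<^sub>F n in F. norm (heatX (t n) (x n - a)) \<le> norm (x n - a)"
      using t(2) by (intro always_eventually allI norm_heatX_le)
    show "((\<lambda>n. norm (x n - a)) \<longlongrightarrow> 0) F" using x by (simp add: LIM_zero_iff tendsto_norm_zero_iff)
  qed
  ultimately have "((\<lambda>n. heatX (t n) a + heatX (t n) (x n - a)) \<longlongrightarrow> heatX t0 a + 0) F"
    by (rule tendsto_add)
  then show ?thesis
    using t(2) by (simp add: linear_diff[OF bounded_linear.linear[OF bounded_linear_heatX]])
qed

section \<open>Uniform approximation by elements of \<open>H^s\<close> and uniqueness of Fourier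
  coefficients\<close>

context sobolev_exponent
begin

text \<open>Stone-Weierstrass on the image of \<open>torus_map\<close>, for the algebra of
  continuous functions that pull back to some \<open>ev a\<close>.\<close>

lemma uniform_approx:
  assumes "periodic f" "continuous_on UNIV f" "e > 0"
  obtains a where "\<And>x. \<bar>f x - ev a x\<bar> < e"
proof -
  define R where "R = {F. continuous_on (range torus_map) F \<and> (\<exists>a. \<forall>x. F (torus_map x) = ev a x)}"
  interpret function_ring_on R "range (torus_map :: real ^ 'd \<Rightarrow> _)"
  proof
    show "compact (range (torus_map :: real ^ 'd \<Rightarrow> _))" by (rule compact_torus)
    show "continuous_on (range torus_map) F" if "F \<in> R" for F using that by (simp add: R_def)
    show "(\<lambda>z. F z + G z) \<in> R" if "F \<in> R" "G \<in> R" for F G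
      using that unfolding R_def by (auto intro!: continuous_intros) (metis ev_add)
    show "(\<lambda>z. F z * G z) \<in> R" if "F \<in> R" "G \<in> R" for F G
      using that unfolding R_def by (auto intro!: continuous_intros) (metis ev_mult)
    show "(\<lambda>_. c) \<in> R" for c unfolding R_def by (auto intro!: exI[of _ "const c"])
    fix z w :: "complex ^ 'd" assume z: "z \<in> range torus_map" "w \<in> range torus_map" "z \<noteq> w"
    then obtain i where i: "z $ i \<noteq> w $ i" by (auto simp: vec_eq_iff)
    \<comment> \<open>The frequency \<open>axis i 1\<close> is the \<open>i\<close>-th coordinate on
      the torus; \<open>single\<close> with \<open>c = 1\<close> and \<open>c = \<i>\<close> gives
      its real and imaginary part up to a factor, and these separate points.\<close>
    have chr: "character (axis i 1) x = torus_map x $ i" for x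
    proof -
      have "(\<Sum>j\<in>UNIV. real_of_int (axis i 1 $ j) * x $ j) = (\<Sum>j\<in>{i}. real_of_int (axis i 1 $ j) * x $ j)"
        by (rule sum.mono_neutral_right) (auto simp: axis_def)
      then show ?thesis by (simp add: character_def torus_map_def axis_def)
    qed
    have R: "(\<lambda>z. 2 * Re (c * z $ i)) \<in> R" for c
    proof -
      have "\<forall>x. 2 * Re (c * torus_map x $ i) = ev (single (axis i 1) c) x"
        unfolding ev_single chr by simp
      then show ?thesis unfolding R_def by (auto intro!: continuous_intros)
    qed
    show "\<exists>F\<in>R. F z \<noteq> F w"
    proof (cases "Re (z $ i) = Re (w $ i)")
      case True
      then have "Im (z $ i) \<noteq> Im (w $ i)" using i by (simp add: complex_eq_iff)
      then show ?thesis by (intro bexI[OF _ R[of \<i>]]) simp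
    next
      case False
      then show ?thesis by (intro bexI[OF _ R[of 1]]) simp
    qed
  qed
  obtain F where F: "continuous_on (range torus_map) F" "\<And>x. F (torus_map x) = f x"
    using periodic_factor[OF assms(1,2)] by blast
  obtain G where "G \<in> R" "\<forall>z\<in>range torus_map. \<bar>F z - G z\<bar> < e"
    using Stone_Weierstrass_basic[OF F(1) assms(3)] by blast
  then obtain a where a: "\<And>x. \<bar>F (torus_map x) - G (torus_map x)\<bar> < e" "\<And>x. G (torus_map x) = ev a x"
    unfolding R_def by blast
  show thesis by (rule that[of a]) (use a(1) in \<open>simp add: F(2) a(2)\<close>)
qed

text \<open>\<open>f\<close> is orthogonal to all finite sums of characters and uniformly close to
  one of them, so the integral of its square is arbitrarily small; continuity and periodicity then
  force \<open>f = 0\<close>.\<close>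

lemma fourier_uniqueness:
  fixes f :: "real ^ 'd \<Rightarrow> real"
  assumes f: "periodic f" "continuous_on UNIV f" and z: "\<And>k. fourier_coeff f k = (0 :: complex)"
  shows "f x = 0"
proof -
  let ?M = "lebesgue_on (torus_cell :: (real ^ 'd) set)"
  obtain B where B: "B > 0" "\<And>x. \<bar>f x\<bar> \<le> B" using periodic_bounded[OF f] by blast
  have int0: "(LINT x|?M. complex_of_real (f x) * character k x) = 0" for k
    using z[of "- k"] by (simp add: fourier_coeff_def character_uminus)
  have le: "(LINT x|?M. (f x)\<^sup>2) \<le> (2 * pi) ^ CARD('d) * (B * (2 * e))" if e: "e > 0" for e
  proof -
    obtain a where a: "\<And>x. \<bar>f x - ev a x\<bar> < e" using uniform_approx[OF f e] by blast
    have "uniform_limit UNIV (\<lambda>F x. \<Sum>k\<in>F. fc a k * character k x) (\<lambda>x. complex_of_real (ev a x)) (finite_subsets_at_top UNIV)"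
      using fc_abs_summable ev_has_sum
      by (intro Weierstrass_m_test_general'[where M = "\<lambda>k. norm (fc a k)"]) (auto simp: norm_mult)
    from uniform_limitD[OF this e] obtain F where F: "finite F"
      "\<And>x. dist (\<Sum>k\<in>F. fc a k * character k x) (complex_of_real (ev a x)) < e"
      unfolding eventually_finite_subsets_at_top by auto
    let ?P = "\<lambda>x. \<Sum>k\<in>F. fc a k * character k x"
    have zero: "(LINT x|?M. complex_of_real (f x) * ?P x) = 0"
    proof -
      have "(LINT x|?M. complex_of_real (f x) * ?P x) = (LINT x|?M. (\<Sum>k\<in>F. fc a k * (complex_of_real (f x) * character k x)))"
        by (simp add: sum_distrib_left mult_ac)
      also have "\<dots> = (\<Sum>k\<in>F. LINT x|?M. fc a k * (complex_of_real (f x) * character k x))"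
        by (intro Bochner_Integration.integral_sum cont_integrable_cell continuous_intros f)
      finally show ?thesis by (simp add: int0)
    qed
    \<comment> \<open>One \<open>e\<close> comes from \<open>uniform_approx\<close>, the other from
      truncating the Fourier series.\<close>
    have near: "norm (complex_of_real (f x) - ?P x) \<le> 2 * e" for x
    proof -
      have "complex_of_real (f x) - ?P x = complex_of_real (f x - ev a x) + (complex_of_real (ev a x) - ?P x)"
        by simp
      also have "norm \<dots> \<le> norm (complex_of_real (f x - ev a x)) + norm (complex_of_real (ev a x) - ?P x)"
        by (rule norm_triangle_ineq)
      also have "\<dots> \<le> 2 * e" using a[of x] F(2)[of x] unfolding norm_of_real by (simp add: dist_norm norm_minus_commute)
      finally show ?thesis .
    qed
    have "complex_of_real (LINT x|?M. (f x)\<^sup>2) = (LINT x|?M. complex_of_real ((f x)\<^sup>2))"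
      by (rule integral_complex_of_real[symmetric])
    also have "\<dots> = (LINT x|?M. complex_of_real (f x) * complex_of_real (f x)) - (LINT x|?M. complex_of_real (f x) * ?P x)"
      unfolding zero by (simp add: power2_eq_square)
    also have "\<dots> = (LINT x|?M. complex_of_real (f x) * complex_of_real (f x) - complex_of_real (f x) * ?P x)"
      by (intro Bochner_Integration.integral_diff[symmetric] cont_integrable_cell continuous_intros f)
    finally have "norm (complex_of_real (LINT x|?M. (f x)\<^sup>2)) =
        norm (LINT x|?M. complex_of_real (f x) * complex_of_real (f x) - complex_of_real (f x) * ?P x)" by simp
    also have "\<dots> \<le> (2 * pi) ^ CARD('d) * (B * (2 * e))"
      unfolding right_diff_distrib[symmetric]
      by (intro norm_integral_cell_le) (use near B in \<open>auto simp: norm_mult intro!: mult_mono\<close>)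
    finally show ?thesis unfolding norm_of_real by linarith
  qed
  have "(LINT x|?M. (f x)\<^sup>2) \<le> 0"
  proof (rule field_le_epsilon)
    fix e :: real assume "e > 0"
    then show "(LINT x|?M. (f x)\<^sup>2) \<le> 0 + e"
      using le[of "e / ((2 * pi) ^ CARD('d) * B * 2)"] B(1) by (simp add: field_simps)
  qed
  moreover have "(LINT x|?M. (f x)\<^sup>2) \<ge> 0" by simp
  ultimately have "(LINT x|?M. (f x)\<^sup>2) = 0" by linarith
  then have cell: "f y = 0" if "y \<in> torus_cell" for y
    using integral_zero_cell[OF f(2)] that by blast
  obtain y where "y \<in> torus_cell" "torus_map y = torus_map x" using torus_map_cell[of x] by blast
  then show ?thesis using periodic_torus_map_eq[OF f(1), of y x] cell by simp
qed

definition emb :: "(real ^ 'd \<Rightarrow> real) \<Rightarrow> 'd hseq" where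
  "emb f = hseq (\<lambda>k. complex_of_real (wt k) * fourier_coeff f k)"

lemma fc_emb:
  assumes "f \<in> sobolev s"
  shows "fc (emb f) k = fourier_coeff f k"
proof -
  have "(\<lambda>k. (2 * pi) ^ CARD('d) * ((1 + freq_sq k) ^ s * (norm (fourier_coeff f k))\<^sup>2)) summable_on UNIV"
    using assms unfolding sobolev_def by (intro summable_on_cmult_right) auto
  then have "coef (emb f) = (\<lambda>k. complex_of_real (wt k) * fourier_coeff f k)"
    unfolding emb_def
    by (intro coef_hseq)
       (auto simp: wt_uminus fourier_coeff_uminus norm_mult power_mult_distrib wt_sq mult.assoc)
  then show ?thesis by (simp add: fc_def)
qed

text \<open>Both sides are continuous and periodic with the same Fourier coefficients. Thus
  \<open>ev\<close> identifies \<open>'d hseq\<close> with \<open>sobolev s\<close>.\<close>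

lemma ev_emb:
  assumes "f \<in> sobolev s"
  shows "ev (emb f) = f"
proof
  fix x
  have f: "periodic f" "continuous_on UNIV f" using assms by (auto simp: sobolev_def)
  have "f x - ev (emb f) x = 0"
  proof (rule fourier_uniqueness)
    show "periodic (\<lambda>x. f x - ev (emb f) x)"
      using f(1) periodic_ev[of "emb f"] by (simp add: periodic_def)
    show "continuous_on UNIV (\<lambda>x. f x - ev (emb f) x)" by (intro continuous_intros f continuous_on_ev)
    show "fourier_coeff (\<lambda>x. f x - ev (emb f) x) k = 0" for k
      using f by (subst fourier_coeff_diff) (auto simp: continuous_on_ev fourier_coeff_ev fc_emb assms)
  qed
  then show "ev (emb f) x = f x" by simp
qed

lemma emb_ev [simp]: "emb (ev a) = a"
  by (rule ev_inj) (rule ev_emb[OF ev_in_sobolev])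

lemma fc_fmul: "multiplier B m \<Longrightarrow> fc (fmul m a) k = m k * fc a k"
  by (simp add: fc_def coef_fmul)

lemma ev_translate: "ev (translate v a) x = ev a (x + v)"
proof (rule ev_eq_of_has_sum)
  show "((\<lambda>k. fc (translate v a) k * character k x) has_sum complex_of_real (ev a (x + v))) UNIV"
    using ev_has_sum[of a "x + v"]
    by (simp add: translate_def fc_fmul[OF multiplier_character] character_add_arg mult_ac)
qed

lemma heat_ev:
  assumes "t \<ge> 0"
  shows "heat t (ev a) = ev (heatX t a)"
proof
  fix x
  show "heat t (ev a) x = ev (heatX t a) x"
    unfolding heat_def ev_def heatX_def fc_fmul[OF multiplier_heat[OF assms]] fourier_coeff_ev[unfolded ev_def] by simp
qed

text \<open>For \<open>ev a\<close> this is the multiplier formula of \<open>translate\<close>;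
  uniform approximation carries it over to every continuous periodic function.\<close>

lemma fourier_coeff_shift:
  fixes f :: "real ^ 'd \<Rightarrow> real"
  assumes f: "periodic f" "continuous_on UNIV f"
  shows "fourier_coeff (\<lambda>x. f (x + v)) k = character k v * (fourier_coeff f k :: complex)"
proof -
  have cs: "continuous_on UNIV (\<lambda>x. g (x + v))" if "continuous_on UNIV g" for g :: "real ^ 'd \<Rightarrow> real"
    by (rule continuous_on_compose2[OF that]) (auto intro!: continuous_intros)
  have "norm (fourier_coeff (\<lambda>x. f (x + v)) k - character k v * fourier_coeff f k) \<le> e" if "e > 0" for e
  proof -
    have "e / 2 > 0" using that by simp
    then obtain a where a: "\<And>x. \<bar>f x - ev a x\<bar> < e / 2" using uniform_approx[OF f] by blast
    have eq: "fourier_coeff (\<lambda>x. ev a (x + v)) k = character k v * fourier_coeff (ev a) k"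
    proof -
      have "(\<lambda>x. ev a (x + v)) = ev (translate v a)" by (simp add: ev_translate fun_eq_iff)
      then show ?thesis by (simp add: fourier_coeff_ev translate_def fc_fmul[OF multiplier_character])
    qed
    have "fourier_coeff (\<lambda>x. f (x + v)) k - character k v * fourier_coeff f k =
        fourier_coeff (\<lambda>x. f (x + v) - ev a (x + v)) k - character k v * fourier_coeff (\<lambda>x. f x - ev a x) k"
      using fourier_coeff_diff[OF cs[OF f(2)] cs[OF continuous_on_ev], of a k]
        fourier_coeff_diff[OF f(2) continuous_on_ev, of a k]
      by (simp add: eq right_diff_distrib)
    also have "norm \<dots> \<le> norm (fourier_coeff (\<lambda>x. f (x + v) - ev a (x + v)) k) + norm (character k v * fourier_coeff (\<lambda>x. f x - ev a x) k)"
      by (rule norm_triangle_ineq4)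
    also have "\<dots> \<le> e / 2 + e / 2"
      unfolding norm_mult norm_character mult_1
      using a by (intro add_mono norm_fourier_coeff_le) (auto intro: less_imp_le)
    finally show ?thesis by simp
  qed
  then have "norm (fourier_coeff (\<lambda>x. f (x + v)) k - character k v * fourier_coeff f k) \<le> 0"
    by (rule field_le_epsilon) simp
  then show ?thesis by simp
qed

subsection \<open>Multiplication by exponentials and powers\<close>

lemmas bounded_linear_mult_right = bounded_bilinear.bounded_linear_right[OF bounded_bilinear_mult]

definition expX_term :: "'d hseq \<Rightarrow> 'd hseq \<Rightarrow> nat \<Rightarrow> 'd hseq" where
  "expX_term f y n = (mult f ^^ n) y /\<^sub>R fact n"

text \<open>The exponential of the operator \<open>mult f\<close>, applied to \<open>y\<close>,
  rather than a product with an exponential element: the bound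
  \<open>exp (mult_const * norm f) * norm y\<close> then comes without a further constant, and only
  so can a scalar factor turn it into a contraction in
  \<open>fast_steer_BB_saturation\<close>.\<close>

definition expX :: "'d hseq \<Rightarrow> 'd hseq \<Rightarrow> 'd hseq" where
  "expX f y = (\<Sum>n. expX_term f y n)"

lemma norm_expX_term: "norm (expX_term f y n) \<le> (mult_const * norm f) ^ n /\<^sub>R fact n * norm y"
proof -
  have "norm ((mult f ^^ n) y) \<le> (mult_const * norm f) ^ n * norm y"
  proof (induction n)
    case (Suc n)
    have "norm ((mult f ^^ Suc n) y) \<le> mult_const * norm f * norm ((mult f ^^ n) y)"
      by (simp add: norm_mult_le)
    also have "\<dots> \<le> mult_const * norm f * ((mult_const * norm f) ^ n * norm y)"
      by (intro mult_left_mono Suc.IH) (simp add: mult_const_nonneg)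
    finally show ?case by (simp add: mult_ac)
  qed simp
  then have "norm ((mult f ^^ n) y) /\<^sub>R fact n \<le> ((mult_const * norm f) ^ n * norm y) /\<^sub>R fact n"
    by (intro scaleR_left_mono) auto
  then show ?thesis by (simp add: expX_term_def mult_ac)
qed

lemma sums_exp_bound: "(\<lambda>n. (mult_const * norm f) ^ n /\<^sub>R fact n * norm y) sums (exp (mult_const * norm f) * norm y)"
  by (intro sums_mult2 exp_converges)

lemma summable_expX_term: "summable (expX_term f y)"
  by (rule summable_comparison_test[OF _ sums_summable[OF sums_exp_bound[of f y]]])
     (use norm_expX_term in blast)

lemma norm_expX_le: "norm (expX f y) \<le> exp (mult_const * norm f) * norm y"
proof -
  have "norm (expX f y) \<le> (\<Sum>n. (mult_const * norm f) ^ n /\<^sub>R fact n * norm y)"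
    unfolding expX_def by (intro norm_suminf_le norm_expX_term sums_summable[OF sums_exp_bound])
  then show ?thesis using sums_unique[OF sums_exp_bound[of f y]] by simp
qed

lemma norm_expX_diff_le: "norm (expX f y - y) \<le> (exp (mult_const * norm f) - 1) * norm y"
proof -
  have sm: "(\<lambda>n. (mult_const * norm f) ^ Suc n /\<^sub>R fact (Suc n) * norm y) sums (exp (mult_const * norm f) * norm y - norm y)"
    using sums_split_initial_segment[OF sums_exp_bound[of f y], of 1] by simp
  have "expX f y = expX_term f y 0 + (\<Sum>n. expX_term f y (Suc n))"
    unfolding expX_def using suminf_split_head[OF summable_expX_term[of f y]] by simp
  then have "expX f y - y = (\<Sum>n. expX_term f y (Suc n))" by (simp add: expX_term_def)
  also have "norm \<dots> \<le> (\<Sum>n. (mult_const * norm f) ^ Suc n /\<^sub>R fact (Suc n) * norm y)"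
    by (intro norm_suminf_le norm_expX_term sums_summable[OF sm])
  also have "\<dots> = exp (mult_const * norm f) * norm y - norm y" using sums_unique[OF sm] by simp
  finally show ?thesis by (simp add: left_diff_distrib)
qed

lemma ev_expX: "ev (expX f y) x = exp (ev f x) * ev y x"
proof -
  have t: "ev (expX_term f y n) x = ev f x ^ n /\<^sub>R fact n * ev y x" for n
  proof -
    have "ev ((mult f ^^ n) y) x = ev f x ^ n * ev y x"
      by (induction n) (simp_all add: ev_mult)
    then show ?thesis by (simp add: expX_term_def ev_scaleR)
  qed
  have "(\<lambda>n. ev (expX_term f y n) x) sums ev (expX f y) x"
    unfolding expX_def by (intro bounded_linear.sums[OF bounded_linear_ev] summable_sums summable_expX_term)
  moreover have "(\<lambda>n. ev (expX_term f y n) x) sums (exp (ev f x) * ev y x)"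
    unfolding t by (intro sums_mult2 exp_converges)
  ultimately show ?thesis by (rule sums_unique2)
qed

lemma expX_expX: "expX f (expX g y) = expX (f + g) y"
  by (rule ev_eqI) (simp add: ev_expX ev_add exp_add)

lemma expX_0 [simp]: "expX 0 y = y"
  by (rule ev_eqI) (simp add: ev_expX)

lemma bounded_linear_expX: "bounded_linear (expX f)"
proof (rule bounded_linear_intro)
  show "norm (expX f y) \<le> norm y * exp (mult_const * norm f)" for y
    using norm_expX_le[of f y] by (simp add: mult.commute)
qed (rule ev_eqI, simp add: ev_expX ev_add ev_scaleR algebra_simps)+

lemma expX_tendsto:
  assumes f: "(f \<longlongrightarrow> f0) F" and y: "(y \<longlongrightarrow> y0) F"
  shows "((\<lambda>n. expX (f n) (y n)) \<longlongrightarrow> expX f0 y0) F"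
proof -
  have "((\<lambda>n. expX f0 (y n)) \<longlongrightarrow> expX f0 y0) F"
    by (rule bounded_linear.tendsto[OF bounded_linear_expX y])
  moreover have "((\<lambda>n. expX (f n) (y n) - expX f0 (y n)) \<longlongrightarrow> 0) F"
  proof (rule Lim_null_comparison)
    \<comment> \<open>Writing \<open>e^f = e^(f - f0) e^f0\<close> reduces the dependence on
      \<open>f\<close> to \<open>norm_expX_diff_le\<close>.\<close>
    have eq: "expX (f n) (y n) = expX (f n - f0) (expX f0 (y n))" for n
      by (simp add: expX_expX)
    show "\<forall>\<^sub>F n in F. norm (expX (f n) (y n) - expX f0 (y n)) \<le>
        (exp (mult_const * norm (f n - f0)) - 1) * norm (expX f0 (y n))"
      unfolding eq by (intro always_eventually allI norm_expX_diff_le)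
    have "((\<lambda>n. (exp (mult_const * norm (f n - f0)) - 1) * norm (expX f0 (y n))) \<longlongrightarrow>
        (exp (mult_const * norm (f0 - f0)) - 1) * norm (expX f0 y0)) F"
      by (intro tendsto_intros f bounded_linear.tendsto[OF bounded_linear_expX y])
    then show "((\<lambda>n. (exp (mult_const * norm (f n - f0)) - 1) * norm (expX f0 (y n))) \<longlongrightarrow> 0) F"
      by simp
  qed
  ultimately show ?thesis using tendsto_add by fastforce
qed

primrec powX :: "'d hseq \<Rightarrow> nat \<Rightarrow> 'd hseq" where
  "powX y 0 = const 1"
| "powX y (Suc n) = mult y (powX y n)"

lemma ev_powX: "ev (powX y n) x = ev y x ^ n"
  by (induction n) (simp_all add: ev_mult)

lemma powX_bounded_Lipschitz:
  assumes "R \<ge> 0"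
  shows "\<exists>K\<ge>0. (\<forall>x. norm x \<le> R \<longrightarrow> norm (powX x n) \<le> K) \<and>
    (\<forall>x y. norm x \<le> R \<longrightarrow> norm y \<le> R \<longrightarrow> norm (powX x n - powX y n) \<le> K * norm (x - y))"
proof (induction n)
  case 0
  show ?case by (intro exI[of _ "norm (const 1)"]) auto
next
  case (Suc n)
  then obtain K where K: "K \<ge> 0" "\<And>x. norm x \<le> R \<Longrightarrow> norm (powX x n) \<le> K"
    "\<And>x y. norm x \<le> R \<Longrightarrow> norm y \<le> R \<Longrightarrow> norm (powX x n - powX y n) \<le> K * norm (x - y)" by blast
  define K' where "K' = mult_const * R * K + mult_const * K"
  have nn: "mult_const * R * K \<ge> 0" "mult_const * K \<ge> 0" using K(1) assms mult_const_nonneg by auto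
  have "norm (powX x (Suc n)) \<le> K'" if "norm x \<le> R" for x
  proof -
    have "norm (powX x (Suc n)) \<le> mult_const * norm x * norm (powX x n)" by (simp add: norm_mult_le)
    also have "\<dots> \<le> mult_const * R * K"
      using that K assms mult_const_nonneg by (intro mult_mono) auto
    finally show ?thesis using nn by (simp add: K'_def)
  qed
  moreover have "norm (powX x (Suc n) - powX y (Suc n)) \<le> K' * norm (x - y)"
    if xy: "norm x \<le> R" "norm y \<le> R" for x y
  proof -
    have "powX x (Suc n) - powX y (Suc n) = mult x (powX x n - powX y n) + mult (x - y) (powX y n)"
      by (rule ev_eqI) (simp add: ev_mult ev_add ev_diff algebra_simps)
    also have "norm \<dots> \<le> mult_const * norm x * norm (powX x n - powX y n) + mult_const * norm (x - y) * norm (powX y n)"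
      by (intro norm_triangle_le add_mono norm_mult_le)
    also have "\<dots> \<le> mult_const * R * (K * norm (x - y)) + mult_const * norm (x - y) * K"
      using xy K assms mult_const_nonneg by (intro add_mono mult_mono) auto
    finally show ?thesis by (simp add: K'_def algebra_simps)
  qed
  ultimately show ?case using nn by (intro exI[of _ K']) (auto simp: K'_def)
qed

end

subsection \<open>Differentiation\<close>

text \<open>The inverse of 1 minus the Laplacian. Writing a smooth function as
  \<open>resolvent b\<close> turns its derivatives and Taylor remainders into bounded operators
  applied to \<open>b\<close>, within one space.\<close>

definition resolvent :: "'d::finite hseq \<Rightarrow> 'd hseq" where
  "resolvent = fmul (\<lambda>k. complex_of_real (1 / (1 + freq_sq k)))"

text \<open>The \<open>i\<close>-th partial derivative of \<open>resolvent b\<close>, bounded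
  because \<open>\<bar>k $ i\<bar> \<le> 1 + freq_sq k\<close>.\<close>

definition deriv_res :: "'d \<Rightarrow> 'd::finite hseq \<Rightarrow> 'd hseq" where
  "deriv_res i = fmul (\<lambda>k. \<i> * real_of_int (k $ i) / (1 + freq_sq k))"

lemma one_plus_freq_sq_pos: "1 + freq_sq k > 0"
  using freq_sq_nonneg[of k] by linarith

lemma multiplier_resolvent: "multiplier 1 (\<lambda>k. complex_of_real (1 / (1 + freq_sq k)))"
  unfolding multiplier_def norm_of_real
  by (auto simp: freq_sq_uminus freq_sq_nonneg add_nonneg_nonneg divide_le_eq_1)

lemma multiplier_deriv_res: "multiplier 1 (\<lambda>k. \<i> * real_of_int (k $ i) / (1 + freq_sq k))"
proof -
  have "\<bar>real_of_int (k $ i)\<bar> \<le> 1 + freq_sq k" for k :: "int ^ 'a"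
  proof -
    have "0 \<le> (\<bar>real_of_int (k $ i)\<bar> - 1)\<^sup>2" by simp
    then have "2 * \<bar>real_of_int (k $ i)\<bar> \<le> (real_of_int (k $ i))\<^sup>2 + 1"
      by (simp add: power2_diff)
    then show ?thesis using coord_sq_le_freq_sq[of k i] by linarith
  qed
  then have "norm (\<i> * real_of_int (k $ i) / (1 + freq_sq k)) \<le> 1" for k :: "int ^ 'a"
    using one_plus_freq_sq_pos[of k] by (simp add: norm_mult norm_divide del: of_real_add of_real_1)
  then show ?thesis by (auto simp: multiplier_def freq_sq_uminus)
qed

lemma phase_sq_le:
  "(\<Sum>i\<in>UNIV. real_of_int (k $ i) * v $ i)\<^sup>2 \<le> freq_sq k * (norm v)\<^sup>2"
proof -
  have "\<bar>\<Sum>i\<in>UNIV. real_of_int (k $ i) * v $ i\<bar> \<le> (\<Sum>i\<in>UNIV. \<bar>real_of_int (k $ i)\<bar> * \<bar>v $ i\<bar>)"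
    by (rule order_trans[OF sum_abs]) (simp add: abs_mult)
  also have "\<dots> \<le> L2_set (\<lambda>i. real_of_int (k $ i)) UNIV * L2_set (\<lambda>i. v $ i) UNIV"
    by (rule L2_set_mult_ineq)
  finally have "\<bar>\<Sum>i\<in>UNIV. real_of_int (k $ i) * v $ i\<bar>\<^sup>2 \<le> (sqrt (freq_sq k) * norm v)\<^sup>2"
    by (intro power_mono) (auto simp: norm_vec_def L2_set_def freq_sq_def)
  then show ?thesis by (simp add: power_mult_distrib freq_sq_nonneg)
qed

lemma character_iexp: "character k v = iexp (\<Sum>i\<in>UNIV. real_of_int (k $ i) * v $ i)"
  by (simp add: character_def cis_conv_exp)

lemma multiplier_diff_quot:
  "multiplier (norm v) (\<lambda>k. (character k v - 1) * complex_of_real (1 / (1 + freq_sq k)))"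
proof -
  have "norm ((character k v - 1) * complex_of_real (1 / (1 + freq_sq k))) \<le> norm v" for k
  proof -
    let ?t = "\<Sum>i\<in>UNIV. real_of_int (k $ i) * v $ i"
    have "norm (character k v - 1) \<le> \<bar>?t\<bar>"
      using iexp_approx1[of ?t 0] by (simp add: character_iexp)
    also have "\<dots> \<le> sqrt (freq_sq k) * norm v"
      using real_sqrt_le_mono[OF phase_sq_le[of k v]] by (simp add: real_sqrt_mult)
    also have "\<dots> \<le> (1 + freq_sq k) * norm v"
    proof (rule mult_right_mono)
      have "0 \<le> (sqrt (freq_sq k) - 1)\<^sup>2" by simp
      then show "sqrt (freq_sq k) \<le> 1 + freq_sq k"
        using real_sqrt_ge_zero[OF freq_sq_nonneg[of k]] freq_sq_nonneg[of k]
        by (simp add: power2_diff)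
    qed simp
    finally show ?thesis
      using one_plus_freq_sq_pos[of k] unfolding norm_mult norm_of_real by (simp add: field_simps)
  qed
  then show ?thesis by (simp add: multiplier_def freq_sq_uminus character_uminus)
qed

text \<open>The modulus of \<open>character k v - 1\<close> is at most the phase, hence at most
  \<open>sqrt (freq_sq k) * norm v\<close>, and the resolvent absorbs the frequency. Linearity in
  \<open>norm v\<close> is what later dominates the conjugated integrand.\<close>

lemma norm_translate_diff_le: "norm (translate v (resolvent b) - resolvent b) \<le> norm v * norm b"
proof -
  have "translate v (resolvent b) - resolvent b = fmul (\<lambda>k. (character k v - 1) * complex_of_real (1 / (1 + freq_sq k))) b"
    unfolding translate_def resolvent_def
    by (rule coef_eqI)
       (simp only: coef_diff coef_fmul[OF multiplier_character] coef_fmul[OF multiplier_resolvent]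
         coef_fmul[OF multiplier_diff_quot], simp add: algebra_simps diff_divide_distrib)
  then show ?thesis using norm_fmul_le[OF multiplier_diff_quot] by simp
qed

lemma multiplier_taylor:
  "multiplier ((norm v)\<^sup>2) (\<lambda>k. (character k v - 1 - \<i> * (\<Sum>i\<in>UNIV. real_of_int (k $ i) * v $ i)) * complex_of_real (1 / (1 + freq_sq k)))"
proof -
  have "norm ((character k v - 1 - \<i> * (\<Sum>i\<in>UNIV. real_of_int (k $ i) * v $ i)) * complex_of_real (1 / (1 + freq_sq k))) \<le> (norm v)\<^sup>2" for k
  proof -
    let ?t = "\<Sum>i\<in>UNIV. real_of_int (k $ i) * v $ i"
    have "norm (character k v - 1 - \<i> * ?t) \<le> ?t\<^sup>2 / 2"
      using iexp_approx1[of ?t 1] by (simp add: character_iexp algebra_simps power2_eq_square)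
    also have "\<dots> \<le> freq_sq k * (norm v)\<^sup>2"
      using phase_sq_le[of k v] zero_le_power2[of ?t] by linarith
    also have "\<dots> \<le> (1 + freq_sq k) * (norm v)\<^sup>2" by (intro mult_right_mono) auto
    finally show ?thesis
      using one_plus_freq_sq_pos[of k] unfolding norm_mult norm_of_real by (simp add: field_simps)
  qed
  then show ?thesis by (auto simp: multiplier_def freq_sq_uminus character_uminus sum_negf)
qed

text \<open>The second order remainder of a character is at most the squared phase, which grows like
  \<open>freq_sq k\<close> and is absorbed by the resolvent. The expansion thus holds in
  \<open>H^s\<close>, not just pointwise.\<close>

lemma norm_taylor_le:
  "norm (translate v (resolvent b) - resolvent b - (\<Sum>i\<in>UNIV. (v $ i) *\<^sub>R deriv_res i b)) \<le> (norm v)\<^sup>2 * norm b"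
proof -
  let ?m = "\<lambda>k. (character k v - 1 - \<i> * (\<Sum>i\<in>UNIV. real_of_int (k $ i) * v $ i)) * complex_of_real (1 / (1 + freq_sq k))"
  have "translate v (resolvent b) - resolvent b - (\<Sum>i\<in>UNIV. (v $ i) *\<^sub>R deriv_res i b) = fmul ?m b"
  proof (rule coef_eqI)
    fix k
    have "coef (\<Sum>i\<in>UNIV. (v $ i) *\<^sub>R deriv_res i b) k = (\<Sum>i\<in>UNIV. (v $ i) *\<^sub>R (\<i> * real_of_int (k $ i) / (1 + freq_sq k) * coef b k))"
      unfolding deriv_res_def
      by (simp only: linear_sum[OF bounded_linear.linear[OF bounded_linear_coef]] coef_scaleR coef_fmul[OF multiplier_deriv_res])
    also have "\<dots> = \<i> * (\<Sum>i\<in>UNIV. real_of_int (k $ i) * v $ i) * complex_of_real (1 / (1 + freq_sq k)) * coef b k"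
      by (simp add: sum_distrib_left sum_distrib_right scaleR_conv_of_real sum_divide_distrib mult_ac)
    finally show "coef (translate v (resolvent b) - resolvent b - (\<Sum>i\<in>UNIV. (v $ i) *\<^sub>R deriv_res i b)) k = coef (fmul ?m b) k"
      unfolding translate_def resolvent_def coef_diff coef_fmul[OF multiplier_character] coef_fmul[OF multiplier_resolvent]
        coef_fmul[OF multiplier_taylor] by (simp add: algebra_simps)
  qed
  then show ?thesis using norm_fmul_le[OF multiplier_taylor] by simp
qed

context sobolev_exponent
begin

lemma has_derivative_ev_resolvent:
  "(ev (resolvent b) has_derivative (\<lambda>w. \<Sum>i\<in>UNIV. w $ i * ev (deriv_res i b) x)) (at x)"
proof -
  have "((\<lambda>h. norm (ev (resolvent b) (x + h) - ev (resolvent b) x - (\<Sum>i\<in>UNIV. h $ i * ev (deriv_res i b) x)) / norm h) \<longlongrightarrow> 0) (at 0)"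
  proof (rule Lim_null_comparison)
    show "\<forall>\<^sub>F h in at 0. norm (norm (ev (resolvent b) (x + h) - ev (resolvent b) x - (\<Sum>i\<in>UNIV. h $ i * ev (deriv_res i b) x)) / norm h)
        \<le> emb_const * norm b * norm h"
    proof (rule always_eventually, rule allI)
      fix h :: "real ^ 'd"
      have "ev (resolvent b) (x + h) - ev (resolvent b) x - (\<Sum>i\<in>UNIV. h $ i * ev (deriv_res i b) x) =
          ev (translate h (resolvent b) - resolvent b - (\<Sum>i\<in>UNIV. (h $ i) *\<^sub>R deriv_res i b)) x"
        by (simp add: ev_diff ev_sum ev_scaleR ev_translate)
      also have "\<bar>\<dots>\<bar> \<le> emb_const * ((norm h)\<^sup>2 * norm b)"
        by (rule order_trans[OF ev_bound]) (intro mult_left_mono norm_taylor_le emb_const_nonneg)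
      finally show "norm (norm (ev (resolvent b) (x + h) - ev (resolvent b) x - (\<Sum>i\<in>UNIV. h $ i * ev (deriv_res i b) x)) / norm h)
          \<le> emb_const * norm b * norm h"
        by (cases "h = 0") (simp_all add: divide_le_eq power2_eq_square mult_ac)
    qed
    have "((\<lambda>h :: real ^ 'd. emb_const * norm b * norm h) \<longlongrightarrow> emb_const * norm b * norm (0 :: real ^ 'd)) (at 0)"
      by (intro tendsto_intros)
    then show "((\<lambda>h :: real ^ 'd. emb_const * norm b * norm h) \<longlongrightarrow> 0) (at 0)" by simp
  qed
  moreover have "bounded_linear (\<lambda>w :: real ^ 'd. \<Sum>i\<in>UNIV. w $ i * ev (deriv_res i b) x)"
    by (intro bounded_linear_sum bounded_linear_mult_const bounded_linear_vec_nth)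
  ultimately show ?thesis unfolding has_derivative_at by blast
qed

lemma partial_deriv_ev_resolvent: "partial_deriv i (ev (resolvent b)) = ev (deriv_res i b)"
proof
  fix x
  have "partial_deriv i (ev (resolvent b)) x = (\<Sum>j\<in>UNIV. axis i 1 $ j * ev (deriv_res j b) x)"
    unfolding partial_deriv_def frechet_derivative_at[OF has_derivative_ev_resolvent, symmetric] ..
  also have "\<dots> = (\<Sum>j\<in>{i}. axis i 1 $ j * ev (deriv_res j b) x)"
    by (rule sum.mono_neutral_right) (auto simp: axis_def)
  finally show "partial_deriv i (ev (resolvent b)) x = ev (deriv_res i b) x" by (simp add: axis_def)
qed

text \<open>The witness has the weighted coefficients of \<open>f\<close> minus its Laplacian; the
  two extra powers of \<open>1 + freq_sq k\<close> in the hypothesis make it square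
  summable.\<close>

lemma sobolev_plus_2_imp_resolvent:
  assumes "f \<in> sobolev (s + 2)"
  obtains b where "f = ev (resolvent b)"
proof -
  have sm: "(\<lambda>k. (2 * pi) ^ CARD('d) * ((1 + freq_sq k) ^ (s + 2) * (norm (fourier_coeff f k))\<^sup>2)) summable_on UNIV"
    using assms unfolding sobolev_def by (intro summable_on_cmult_right) auto
  define h where "h k = complex_of_real ((1 + freq_sq k) * wt k) * fourier_coeff f k" for k
  have "(norm (h k))\<^sup>2 = (2 * pi) ^ CARD('d) * ((1 + freq_sq k) ^ (s + 2) * (norm (fourier_coeff f k))\<^sup>2)" for k
    unfolding h_def norm_mult norm_of_real power_mult_distrib power2_abs
    by (simp add: power_mult_distrib[of "1 + freq_sq k"] wt_sq power_add power2_eq_square[of "1 + freq_sq k"] mult_ac)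
  then have "(\<lambda>k. (norm (h k))\<^sup>2) summable_on UNIV" using sm by simp
  then have ch: "coef (hseq h) = h"
    by (intro coef_hseq) (auto simp: h_def wt_uminus freq_sq_uminus fourier_coeff_uminus)
  have fcr: "fc (resolvent (hseq h)) k = fourier_coeff f k" for k
  proof -
    have "1 + freq_sq k \<noteq> 0" using one_plus_freq_sq_pos[of k] by linarith
    then have "complex_of_real (1 + freq_sq k) \<noteq> 0" using of_real_eq_0_iff by blast
    then show ?thesis
      unfolding resolvent_def fc_fmul[OF multiplier_resolvent]
      by (simp add: fc_def ch h_def del: of_real_add)
  qed
  have "(\<lambda>k. (norm (coef (resolvent (hseq h)) k))\<^sup>2) summable_on UNIV" by (rule summable_coef)
  then have "(\<lambda>k. 1 / (2 * pi) ^ CARD('d) * (norm (coef (resolvent (hseq h)) k))\<^sup>2) summable_on UNIV"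
    by (intro summable_on_cmult_right)
  then have "f \<in> sobolev s"
    using assms by (simp add: sobolev_def norm_coef_sq fcr)
  then have "f = ev (emb f)" by (simp add: ev_emb)
  moreover have "emb f = resolvent (hseq h)"
    by (rule fc_eqI) (simp add: fcr fc_emb \<open>f \<in> sobolev s\<close>)
  ultimately show thesis using that by metis
qed

lemma BB_ev_resolvent:
  "BB (ev (resolvent b)) = ev (\<Sum>i\<in>UNIV. mult (deriv_res i b) (deriv_res i b))"
  by (rule ext) (simp add: BB_def partial_deriv_ev_resolvent ev_sum ev_mult power2_eq_square)

lemma BB_in_sobolev: "(f :: real ^ 'd \<Rightarrow> real) \<in> sobolev (s + 2) \<Longrightarrow> BB f \<in> sobolev s"
  using sobolev_plus_2_imp_resolvent BB_ev_resolvent ev_in_sobolev by metis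

lemma add_in_sobolev: "(f :: real ^ 'd \<Rightarrow> real) \<in> sobolev s \<Longrightarrow> g \<in> sobolev s \<Longrightarrow> f + g \<in> sobolev s"
  using ev_in_sobolev[of "emb f + emb g"] by (simp add: ev_add[abs_def] ev_emb plus_fun_def)

lemma scaleR_in_sobolev: "(f :: real ^ 'd \<Rightarrow> real) \<in> sobolev s \<Longrightarrow> c *\<^sub>R f \<in> sobolev s"
  using ev_in_sobolev[of "c *\<^sub>R emb f"] by (simp add: ev_scaleR[abs_def] ev_emb scaleR_fun_def)

lemma zero_in_sobolev: "(0 :: real ^ 'd \<Rightarrow> real) \<in> sobolev s"
  using ev_in_sobolev[of 0] by (simp add: ev_zero[abs_def] zero_fun_def)

end

subsection \<open>Smooth functions\<close>

text \<open>Difference quotients replace integration by parts: the shift formula gives their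
  coefficients, the mean value theorem bounds them by a bound of the derivative, and dominated
  convergence passes to the limit.\<close>

lemma fourier_coeff_partial_deriv:
  fixes f :: "real ^ 'd::finite \<Rightarrow> real"
  assumes f: "periodic f" "\<And>x. f differentiable (at x)" "continuous_on UNIV (partial_deriv i f)"
  shows "periodic (partial_deriv i f)"
    and "fourier_coeff (partial_deriv i f) k = \<i> * real_of_int (k $ i) * fourier_coeff f k"
proof -
  have D: "(f has_derivative frechet_derivative f (at x)) (at x)" for x
    using f(2) frechet_derivative_works by blast
  show per: "periodic (partial_deriv i f)"
    unfolding periodic_def
  proof (intro allI)
    fix x j
    have "((\<lambda>y. f (y + axis j (2 * pi))) has_derivative frechet_derivative f (at (x + axis j (2 * pi)))) (at x)"
    proof -
      have "((\<lambda>y. y + axis j (2 * pi)) has_derivative (\<lambda>h. h)) (at x)"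
        by (auto intro!: derivative_eq_intros)
      from has_derivative_compose[OF this D] show ?thesis by simp
    qed
    moreover have "(\<lambda>y. f (y + axis j (2 * pi))) = f" using f(1) by (auto simp: periodic_def)
    ultimately have "frechet_derivative f (at (x + axis j (2 * pi))) = frechet_derivative f (at x)"
      using frechet_derivative_at by metis
    then show "partial_deriv i f (x + axis j (2 * pi)) = partial_deriv i f x"
      by (simp add: partial_deriv_def)
  qed
  have cf: "continuous_on UNIV f"
    using f(2) by (simp add: continuous_on_eq_continuous_at differentiable_imp_continuous_within)
  obtain B where B: "\<And>x. \<bar>partial_deriv i f x\<bar> \<le> B" using periodic_bounded[OF per f(3)] by metis
  have line: "((\<lambda>t. f (x + t *\<^sub>R axis i 1)) has_real_derivative partial_deriv i f (x + t *\<^sub>R axis i 1)) (at t)" for x t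
  proof -
    have "((\<lambda>t. f (x + t *\<^sub>R axis i 1)) has_derivative
        (\<lambda>h. frechet_derivative f (at (x + t *\<^sub>R axis i 1)) (h *\<^sub>R axis i 1))) (at t)"
    proof -
      have "((\<lambda>t. x + t *\<^sub>R axis i 1) has_derivative (\<lambda>h. h *\<^sub>R axis i 1)) (at t)"
        by (auto intro!: derivative_eq_intros)
      from has_derivative_compose[OF this D] show ?thesis by simp
    qed
    moreover have "frechet_derivative f (at y) (h *\<^sub>R axis i 1) = partial_deriv i f y * h" for y h
      unfolding partial_deriv_def
      using linear_scale[OF has_derivative_linear[OF D], of y h "axis i 1"] by simp
    ultimately show ?thesis by (simp add: has_field_derivative_def)
  qed
  define h where "h n = 1 / real (Suc n)" for n
  have h: "h n > 0" for n by (simp add: h_def)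
  have h0: "filterlim h (at 0) sequentially"
    unfolding h_def filterlim_at by (use LIMSEQ_Suc[OF lim_1_over_n] in auto)
  define g where "g n x = (f (x + h n *\<^sub>R axis i 1) - f x) / h n" for n x
  have glim: "(\<lambda>n. g n x) \<longlonglongrightarrow> partial_deriv i f x" for x
    using filterlim_compose[OF line[of x 0, unfolded DERIV_def] h0] by (simp add: g_def)
  have gb: "\<bar>g n x\<bar> \<le> B" for n x
  proof -
    obtain z where "f (x + h n *\<^sub>R axis i 1) - f (x + 0 *\<^sub>R axis i 1) = (h n - 0) * partial_deriv i f (x + z *\<^sub>R axis i 1)"
      using MVT2[OF h[of n], of "\<lambda>t. f (x + t *\<^sub>R axis i 1)" "\<lambda>t. partial_deriv i f (x + t *\<^sub>R axis i 1)"] line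
      by blast
    then have "g n x = partial_deriv i f (x + z *\<^sub>R axis i 1)" using h[of n] by (simp add: g_def)
    then show ?thesis using B by simp
  qed
  have cs: "continuous_on UNIV (\<lambda>x. f (x + v))" for v
    by (rule continuous_on_compose2[OF cf]) (auto intro!: continuous_intros)
  have cg: "continuous_on UNIV (g n)" for n
    unfolding g_def using h[of n] by (intro continuous_intros cs cf) auto
  have "(\<lambda>n. LINT x|lebesgue_on torus_cell. complex_of_real (g n x) * cnj (character k x)) \<longlonglongrightarrow>
      (LINT x|lebesgue_on torus_cell. complex_of_real (partial_deriv i f x) * cnj (character k x))"
  proof (rule integral_dominated_convergence[where w = "\<lambda>_. B"])
    show "integrable (lebesgue_on (torus_cell :: (real ^ 'd) set)) (\<lambda>_. B)" by (intro cont_integrable_cell continuous_intros)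
    show "AE x in lebesgue_on torus_cell. (\<lambda>n. complex_of_real (g n x) * cnj (character k x)) \<longlonglongrightarrow>
        complex_of_real (partial_deriv i f x) * cnj (character k x)"
      by (intro AE_I2 tendsto_intros glim)
    show "AE x in lebesgue_on torus_cell. norm (complex_of_real (g n x) * cnj (character k x)) \<le> B" for n
      using gb by (intro AE_I2) (simp add: norm_mult)
  qed (intro borel_measurable_integrable cont_integrable_cell continuous_intros f cg)+
  then have "(\<lambda>n. fourier_coeff (g n) k) \<longlonglongrightarrow> fourier_coeff (partial_deriv i f) k"
    unfolding fourier_coeff_def by (intro tendsto_intros) auto
  moreover have "fourier_coeff (g n) k = (character k (h n *\<^sub>R axis i 1) - 1) / h n * fourier_coeff f k" for n
  proof -
    \<comment> \<open>Any exponent above half the dimension serves, since the shift formula does not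
      mention it.\<close>
    interpret sobolev_exponent "CARD('d) + 1" "TYPE('d)" by unfold_locales simp
    have "fourier_coeff (\<lambda>x. f (x + h n *\<^sub>R axis i 1) - f x) k = (character k (h n *\<^sub>R axis i 1) - 1) * fourier_coeff f k"
      using fourier_coeff_diff[OF cs cf, of "h n *\<^sub>R axis i 1" k] fourier_coeff_shift[OF f(1) cf]
      by (simp add: left_diff_distrib)
    moreover have "fourier_coeff (g n) k = fourier_coeff (\<lambda>x. f (x + h n *\<^sub>R axis i 1) - f x) k / h n"
    proof -
      have "(LINT x|lebesgue_on torus_cell. complex_of_real (g n x) * cnj (character k x)) =
          (LINT x|lebesgue_on torus_cell. complex_of_real (f (x + h n *\<^sub>R axis i 1) - f x) * cnj (character k x) / h n)"
        by (simp add: g_def)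
      also have "\<dots> = (LINT x|lebesgue_on torus_cell. complex_of_real (f (x + h n *\<^sub>R axis i 1) - f x) * cnj (character k x)) / h n"
        by (rule integral_divide_zero)
      finally show ?thesis by (simp add: fourier_coeff_def)
    qed
    ultimately show ?thesis by simp
  qed
  moreover have lim: "(\<lambda>n. (character k (h n *\<^sub>R axis i 1) - 1) / h n) \<longlonglongrightarrow> \<i> * real_of_int (k $ i)"
  proof -
    have chr: "character k (t *\<^sub>R axis i 1) = exp (\<i> * (of_int (k $ i) * complex_of_real t))" for t
    proof -
      have "(\<Sum>j\<in>UNIV. real_of_int (k $ j) * (t *\<^sub>R axis i 1) $ j) = (\<Sum>j\<in>{i}. real_of_int (k $ j) * (t *\<^sub>R axis i 1) $ j)"
        by (rule sum.mono_neutral_right) (auto simp: axis_def)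
      then show ?thesis by (simp add: character_def axis_def cis_conv_exp)
    qed
    have "((\<lambda>z. exp (\<i> * (of_int (k $ i) * z))) has_field_derivative (\<i> * of_int (k $ i))) (at 0)"
      by (auto intro!: derivative_eq_intros)
    then have "(\<lambda>z. (exp (\<i> * (of_int (k $ i) * z)) - 1) / z) \<midarrow>0\<rightarrow> \<i> * of_int (k $ i)"
      by (simp add: DERIV_def)
    moreover have "filterlim (\<lambda>n. complex_of_real (h n)) (at 0) sequentially"
      using h0 h unfolding filterlim_at by (auto intro: tendsto_eq_intros simp: less_imp_neq[OF h, symmetric])
    ultimately have "(\<lambda>n. (exp (\<i> * (of_int (k $ i) * complex_of_real (h n))) - 1) / complex_of_real (h n)) \<longlonglongrightarrow> \<i> * of_int (k $ i)"
      by (rule filterlim_compose)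
    then show ?thesis by (simp add: chr)
  qed
  ultimately show "fourier_coeff (partial_deriv i f) k = \<i> * real_of_int (k $ i) * fourier_coeff f k"
    using LIMSEQ_unique[OF _ tendsto_mult_right[OF lim, of "fourier_coeff f k"]] by simp
qed

lemma class_C_continuous: "class_C n f \<Longrightarrow> continuous_on UNIV f"
  by (cases n) (auto simp: continuous_on_eq_continuous_at differentiable_imp_continuous_within)

text \<open>Each derivative in direction \<open>i\<close> multiplies the coefficient by
  \<open>\<i> * k $ i\<close>, and the coefficients of a bounded function are bounded.\<close>

lemma class_C_fourier_decay:
  fixes f :: "real ^ 'd::finite \<Rightarrow> real"
  assumes "periodic f" "class_C n f"
  shows "\<exists>M. \<forall>k. \<bar>real_of_int (k $ i)\<bar> ^ n * norm (fourier_coeff f k) \<le> M"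
  using assms
proof (induction n arbitrary: f)
  case 0
  then obtain B where "\<And>x. \<bar>f x\<bar> \<le> B" using periodic_bounded[of f] by auto
  then show ?case using norm_fourier_coeff_le[of f B] by auto
next
  case (Suc n)
  have c: "continuous_on UNIV (partial_deriv i f)" using Suc.prems class_C_continuous by auto
  note * = fourier_coeff_partial_deriv[OF Suc.prems(1) _ c]
  obtain M where "\<And>k. \<bar>real_of_int (k $ i)\<bar> ^ n * norm (fourier_coeff (partial_deriv i f) k) \<le> M"
    using Suc.IH[of "partial_deriv i f"] Suc.prems *(1) by auto
  then show ?case using *(2) Suc.prems by (intro exI[of _ M]) (auto simp: norm_mult mult_ac)
qed

text \<open>Stands in for smoothness in the recursion over saturation spaces: it is closed under
  \<open>BB\<close> because \<open>BB\<close> maps \<open>H^(m+2)\<close> into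
  \<open>H^m\<close>.\<close>

definition smooth_space :: "(real ^ 'd::finite \<Rightarrow> real) set" where
  "smooth_space = {f. \<forall>m. real m > real CARD('d) / 2 \<longrightarrow> f \<in> sobolev m}"

text \<open>For the largest component, \<open>freq_sq k \<le> d * (k $ i)\<^sup>2\<close>, so decay
  of order \<open>2 * m\<close> in every direction bounds \<open>(1 + freq_sq k) ^ m\<close> times
  the coefficient. Squaring this leaves the summable factor
  \<open>1 / (1 + freq_sq k) ^ m\<close>.\<close>

lemma smooth_in_smooth_space:
  fixes f :: "real ^ 'd::finite \<Rightarrow> real"
  assumes "periodic f" "smooth f"
  shows "f \<in> smooth_space"
  unfolding smooth_space_def
proof (intro CollectI allI impI)
  fix m :: nat assume m: "real m > real CARD('d) / 2"
  have C: "class_C n f" for n using assms(2) by (simp add: smooth_def)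
  have "\<forall>i. \<exists>M. \<forall>k. \<bar>real_of_int (k $ i)\<bar> ^ (2 * m) * norm (fourier_coeff f k) \<le> M"
    using class_C_fourier_decay[OF assms(1) C] by blast
  from choice[OF this] obtain M
    where M: "\<And>i k. \<bar>real_of_int (k $ i)\<bar> ^ (2 * m) * norm (fourier_coeff f k) \<le> M i"
    by blast
  obtain M0 where M0: "\<And>k. norm (fourier_coeff f k) \<le> M0"
    using class_C_fourier_decay[OF assms(1) C[of 0]] by auto
  define B where "B = (2 * real CARD('d)) ^ m * (M0 + (\<Sum>i\<in>UNIV. \<bar>M i\<bar>))"
  have decay: "(1 + freq_sq k) ^ m * norm (fourier_coeff f k) \<le> B" for k
  proof -
    obtain i where i: "\<And>j. (real_of_int (k $ j))\<^sup>2 \<le> (real_of_int (k $ i))\<^sup>2"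
    proof -
      let ?S = "range (\<lambda>j. (real_of_int (k $ j))\<^sup>2)"
      have "Max ?S \<in> ?S" by (intro Max_in) auto
      then obtain i where "Max ?S = (real_of_int (k $ i))\<^sup>2" unfolding image_iff by blast
      moreover have "(real_of_int (k $ j))\<^sup>2 \<le> Max ?S" for j by (intro Max_ge) auto
      ultimately show thesis using that by metis
    qed
    define x where "x = (real_of_int (k $ i))\<^sup>2"
    have x: "x \<ge> 0" by (simp add: x_def)
    have d: "real CARD('d) \<ge> 1" by (simp add: Suc_le_eq)
    have "freq_sq k \<le> (\<Sum>j\<in>(UNIV :: 'd set). x)" unfolding freq_sq_def x_def by (intro sum_mono i)
    also have "\<dots> = real CARD('d) * x" by simp
    finally have "1 + freq_sq k \<le> real CARD('d) + real CARD('d) * x" using d by linarith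
    also have "\<dots> \<le> 2 * real CARD('d) * max 1 x"
    proof -
      have "real CARD('d) * 1 \<le> real CARD('d) * max 1 x" "real CARD('d) * x \<le> real CARD('d) * max 1 x"
        by (intro mult_left_mono; simp)+
      then have "real CARD('d) + real CARD('d) * x \<le> 2 * (real CARD('d) * max 1 x)" by linarith
      then show ?thesis by (simp only: mult.assoc)
    qed
    finally have "(1 + freq_sq k) ^ m \<le> (2 * real CARD('d) * max 1 x) ^ m"
      using freq_sq_nonneg[of k] by (intro power_mono) auto
    also have "\<dots> \<le> (2 * real CARD('d)) ^ m * (1 + x ^ m)"
      using x unfolding power_mult_distrib[of _ "max 1 x"] by (intro mult_left_mono) (auto simp: max_def)
    finally have "(1 + freq_sq k) ^ m * norm (fourier_coeff f k) \<le> (2 * real CARD('d)) ^ m * (1 + x ^ m) * norm (fourier_coeff f k)"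
      by (intro mult_right_mono) auto
    also have "\<dots> = (2 * real CARD('d)) ^ m * (norm (fourier_coeff f k) + \<bar>real_of_int (k $ i)\<bar> ^ (2 * m) * norm (fourier_coeff f k))"
    proof -
      have "x ^ m = \<bar>real_of_int (k $ i)\<bar> ^ (2 * m)" unfolding x_def power_mult power2_abs ..
      then show ?thesis by (simp add: algebra_simps)
    qed
    also have "\<dots> \<le> (2 * real CARD('d)) ^ m * (M0 + (\<Sum>i\<in>UNIV. \<bar>M i\<bar>))"
    proof (intro mult_left_mono add_mono M0)
      have "M i \<le> \<bar>M i\<bar>" by simp
      also have "\<dots> \<le> (\<Sum>i\<in>UNIV. \<bar>M i\<bar>)" by (rule member_le_sum) auto
      finally show "\<bar>real_of_int (k $ i)\<bar> ^ (2 * m) * norm (fourier_coeff f k) \<le> (\<Sum>i\<in>UNIV. \<bar>M i\<bar>)"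
        using M[of k i] by linarith
    qed simp
    finally show ?thesis by (simp add: B_def)
  qed
  have "(\<lambda>k. (1 + freq_sq k) ^ m * (norm (fourier_coeff f k))\<^sup>2) summable_on UNIV"
  proof (rule summable_on_comparison_test)
    show "(\<lambda>k :: int ^ 'd. B\<^sup>2 * (1 / (1 + freq_sq k) ^ m)) summable_on UNIV"
      by (intro summable_on_cmult_right summable_on_lattice m)
    fix k :: "int ^ 'd"
    have pos: "(1 + freq_sq k) ^ m > 0" by (intro zero_less_power one_plus_freq_sq_pos)
    have "((1 + freq_sq k) ^ m * norm (fourier_coeff f k))\<^sup>2 \<le> B\<^sup>2"
      using decay[of k] pos by (intro power_mono) auto
    then show "(1 + freq_sq k) ^ m * (norm (fourier_coeff f k))\<^sup>2 \<le> B\<^sup>2 * (1 / (1 + freq_sq k) ^ m)"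
      using pos by (simp add: power_mult_distrib field_simps power2_eq_square)
    show "0 \<le> (1 + freq_sq k) ^ m * (norm (fourier_coeff f k))\<^sup>2" using pos by simp
  qed
  then show "f \<in> sobolev m"
    using assms(1) class_C_continuous[OF C] by (simp add: sobolev_def)
qed

lemma subspace_smooth_space: "subspace (smooth_space :: (real ^ 'd::finite \<Rightarrow> real) set)"
proof -
  have *: "(0 :: real ^ 'd \<Rightarrow> real) \<in> sobolev m"
    "f \<in> sobolev m \<Longrightarrow> g \<in> sobolev m \<Longrightarrow> f + g \<in> sobolev m"
    "f \<in> sobolev m \<Longrightarrow> c *\<^sub>R f \<in> sobolev m"
    if "real m > real CARD('d) / 2" for f g :: "real ^ 'd \<Rightarrow> real" and c m
  proof -
    interpret sobolev_exponent m "TYPE('d)" using that by unfold_locales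
    show "(0 :: real ^ 'd \<Rightarrow> real) \<in> sobolev m"
      "f \<in> sobolev m \<Longrightarrow> g \<in> sobolev m \<Longrightarrow> f + g \<in> sobolev m"
      "f \<in> sobolev m \<Longrightarrow> c *\<^sub>R f \<in> sobolev m"
      by (rule zero_in_sobolev add_in_sobolev scaleR_in_sobolev; assumption)+
  qed
  then show ?thesis by (auto simp: subspace_def smooth_space_def)
qed

lemma BB_smooth_space:
  fixes f :: "real ^ 'd::finite \<Rightarrow> real"
  assumes "f \<in> smooth_space"
  shows "BB f \<in> smooth_space"
  unfolding smooth_space_def
proof (intro CollectI allI impI)
  fix m :: nat assume m: "real m > real CARD('d) / 2"
  then interpret sobolev_exponent m "TYPE('d)" by unfold_locales
  show "BB f \<in> sobolev m"
    using assms m by (intro BB_in_sobolev) (auto simp: smooth_space_def)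
qed

lemma saturation_smooth_space:
  fixes Q :: "nat \<Rightarrow> real ^ 'd::finite \<Rightarrow> real"
  assumes "\<forall>j\<in>{1..q}. periodic (Q j) \<and> smooth (Q j)"
  shows "saturation Q q j \<subseteq> smooth_space"
proof (induction j)
  case 0
  show ?case
  proof -
    have "span (Q ` {1..q}) \<subseteq> smooth_space"
      by (rule span_minimal[OF _ subspace_smooth_space]) (use assms smooth_in_smooth_space in blast)
    then show ?thesis by simp
  qed
next
  case (Suc j)
  have "saturation Q q (Suc j) \<subseteq> BB_sums (saturation Q q j)"
    using largest_subspace(2)[OF subspace_saturation] by simp
  also have "\<dots> \<subseteq> smooth_space"
  proof
    fix f assume "f \<in> BB_sums (saturation Q q j)"
    then obtain f0 \<phi> and n :: nat where "f = f0 + (\<Sum>k\<in>{1..n}. BB (\<phi> k))" "f0 \<in> saturation Q q j"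
      "\<forall>k\<in>{1..n}. \<phi> k \<in> saturation Q q j"
      unfolding BB_sums_def by blast
    then show "f \<in> smooth_space"
      using Suc by (auto intro!: subspace_add subspace_sum subspace_smooth_space BB_smooth_space)
  qed
  finally show ?case .
qed

context sobolev_exponent
begin

subsection \<open>Logarithms of positive functions\<close>

text \<open>Parseval's identity, read off from the zeroth coefficient of the square.\<close>

lemma sum_fc_sq: "((\<lambda>k. complex_of_real ((norm (fc x k))\<^sup>2)) has_sum fc (mult x x) 0) UNIV"
proof -
  have eq: "fc x k * fc x (0 - k) = complex_of_real ((norm (fc x k))\<^sup>2)" for k
    using complex_norm_square[of "fc x k"] by (simp add: fc_uminus)
  have "(\<lambda>k. fc x k * fc x (0 - k)) summable_on UNIV"
    by (rule Infinite_Sum.abs_summable_summable) (rule has_sum_convolution(2)[OF fc_abs_summable fc_abs_summable])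
  then have "((\<lambda>k. fc x k * fc x (0 - k)) has_sum fc (mult x x) 0) UNIV"
    unfolding fc_mult by simp
  then show ?thesis unfolding eq .
qed

lemma sum_fc_sq_le:
  assumes "\<And>y. \<bar>ev x y\<bar> \<le> B" "finite F"
  shows "(\<Sum>k\<in>F. (norm (fc x k))\<^sup>2) \<le> B\<^sup>2"
proof -
  have hs: "((\<lambda>k. (norm (fc x k))\<^sup>2) has_sum Re (fc (mult x x) 0)) UNIV"
    using has_sum_Re[OF sum_fc_sq[of x]] by simp
  have "(\<Sum>k\<in>F. (norm (fc x k))\<^sup>2) \<le> Re (fc (mult x x) 0)"
    by (rule finite_sum_le_has_sum[OF hs assms(2)]) auto
  also have "\<dots> \<le> norm (fourier_coeff (ev (mult x x)) 0)"
    unfolding fourier_coeff_ev by (rule complex_Re_le_cmod)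
  also have "\<dots> \<le> B\<^sup>2"
  proof (rule norm_fourier_coeff_le)
    show "\<bar>ev (mult x x) y\<bar> \<le> B\<^sup>2" for y
      using power_mono[OF assms(1)[of y], of 2] by (simp add: ev_mult power2_eq_square)
  qed
  finally show ?thesis .
qed

definition band :: "nat \<Rightarrow> 'd hseq \<Rightarrow> bool" where
  "band N x \<longleftrightarrow> (\<forall>k. fc x k \<noteq> 0 \<longrightarrow> (\<forall>i. \<bar>k $ i\<bar> \<le> int N))"

lemma band_powX:
  assumes "band N x"
  shows "band (n * N) (powX x n)"
proof (induction n)
  case 0
  then show ?case by (auto simp: band_def const_def fc_single split: if_splits)
next
  case (Suc n)
  show ?case
    unfolding band_def
  proof (intro allI impI)
    fix m i assume "fc (powX x (Suc n)) m \<noteq> 0"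
    then obtain k where "fc x k * fc (powX x n) (m - k) \<noteq> 0"
      by (fastforce simp: fc_mult intro: infsum_0)
    then have "\<bar>k $ i\<bar> \<le> int N" "\<bar>(m - k) $ i\<bar> \<le> int (n * N)"
      using assms Suc unfolding band_def by auto
    then show "\<bar>m $ i\<bar> \<le> int (Suc n * N)" by simp
  qed
qed

text \<open>Up to frequency \<open>N\<close> the Sobolev weight is at most a polynomial in
  \<open>N\<close>, and Parseval bounds the unweighted sum by the sup norm.\<close>

lemma norm_band_le:
  assumes "band N x" "\<And>y. \<bar>ev x y\<bar> \<le> B"
  shows "norm x \<le> sqrt ((2 * pi) ^ CARD('d) * (1 + CARD('d) * (real N)\<^sup>2) ^ s) * B"
proof (rule norm_hseq_leI)
  have B: "B \<ge> 0" using order_trans[OF abs_ge_zero assms(2)] .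
  let ?A = "(2 * pi) ^ CARD('d) * (1 + CARD('d) * (real N)\<^sup>2) ^ s"
  have A: "?A \<ge> 0" by (simp add: add_nonneg_nonneg)
  show "0 \<le> sqrt ?A * B" using A B by simp
  fix F :: "(int ^ 'd) set" assume F: "finite F"
  have "(\<Sum>k\<in>F. (norm (coef x k))\<^sup>2) \<le> (\<Sum>k\<in>F. ?A * (norm (fc x k))\<^sup>2)"
  proof (rule sum_mono)
    fix k
    show "(norm (coef x k))\<^sup>2 \<le> ?A * (norm (fc x k))\<^sup>2"
    proof (cases "fc x k = 0")
      case False
      have "freq_sq k \<le> (\<Sum>i\<in>(UNIV :: 'd set). (real N)\<^sup>2)"
        unfolding freq_sq_def
      proof (rule sum_mono)
        fix i
        have "\<bar>real_of_int (k $ i)\<bar> \<le> real N" using assms(1) False unfolding band_def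
          by (metis of_int_abs of_int_le_iff of_int_of_nat_eq)
        then show "(real_of_int (k $ i))\<^sup>2 \<le> (real N)\<^sup>2" by (rule power2_le_iff_abs_le[THEN iffD2, rotated]) simp
      qed
      then have "(1 + freq_sq k) ^ s \<le> (1 + CARD('d) * (real N)\<^sup>2) ^ s"
        by (intro power_mono) (auto simp: freq_sq_nonneg add_nonneg_nonneg)
      then have "(2 * pi) ^ CARD('d) * (1 + freq_sq k) ^ s \<le> ?A" by (intro mult_left_mono) auto
      then have "(2 * pi) ^ CARD('d) * (1 + freq_sq k) ^ s * (norm (fc x k))\<^sup>2 \<le> ?A * (norm (fc x k))\<^sup>2"
        by (intro mult_right_mono) auto
      then show ?thesis unfolding norm_coef_sq by (simp only: mult.assoc)
    qed (simp add: coef_fc)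
  qed
  also have "\<dots> \<le> ?A * B\<^sup>2"
    unfolding sum_distrib_left[symmetric] by (intro mult_left_mono sum_fc_sq_le assms F A)
  finally show "(\<Sum>k\<in>F. (norm (coef x k))\<^sup>2) \<le> (sqrt ?A * B)\<^sup>2"
    using A by (simp add: power_mult_distrib)
qed

lemma band_dense:
  assumes "e > 0"
  obtains P N where "band N P" "norm (f - P) < e"
proof -
  define t where "t N k = (if \<forall>i. \<bar>k $ i\<bar> \<le> int N then 1 else 0 :: complex)" for N and k :: "int ^ 'd"
  have m: "multiplier 1 (t N)" for N by (auto simp: multiplier_def t_def)
  have m1: "multiplier 1 (\<lambda>_ :: int ^ 'd. 1)" by (simp add: multiplier_def)
  have "(\<lambda>N. fmul (t N) f) \<longlonglongrightarrow> fmul (\<lambda>_. 1) f"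
  proof (rule fmul_tendsto[OF m m1])
    fix k :: "int ^ 'd"
    define K where "K = Max (range (\<lambda>i. nat \<bar>k $ i\<bar>))"
    have "nat \<bar>k $ i\<bar> \<le> K" for i unfolding K_def by (intro Max_ge) auto
    then have "\<bar>k $ i\<bar> \<le> int N" if "N \<ge> K" for i N
      using that by (meson le_trans nat_le_iff)
    then have "t N k = 1" if "N \<ge> K" for N using that by (simp add: t_def)
    then show "(\<lambda>N. t N k) \<longlonglongrightarrow> 1"
      by (intro tendsto_eventually) (auto simp: eventually_sequentially)
  qed
  moreover have "fmul (\<lambda>_. 1) f = f" by (rule coef_eqI) (simp add: coef_fmul[OF m1])
  ultimately have "(\<lambda>N. fmul (t N) f) \<longlonglongrightarrow> f" by simp
  then obtain N where "dist (fmul (t N) f) f < e"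
    using eventually_happens'[OF sequentially_bot tendstoD[OF _ assms]] by blast
  moreover have "band N (fmul (t N) f)" by (simp add: band_def fc_fmul[OF m] t_def)
  ultimately show thesis using that by (simp add: dist_norm norm_minus_commute)
qed

lemma summable_poly_geometric:
  fixes \<theta> :: real
  assumes "0 \<le> \<theta>" "\<theta> < 1"
  shows "summable (\<lambda>n. (1 + real n) ^ m * \<theta> ^ n)"
proof -
  define c where "c = (1 + \<theta>) / 2"
  have c: "\<theta> < c" "c < 1" using assms by (auto simp: c_def)
  have "(\<lambda>n. (1 + 1 / real (Suc n)) ^ m * \<theta>) \<longlonglongrightarrow> (1 + 0) ^ m * \<theta>"
    by (intro tendsto_intros LIMSEQ_Suc[OF lim_1_over_n])
  then have "\<forall>\<^sub>F n in sequentially. (1 + 1 / real (Suc n)) ^ m * \<theta> < c"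
    using c by (intro order_tendstoD(2)) auto
  then obtain N where N: "\<And>n. n \<ge> N \<Longrightarrow> (1 + 1 / real (Suc n)) ^ m * \<theta> < c"
    unfolding eventually_sequentially by blast
  show ?thesis
  proof (rule summable_ratio_test[OF c(2)])
    fix n assume "N \<le> n"
    have "1 + real (Suc n) = (1 + 1 / real (Suc n)) * (1 + real n)" by (simp add: field_simps)
    then have "(1 + real (Suc n)) ^ m * \<theta> ^ Suc n = ((1 + 1 / real (Suc n)) ^ m * \<theta>) * ((1 + real n) ^ m * \<theta> ^ n)"
      by (simp only: power_mult_distrib power_Suc mult_ac)
    also have "\<dots> \<le> c * ((1 + real n) ^ m * \<theta> ^ n)"
      using N[OF \<open>N \<le> n\<close>] assms(1) by (intro mult_right_mono) auto
    finally show "norm ((1 + real (Suc n)) ^ m * \<theta> ^ Suc n) \<le> c * norm ((1 + real n) ^ m * \<theta> ^ n)"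
      using assms(1) by simp
  qed
qed

lemma norm_mult_powX_le: "norm (mult (powX r j) y) \<le> (mult_const * norm r) ^ j * norm y"
proof (induction j)
  case 0
  have "mult (const 1) y = y" by (rule ev_eqI) (simp add: ev_mult)
  then show ?case by simp
next
  case (Suc j)
  have "mult (powX r (Suc j)) y = mult r (mult (powX r j) y)" by (rule ev_eqI) (simp add: ev_mult)
  then have "norm (mult (powX r (Suc j)) y) \<le> mult_const * norm r * norm (mult (powX r j) y)"
    by (simp only: norm_mult_le)
  also have "\<dots> \<le> mult_const * norm r * ((mult_const * norm r) ^ j * norm y)"
    by (intro mult_left_mono Suc) (simp add: mult_const_nonneg)
  finally show ?case by (simp add: mult_ac)
qed

text \<open>Spectral radius: powers of a trigonometric polynomial \<open>P\<close> stay trigonometric polynomials whose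
  bandwidth grows linearly, so their Sobolev norm exceeds the sup norm only by a polynomial factor.\<close>

lemma summable_powX:
  assumes "\<And>x. \<bar>ev f x\<bar> \<le> \<rho>" "\<rho> < 1"
  shows "summable (\<lambda>n. norm (powX f n))"
proof -
  have \<rho>: "\<rho> \<ge> 0" using order_trans[OF abs_ge_zero assms(1)] .
  \<comment> \<open>The remainder \<open>r = f - P\<close> costs \<open>mult_const * e\<close> in
    the algebra norm and shifts the sup norm of \<open>P\<close> by \<open>emb_const * e\<close>;
    this \<open>e\<close> keeps the total rate \<open>\<theta>\<close> below 1.\<close>
  define e where "e = (1 - \<rho>) / (2 * (emb_const + mult_const + 1))"
  have pos: "emb_const + mult_const + 1 > 0" using emb_const_nonneg mult_const_nonneg by linarith
  have e: "e > 0" unfolding e_def using assms(2) pos by (intro divide_pos_pos) auto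
  obtain P N where P: "band N P" "norm (f - P) < e" using band_dense[OF e] by blast
  define r where "r = f - P"
  define \<sigma> where "\<sigma> = \<rho> + emb_const * e"
  define \<theta> where "\<theta> = mult_const * e + \<sigma>"
  have \<sigma>: "\<sigma> \<ge> 0" using \<rho> e emb_const_nonneg by (simp add: \<sigma>_def)
  have \<theta>: "0 \<le> \<theta>" "\<theta> < 1"
  proof -
    show "0 \<le> \<theta>" using \<sigma> e mult_const_nonneg by (simp add: \<theta>_def)
    have "(emb_const + mult_const + 1) * e = (1 - \<rho>) / 2"
      using nonzero_mult_divide_mult_cancel_left[OF less_imp_neq[OF pos, symmetric], of "1 - \<rho>" 2]
      by (simp only: e_def mult.commute[of 2] times_divide_eq_right)
    then show "\<theta> < 1" using e assms(2) by (simp add: \<theta>_def \<sigma>_def algebra_simps)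
  qed
  have evP: "\<bar>ev P x\<bar> \<le> \<sigma>" for x
  proof -
    have "\<bar>ev r x\<bar> \<le> emb_const * e"
      using ev_bound[of r x] mult_left_mono[OF less_imp_le[OF P(2)] emb_const_nonneg] by (simp add: r_def)
    then show ?thesis using assms(1)[of x] by (simp add: r_def \<sigma>_def ev_diff)
  qed
  define A where "A = sqrt ((2 * pi) ^ CARD('d) * (1 + CARD('d) * (real N)\<^sup>2) ^ s)"
  have A: "A \<ge> 0" by (simp add: A_def add_nonneg_nonneg)
  have nP: "norm (powX P n) \<le> A * (1 + real n) ^ s * \<sigma> ^ n" for n
  proof -
    have "norm (powX P n) \<le> sqrt ((2 * pi) ^ CARD('d) * (1 + CARD('d) * (real (n * N))\<^sup>2) ^ s) * \<sigma> ^ n"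
      using evP by (intro norm_band_le band_powX P) (simp add: ev_powX power_abs power_mono)
    also have "\<dots> \<le> (A * (1 + real n) ^ s) * \<sigma> ^ n"
    proof (intro mult_right_mono real_le_lsqrt)
      have "1 + CARD('d) * (real (n * N))\<^sup>2 \<le> (1 + CARD('d) * (real N)\<^sup>2) * (1 + real n)\<^sup>2"
        by (simp add: power2_eq_square algebra_simps)
      then have "(1 + CARD('d) * (real (n * N))\<^sup>2) ^ s \<le> ((1 + CARD('d) * (real N)\<^sup>2) * (1 + real n)\<^sup>2) ^ s"
        by (intro power_mono) (auto simp: add_nonneg_nonneg)
      then have "(2 * pi) ^ CARD('d) * (1 + CARD('d) * (real (n * N))\<^sup>2) ^ s \<le>
          (2 * pi) ^ CARD('d) * ((1 + CARD('d) * (real N)\<^sup>2) * (1 + real n)\<^sup>2) ^ s"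
        by (intro mult_left_mono) auto
      also have "\<dots> = (A * (1 + real n) ^ s)\<^sup>2"
        unfolding power_mult_distrib A_def
        by (simp add: add_nonneg_nonneg power_mult[symmetric] mult.commute power_mult_distrib)
      finally show "(2 * pi) ^ CARD('d) * (1 + CARD('d) * (real (n * N))\<^sup>2) ^ s \<le> (A * (1 + real n) ^ s)\<^sup>2" .
    qed (use \<sigma> A in auto)
    finally show ?thesis .
  qed
  have bound: "norm (powX f n) \<le> A * ((1 + real n) ^ s * \<theta> ^ n)" for n
  proof -
    \<comment> \<open>In the binomial expansion of \<open>f = r + P\<close>, powers of
      \<open>r\<close> are bounded in the algebra norm and powers of \<open>P\<close> through their
      band. The bounds again form a binomial sum, equal to \<open>\<theta> ^ n\<close>.\<close>
    have "powX f n = (\<Sum>j\<le>n. real (n choose j) *\<^sub>R mult (powX r j) (powX P (n - j)))"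
    proof (rule ev_eqI)
      fix x
      have "ev f x = ev r x + ev P x" by (simp add: r_def ev_diff)
      then show "ev (powX f n) x = ev (\<Sum>j\<le>n. real (n choose j) *\<^sub>R mult (powX r j) (powX P (n - j))) x"
        by (simp add: ev_powX ev_sum ev_scaleR ev_mult binomial_ring mult.assoc)
    qed
    then have "norm (powX f n) \<le> (\<Sum>j\<le>n. real (n choose j) * ((mult_const * e) ^ j * (A * (1 + real n) ^ s * \<sigma> ^ (n - j))))"
    proof (simp only:, intro sum_norm_le)
      fix j assume "j \<in> {..n}"
      have "norm (mult (powX r j) (powX P (n - j))) \<le> (mult_const * norm r) ^ j * norm (powX P (n - j))"
        by (rule norm_mult_powX_le)
      also have "\<dots> \<le> (mult_const * e) ^ j * (A * (1 + real n) ^ s * \<sigma> ^ (n - j))"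
      proof (intro mult_mono power_mono mult_left_mono)
        show "norm r \<le> e" using P(2) by (simp add: r_def)
        have "norm (powX P (n - j)) \<le> A * (1 + real (n - j)) ^ s * \<sigma> ^ (n - j)" by (rule nP)
        also have "\<dots> \<le> A * (1 + real n) ^ s * \<sigma> ^ (n - j)"
          using A \<sigma> by (intro mult_right_mono mult_left_mono power_mono) auto
        finally show "norm (powX P (n - j)) \<le> A * (1 + real n) ^ s * \<sigma> ^ (n - j)" .
      qed (use e mult_const_nonneg in auto)
      finally show "norm (real (n choose j) *\<^sub>R mult (powX r j) (powX P (n - j))) \<le>
          real (n choose j) * ((mult_const * e) ^ j * (A * (1 + real n) ^ s * \<sigma> ^ (n - j)))"
        by (simp add: mult_left_mono)
    qed
    also have "\<dots> = A * ((1 + real n) ^ s * \<theta> ^ n)"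
      unfolding \<theta>_def binomial_ring by (simp add: sum_distrib_left mult_ac)
    finally show ?thesis .
  qed
  show ?thesis
  proof (rule summable_comparison_test)
    show "\<exists>N. \<forall>n\<ge>N. norm (norm (powX f n)) \<le> A * ((1 + real n) ^ s * \<theta> ^ n)" using bound by auto
    show "summable (\<lambda>n. A * ((1 + real n) ^ s * \<theta> ^ n))"
      by (intro summable_mult summable_poly_geometric \<theta>)
  qed
qed

text \<open>The logarithm series in \<open>g = 1 - f / M\<close>. As \<open>f\<close> is bounded
  away from 0, the sup norm of \<open>g\<close> is below 1, and \<open>summable_powX\<close> turns
  this into convergence in \<open>H^s\<close>.\<close>

lemma ex_log:
  assumes pos: "\<And>x. ev f x > 0"
  obtains l where "\<And>x. ev l x = ln (ev f x)"
proof -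
  have c: "continuous_on UNIV (\<lambda>x. 1 / ev f x)"
    using pos by (intro continuous_on_divide continuous_on_const continuous_on_ev) (simp add: less_imp_neq[symmetric])
  have "periodic (\<lambda>x. 1 / ev f x)" using periodic_ev[of f] by (simp add: periodic_def)
  then obtain B where B: "B > 0" "\<And>x. \<bar>1 / ev f x\<bar> \<le> B" using periodic_bounded[OF _ c] by blast
  obtain M where M: "M > 0" "\<And>x. \<bar>ev f x\<bar> \<le> M" using periodic_bounded[OF periodic_ev continuous_on_ev] by blast
  define g where "g = const 1 - (1 / M) *\<^sub>R f"
  have evg: "ev g x = 1 - ev f x / M" for x by (simp add: g_def ev_diff ev_scaleR)
  have g: "\<bar>ev g x\<bar> \<le> 1 - 1 / (B * M)" for x
  proof -
    have "1 / B \<le> ev f x" using B(1) B(2)[of x] pos[of x] by (simp add: field_simps)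
    then have "1 / (B * M) \<le> ev f x / M" using M(1) B(1) by (simp add: field_simps)
    moreover have "ev f x / M \<le> 1" using M(1) M(2)[of x] by (simp add: field_simps)
    ultimately show ?thesis by (simp add: evg)
  qed
  have lt1: "1 - 1 / (B * M) < 1" using B(1) M(1) by simp
  \<comment> \<open>The term \<open>n = 0\<close> vanishes because \<open>1 / 0 = 0\<close>, so the
    series starts at 1 as it should.\<close>
  have "summable (\<lambda>n. norm ((1 / real n) *\<^sub>R powX g n))"
  proof (rule summable_comparison_test[OF _ summable_powX[OF g lt1]])
    have "norm (norm ((1 / real n) *\<^sub>R powX g n)) \<le> norm (powX g n)" for n
      by (cases n) (simp_all add: field_simps mult_le_cancel_right1 del: powX.simps)
    then show "\<exists>N. \<forall>n\<ge>N. norm (norm ((1 / real n) *\<^sub>R powX g n)) \<le> norm (powX g n)" by blast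
  qed
  then have sm: "summable (\<lambda>n. (1 / real n) *\<^sub>R powX g n)" by (rule summable_norm_cancel)
  have "ev (const (ln M) - (\<Sum>n. (1 / real n) *\<^sub>R powX g n)) x = ln (ev f x)" for x
  proof -
    have "(\<lambda>n. ev ((1 / real n) *\<^sub>R powX g n) x) sums ev (\<Sum>n. (1 / real n) *\<^sub>R powX g n) x"
      by (intro bounded_linear.sums[OF bounded_linear_ev] summable_sums sm)
    then have "(\<lambda>n. ev g x ^ n / real n) sums ev (\<Sum>n. (1 / real n) *\<^sub>R powX g n) x"
      by (simp add: ev_scaleR ev_powX)
    moreover have "(\<lambda>n. - (ev g x ^ n / real n)) sums ln (1 - ev g x)"
      using ln_series'[of "- ev g x"] g[of x] lt1 by (simp add: divide_inverse)
    then have "(\<lambda>n. ev g x ^ n / real n) sums (- ln (1 - ev g x))" using sums_minus by fastforce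
    ultimately have "ev (\<Sum>n. (1 / real n) *\<^sub>R powX g n) x = - ln (1 - ev g x)" by (rule sums_unique2)
    then show ?thesis using pos[of x] M(1) by (simp add: ev_diff evg ln_div)
  qed
  then show thesis using that by blast
qed

end

subsection \<open>Steering within a class of signs\<close>

lemma abs_exp_minus_1_less:
  fixes t e :: real
  assumes "\<bar>t\<bar> < ln (1 + e)" "e > 0"
  shows "\<bar>exp t - 1\<bar> < e"
proof -
  have "exp t < 1 + e" "exp (- t) < 1 + e"
    using assms exp_less_mono[of t "ln (1 + e)"] exp_less_mono[of "- t" "ln (1 + e)"] by auto
  moreover have "1 - e \<le> 1 / (1 + e)" using assms(2) by (simp add: field_simps)
  ultimately have "1 - e < exp t"
    using assms(2) by (smt (verit, best) exp_gt_zero exp_minus inverse_eq_divide frac_less2 inverse_inverse_eq)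
  then show ?thesis using \<open>exp t < 1 + e\<close> by auto
qed

lemma continuous_on_ratio:
  fixes f g :: "'a::topological_space \<Rightarrow> real"
  assumes "continuous_on S f" "continuous_on S g" "c > 0"
  shows "continuous_on S (\<lambda>x. (\<bar>g x\<bar> + c) / (\<bar>f x\<bar> + c))"
proof -
  have "\<bar>f x\<bar> + c \<noteq> 0" for x using assms(3) abs_ge_zero[of "f x"] by linarith
  then show ?thesis by (intro continuous_intros assms) simp
qed

lemma abs_mult_ratio_le:
  fixes u v c :: real
  assumes "\<bar>v\<bar> \<le> M" "0 < c" "c \<le> 1"
  shows "\<bar>u * ((\<bar>v\<bar> + c) / (\<bar>u\<bar> + c))\<bar> \<le> M + 1"
proof -
  have p: "\<bar>u\<bar> + c > 0" using assms(2) by linarith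
  have "\<bar>u\<bar> / (\<bar>u\<bar> + c) \<le> 1" using p assms(2) by (subst divide_le_eq_1_pos) auto
  then have "\<bar>u\<bar> / (\<bar>u\<bar> + c) * (\<bar>v\<bar> + c) \<le> 1 * (M + 1)"
    using assms by (intro mult_mono) auto
  moreover have "\<bar>u * ((\<bar>v\<bar> + c) / (\<bar>u\<bar> + c))\<bar> = \<bar>u\<bar> / (\<bar>u\<bar> + c) * (\<bar>v\<bar> + c)"
    using p assms(2) by (simp add: abs_mult)
  ultimately show ?thesis by (simp only: mult_1)
qed

text \<open>Where \<open>f\<close> vanishes so does \<open>g\<close>; elsewhere the limit
  \<open>f * \<bar>g\<bar> / \<bar>f\<bar>\<close> is \<open>g\<close> because the signs agree. The
  differences are bounded by \<open>2 * M + 1\<close>, so dominated convergence applies.\<close>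

lemma tendsto_L2_same_sign:
  fixes f g :: "real ^ 'd::finite \<Rightarrow> real"
  assumes f: "continuous_on UNIV f" and g: "continuous_on UNIV g"
    and M: "\<And>x. \<bar>g x\<bar> \<le> M" and sgn: "\<And>x. sgn (f x) = sgn (g x)"
  shows "(\<lambda>n. LINT x|lebesgue_on torus_cell.
    (f x * ((\<bar>g x\<bar> + 1 / real (Suc n)) / (\<bar>f x\<bar> + 1 / real (Suc n))) - g x)\<^sup>2) \<longlonglongrightarrow> 0"
proof -
  let ?h = "\<lambda>n x. f x * ((\<bar>g x\<bar> + 1 / real (Suc n)) / (\<bar>f x\<bar> + 1 / real (Suc n))) - g x"
  have c: "continuous_on UNIV (\<lambda>x. (?h n x)\<^sup>2)" for n
    by (intro continuous_on_power continuous_on_diff continuous_on_mult continuous_on_ratio f g) simp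
  have lim: "(\<lambda>n. (?h n x)\<^sup>2) \<longlonglongrightarrow> 0" for x
  proof (cases "f x = 0")
    case True
    then have "g x = 0" using sgn[of x] by (metis sgn_zero_iff)
    then show ?thesis using True by simp
  next
    case False
    have z: "(\<lambda>n. 1 / real (Suc n)) \<longlonglongrightarrow> 0" by (rule LIMSEQ_Suc[OF lim_1_over_n])
    have "(\<lambda>n. (?h n x)\<^sup>2) \<longlonglongrightarrow> (f x * ((\<bar>g x\<bar> + 0) / (\<bar>f x\<bar> + 0)) - g x)\<^sup>2"
      by (intro tendsto_power tendsto_diff tendsto_mult tendsto_divide tendsto_add tendsto_const z)
         (simp add: False)
    also have "f x * ((\<bar>g x\<bar> + 0) / (\<bar>f x\<bar> + 0)) = sgn (f x) * \<bar>g x\<bar>" by (simp add: sgn_if)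
    also have "\<dots> = g x" unfolding sgn by (simp add: sgn_mult_abs)
    finally show ?thesis by simp
  qed
  have bound: "norm ((?h n x)\<^sup>2) \<le> (2 * M + 1)\<^sup>2" for n x
  proof -
    have "\<bar>?h n x\<bar> \<le> (M + 1) + M"
      using abs_mult_ratio_le[OF M[of x], of "1 / real (Suc n)" "f x"] M[of x]
      by (intro order_trans[OF abs_triangle_ineq4] add_mono) auto
    then show ?thesis using power_mono[of "\<bar>?h n x\<bar>" "2 * M + 1" 2] by (simp del: power_mono_iff)
  qed
  have "(\<lambda>n. LINT x|lebesgue_on torus_cell. (?h n x)\<^sup>2) \<longlonglongrightarrow> (LINT x|lebesgue_on (torus_cell :: (real ^ 'd) set). 0)"
  proof (rule integral_dominated_convergence[where w = "\<lambda>_. (2 * M + 1)\<^sup>2"])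
    show "(\<lambda>x. (?h n x)\<^sup>2) \<in> borel_measurable (lebesgue_on torus_cell)" for n
      using cont_integrable_cell[OF c] by (rule borel_measurable_integrable)
    show "integrable (lebesgue_on torus_cell) (\<lambda>_ :: real ^ 'd. (2 * M + 1)\<^sup>2)"
      by (intro cont_integrable_cell continuous_on_const)
  qed (use lim bound in auto)
  then show ?thesis by simp
qed

context sobolev_exponent
begin

text \<open>The ratio \<open>r n\<close> is positive but, because of the absolute values, only known
  to be continuous. Its logarithm is therefore replaced by a uniformly close \<open>ev f\<close>,
  and uniform closeness is enough in \<open>L\<^sup>2\<close>.\<close>

lemma expX_L2_approx:
  assumes sgn: "\<And>x. sgn (ev a x) = sgn (ev b x)" and e: "e > 0"
  obtains f \<delta> where "\<delta> > 0" "\<And>c. norm (c - expX f a) < \<delta> \<Longrightarrow> L2_norm (ev c - ev b) < e"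
proof -
  let ?C = "(2 * pi) ^ CARD('d)"
  have C: "?C > 0" by simp
  obtain M where M: "M > 0" "\<And>x. \<bar>ev b x\<bar> \<le> M" using periodic_bounded[OF periodic_ev continuous_on_ev] by blast
  define r where "r n x = (\<bar>ev b x\<bar> + 1 / real (Suc n)) / (\<bar>ev a x\<bar> + 1 / real (Suc n))" for n x
  have "(\<lambda>n. LINT x|lebesgue_on torus_cell. (ev a x * r n x - ev b x)\<^sup>2) \<longlonglongrightarrow> 0"
    unfolding r_def by (intro tendsto_L2_same_sign[OF _ _ M(2)] continuous_on_ev sgn)
  moreover have "e\<^sup>2 / 4 > 0" using e by simp
  ultimately have "\<forall>\<^sub>F n in sequentially. (LINT x|lebesgue_on torus_cell. (ev a x * r n x - ev b x)\<^sup>2) < e\<^sup>2 / 4"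
    by (rule order_tendstoD)
  then obtain n where n: "(LINT x|lebesgue_on torus_cell. (ev a x * r n x - ev b x)\<^sup>2) < e\<^sup>2 / 4"
    using eventually_happens'[OF sequentially_bot] by blast
  have pos: "\<bar>ev b x\<bar> + 1 / real (Suc n) > 0" "\<bar>ev a x\<bar> + 1 / real (Suc n) > 0" for x
    by (intro add_nonneg_pos; simp)+
  have rpos: "r n x > 0" for x unfolding r_def by (intro divide_pos_pos pos)
  have rc: "continuous_on UNIV (r n)"
    unfolding r_def by (intro continuous_on_ratio continuous_on_ev) simp
  have rb: "\<bar>ev a x * r n x\<bar> \<le> M + 1" for x
    unfolding r_def by (intro abs_mult_ratio_le M(2)) auto
  \<comment> \<open>Half of \<open>d\<close> goes to approximating the logarithm (\<open>e'\<close>)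
    and half to the distance of \<open>c\<close> from \<open>expX f a\<close>
    (\<open>\<delta>\<close>). The squares then add up to \<open>e\<^sup>2 / 8\<close> plus twice a
    quantity below \<open>e\<^sup>2 / 4\<close>.\<close>
  define d where "d = e / (4 * sqrt ?C)"
  have d: "d > 0" using e C by (simp add: d_def)
  have dC: "?C * d\<^sup>2 = e\<^sup>2 / 16" using C by (simp add: d_def power_divide power_mult_distrib)
  have half: "c * (d / (2 * c)) = d / 2" if "c > 0" for c using that by simp
  define e' where "e' = d / (2 * (M + 1))"
  have e': "e' > 0" using d M(1) by (simp add: e'_def)
  have "periodic (\<lambda>x. ln (r n x))"
    using periodic_ev[of a] periodic_ev[of b] by (simp add: periodic_def r_def)
  moreover have "continuous_on UNIV (\<lambda>x. ln (r n x))"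
    using rpos by (intro continuous_on_ln rc) (simp add: less_imp_neq[symmetric])
  moreover have "ln (1 + e') > 0" using e' by simp
  ultimately obtain f where f: "\<And>x. \<bar>ln (r n x) - ev f x\<bar> < ln (1 + e')"
    using uniform_approx[of "\<lambda>x. ln (r n x)" "ln (1 + e')"] by blast
  have near: "\<bar>ev (expX f a) x - ev a x * r n x\<bar> \<le> d / 2" for x
  proof -
    have "ev (expX f a) x - ev a x * r n x = (ev a x * r n x) * (exp (ev f x - ln (r n x)) - 1)"
      using rpos[of x] by (simp add: ev_expX exp_diff algebra_simps)
    moreover have "\<bar>exp (ev f x - ln (r n x)) - 1\<bar> < e'"
      using f[of x] e' by (intro abs_exp_minus_1_less) auto
    ultimately have "\<bar>ev (expX f a) x - ev a x * r n x\<bar> \<le> (M + 1) * e'"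
      using rb[of x] M(1) by (simp add: abs_mult mult_mono)
    also have "\<dots> = d / 2" unfolding e'_def using M(1) by (intro half) simp
    finally show ?thesis .
  qed
  define \<delta> where "\<delta> = d / (2 * (emb_const + 1))"
  have \<delta>: "\<delta> > 0" unfolding \<delta>_def using d emb_const_nonneg by (intro divide_pos_pos) auto
  show thesis
  proof (rule that[OF \<delta>])
    fix c assume c: "norm (c - expX f a) < \<delta>"
    have cd: "\<bar>ev c x - ev a x * r n x\<bar> \<le> d" for x
    proof -
      have "\<bar>ev c x - ev (expX f a) x\<bar> \<le> emb_const * \<delta>"
        using ev_bound[of "c - expX f a" x] mult_left_mono[OF less_imp_le[OF c] emb_const_nonneg]
        by (simp add: ev_diff)
      also have "\<dots> \<le> (emb_const + 1) * \<delta>" using \<delta> by (simp add: distrib_right)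
      also have "\<dots> = d / 2" unfolding \<delta>_def using emb_const_nonneg by (intro half) linarith
      finally show ?thesis using near[of x] by linarith
    qed
    have cont: "continuous_on UNIV (\<lambda>x. (ev c x - ev b x)\<^sup>2)"
      "continuous_on UNIV (\<lambda>x. (ev a x * r n x - ev b x)\<^sup>2)"
      by (intro continuous_intros continuous_on_ev rc)+
    have "(LINT x|lebesgue_on torus_cell. (ev c x - ev b x)\<^sup>2) \<le>
        (LINT x|lebesgue_on torus_cell. 2 * d\<^sup>2 + 2 * (ev a x * r n x - ev b x)\<^sup>2)"
    proof (rule integral_mono)
      fix x
      have "(ev c x - ev b x)\<^sup>2 \<le> 2 * (ev c x - ev a x * r n x)\<^sup>2 + 2 * (ev a x * r n x - ev b x)\<^sup>2"
        using zero_le_power2[of "(ev c x - ev a x * r n x) - (ev a x * r n x - ev b x)"]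
        by (simp add: power2_eq_square algebra_simps)
      also have "(ev c x - ev a x * r n x)\<^sup>2 \<le> d\<^sup>2" using power_mono[OF cd[of x], of 2] by simp
      finally show "(ev c x - ev b x)\<^sup>2 \<le> 2 * d\<^sup>2 + 2 * (ev a x * r n x - ev b x)\<^sup>2" by simp
    qed (intro cont_integrable_cell continuous_intros cont)+
    also have "\<dots> = 2 * d\<^sup>2 * ?C + 2 * (LINT x|lebesgue_on torus_cell. (ev a x * r n x - ev b x)\<^sup>2)"
      using measure_cell[where 'd = 'd]
      by (subst Bochner_Integration.integral_add)
         (auto intro!: cont_integrable_cell continuous_intros cont)
    also have "2 * d\<^sup>2 * ?C = e\<^sup>2 / 8" using dC by (simp only: mult.assoc mult.commute[of "d\<^sup>2"])
    also have "e\<^sup>2 / 8 + 2 * (LINT x|lebesgue_on torus_cell. (ev a x * r n x - ev b x)\<^sup>2) < e\<^sup>2"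
      using n zero_less_power[OF e, of 2] by linarith
    finally have "L2_norm (ev c - ev b) < sqrt (e\<^sup>2)"
      unfolding L2_norm_def fun_diff_def by (rule real_sqrt_less_mono)
    then show "L2_norm (ev c - ev b) < e" using e by simp
  qed
qed

text \<open>The constant \<open>\<sigma>\<close> is the common sign, 1 or -1, and the exponents are
  the logarithms of the absolute values.\<close>

lemma same_sign_imp_expX:
  assumes "(\<forall>x. ev a x > 0 \<and> ev b x > 0) \<or> (\<forall>x. ev a x < 0 \<and> ev b x < 0)"
  obtains f g \<sigma> where "a = expX f (const \<sigma>)" "b = expX g (const \<sigma>)"
proof -
  have ex: "\<exists>f. c = expX f (const \<sigma>)" if \<sigma>: "\<sigma> = 1 \<or> \<sigma> = - 1" and pos: "\<And>x. \<sigma> * ev c x > 0" for c \<sigma>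
  proof -
    obtain f where f: "\<And>x. ev f x = ln (ev (\<sigma> *\<^sub>R c) x)"
      using ex_log[of "\<sigma> *\<^sub>R c"] pos by (auto simp: ev_scaleR)
    have "c = expX f (const \<sigma>)"
      using \<sigma> pos by (intro ev_eqI) (auto simp: ev_expX f ev_scaleR)
    then show ?thesis ..
  qed
  from assms show thesis
  proof
    assume "\<forall>x. ev a x > 0 \<and> ev b x > 0"
    then show thesis using that ex[of 1 a] ex[of 1 b] by auto
  next
    assume "\<forall>x. ev a x < 0 \<and> ev b x < 0"
    then show thesis using that ex[of "- 1" a] ex[of "- 1" b] by auto
  qed
qed

end

subsection \<open>The heat semigroup as a Gaussian average of translations\<close>

definition gauss :: "('d::finite \<Rightarrow> real) measure" where
  "gauss = (\<Pi>\<^sub>M i\<in>UNIV. std_normal_distribution)"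

definition vec_of :: "('d::finite \<Rightarrow> real) \<Rightarrow> real ^ 'd" where
  "vec_of w = (\<chi> i. w i)"

lemma vec_of_nth [simp]: "vec_of w $ i = w i"
  by (simp add: vec_of_def)

lemma prob_space_std_normal: "prob_space std_normal_distribution"
  by (rule prob_space_normal_density) simp

lemma prob_space_gauss: "prob_space (gauss :: ('d::finite \<Rightarrow> real) measure)"
  unfolding gauss_def by (intro prob_space_PiM prob_space_std_normal)

lemma product_sigma_finite_gauss: "product_sigma_finite (\<lambda>_ :: 'd::finite. std_normal_distribution)"
  using prob_space_std_normal by (intro product_sigma_finite.intro prob_space_imp_sigma_finite)

lemma measurable_vec_of [measurable]: "vec_of \<in> borel_measurable (gauss :: ('d::finite \<Rightarrow> real) measure)"
proof -
  have "(\<lambda>w. vec_of w \<bullet> b) \<in> borel_measurable (gauss :: ('d \<Rightarrow> real) measure)" if "b \<in> Basis" for b :: "real ^ 'd"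
  proof -
    have "b \<in> range (\<lambda>i :: 'd. axis i 1)" using that by (auto simp: Basis_vec_def)
    then obtain i where "b = axis i 1" by blast
    then have "(\<lambda>w. vec_of w \<bullet> b) = (\<lambda>w. w i)" by (simp add: inner_axis fun_eq_iff)
    moreover have "(\<lambda>w. w i) \<in> measurable (gauss :: ('d \<Rightarrow> real) measure) std_normal_distribution"
      unfolding gauss_def by (rule measurable_component_singleton) simp
    moreover have "measurable (gauss :: ('d \<Rightarrow> real) measure) std_normal_distribution = borel_measurable gauss"
      by (rule measurable_cong_sets) simp_all
    ultimately show ?thesis by (simp only:)
  qed
  then show ?thesis by (subst borel_measurable_euclidean_space) blast
qed

lemma std_normal_exp:
  shows "integrable std_normal_distribution (\<lambda>x. exp (c * x))"
    and "(LINT x|std_normal_distribution. exp (c * x)) = exp (c\<^sup>2 / 2)"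
proof -
  have eq: "std_normal_density x * exp (c * x) = exp (c\<^sup>2 / 2) * normal_density c 1 x" for x
  proof -
    have "- x\<^sup>2 / 2 + c * x = c\<^sup>2 / 2 + (- (x - c)\<^sup>2 / 2)"
      by (simp add: power2_eq_square field_simps)
    then have "exp (- x\<^sup>2 / 2) * exp (c * x) = exp (c\<^sup>2 / 2) * exp (- (x - c)\<^sup>2 / 2)"
      by (simp flip: exp_add)
    then show ?thesis by (simp add: normal_density_def)
  qed
  show "integrable std_normal_distribution (\<lambda>x. exp (c * x))"
    by (subst integrable_density) (auto simp: normal_density_nonneg eq)
  show "(LINT x|std_normal_distribution. exp (c * x)) = exp (c\<^sup>2 / 2)"
    by (subst integral_density) (auto simp: normal_density_nonneg eq)
qed

lemma gauss_exp:
  "(LINT w|gauss. exp (\<Sum>i\<in>UNIV. c i * w i)) = exp ((\<Sum>i\<in>UNIV. (c i)\<^sup>2) / 2)"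
proof -
  interpret product_sigma_finite "\<lambda>_ :: 'a. std_normal_distribution" by (rule product_sigma_finite_gauss)
  have "(LINT w|gauss. exp (\<Sum>i\<in>UNIV. c i * w i)) = (LINT w|gauss. (\<Prod>i\<in>UNIV. exp (c i * w i)))"
    by (simp add: exp_sum)
  also have "\<dots> = (\<Prod>i\<in>UNIV. LINT x|std_normal_distribution. exp (c i * x))"
    unfolding gauss_def by (intro product_integral_prod std_normal_exp) auto
  also have "\<dots> = exp ((\<Sum>i\<in>UNIV. (c i)\<^sup>2) / 2)"
    by (simp add: std_normal_exp exp_sum sum_divide_distrib)
  finally show ?thesis .
qed

lemma gauss_character:
  "(LINT w|gauss. character k (c *\<^sub>R vec_of w)) = complex_of_real (exp (- (c\<^sup>2 / 2) * freq_sq k))"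
proof -
  interpret product_sigma_finite "\<lambda>_ :: 'a. std_normal_distribution" by (rule product_sigma_finite_gauss)
  interpret real_distribution std_normal_distribution by (rule real_dist_normal_dist)
  have "(LINT w|gauss. character k (c *\<^sub>R vec_of w)) = (LINT w|gauss. (\<Prod>i\<in>UNIV. iexp ((k $ i * c) * w i)))"
  proof -
    have "character k (c *\<^sub>R vec_of w) = (\<Prod>i\<in>UNIV. iexp ((k $ i * c) * w i))" for w
      unfolding character_def by (subst cis_sum) (simp_all add: cis_conv_exp mult_ac)
    then show ?thesis by simp
  qed
  also have "\<dots> = (\<Prod>i\<in>UNIV. CLINT x|std_normal_distribution. iexp ((k $ i * c) * x))"
    unfolding gauss_def by (intro product_integral_prod integrable_iexp) auto
  also have "\<dots> = (\<Prod>i\<in>UNIV. complex_of_real (exp (- (k $ i * c)\<^sup>2 / 2)))"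
  proof -
    have "(CLINT x|std_normal_distribution. iexp (t * x)) = complex_of_real (exp (- (t\<^sup>2) / 2))" for t
      using fun_cong[OF char_std_normal_distribution, of t] unfolding char_def .
    then show ?thesis by (simp only:)
  qed
  also have "\<dots> = complex_of_real (exp (\<Sum>i\<in>UNIV. - (k $ i * c)\<^sup>2 / 2))"
    by (simp add: exp_sum)
  also have "(\<Sum>i\<in>UNIV. - (k $ i * c)\<^sup>2 / 2) = - (c\<^sup>2 / 2) * freq_sq k"
    by (simp add: freq_sq_def sum_distrib_left power_mult_distrib sum_negf mult_ac)
  finally show ?thesis .
qed

text \<open>The Euclidean norm is at most the sum of the absolute values, and
  \<open>exp \<bar>t\<bar> \<le> exp t + exp (- t)\<close>; this leaves a product of one-dimensional
  integrable functions. It provides the dominating functions below.\<close>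

lemma integrable_gauss_exp_norm: "integrable (gauss :: ('d::finite \<Rightarrow> real) measure) (\<lambda>w. exp (c * norm (vec_of w)))"
proof -
  interpret product_sigma_finite "\<lambda>_ :: 'd. std_normal_distribution" by (rule product_sigma_finite_gauss)
  have "integrable (gauss :: ('d \<Rightarrow> real) measure) (\<lambda>w. \<Prod>i\<in>UNIV. exp (\<bar>c\<bar> * w i) + exp (- \<bar>c\<bar> * w i))"
    unfolding gauss_def
    by (rule product_integrable_prod[where f = "\<lambda>_ x. exp (\<bar>c\<bar> * x) + exp (- \<bar>c\<bar> * x)"])
       (intro Bochner_Integration.integrable_add std_normal_exp finite)+
  then show ?thesis
  proof (rule Bochner_Integration.integrable_bound)
    show "(\<lambda>w. exp (c * norm (vec_of w))) \<in> borel_measurable gauss" by measurable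
    have "norm (exp (c * norm (vec_of w))) \<le> norm (\<Prod>i\<in>UNIV. exp (\<bar>c\<bar> * w i) + exp (- \<bar>c\<bar> * w i))" for w
    proof -
      have "c * norm (vec_of w) \<le> \<bar>c\<bar> * norm (vec_of w)" by (intro mult_right_mono) auto
      also have "\<dots> \<le> \<bar>c\<bar> * (\<Sum>i\<in>UNIV. \<bar>w i\<bar>)"
        using norm_le_l1_cart[of "vec_of w"] by (intro mult_left_mono) auto
      finally have "exp (c * norm (vec_of w)) \<le> exp (\<Sum>i\<in>UNIV. \<bar>c\<bar> * \<bar>w i\<bar>)" by (simp add: sum_distrib_left)
      also have "\<dots> = (\<Prod>i\<in>UNIV. exp (\<bar>c\<bar> * \<bar>w i\<bar>))" by (simp add: exp_sum)
      also have "\<dots> \<le> (\<Prod>i\<in>UNIV. exp (\<bar>c\<bar> * w i) + exp (- \<bar>c\<bar> * w i))"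
        by (intro prod_mono) (auto simp: abs_if)
      finally show ?thesis by simp
    qed
    then show "AE w in gauss. norm (exp (c * norm (vec_of w))) \<le> norm (\<Prod>i\<in>UNIV. exp (\<bar>c\<bar> * w i) + exp (- \<bar>c\<bar> * w i))"
      by (intro AE_I2)
  qed
qed

lemma measurable_translate_gauss:
  "(\<lambda>w. translate (c *\<^sub>R vec_of w) a) \<in> borel_measurable (gauss :: ('d::finite \<Rightarrow> real) measure)"
proof -
  have "continuous_on UNIV (\<lambda>v :: real ^ 'd. translate v a)"
    unfolding continuous_on_def by (auto intro!: translate_tendsto tendsto_ident_at)
  then have "(\<lambda>v :: real ^ 'd. translate v a) \<in> borel_measurable borel"
    by (rule borel_measurable_continuous_onI)
  then show ?thesis by measurable
qed

lemma integrable_translate_gauss: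
  "integrable gauss (\<lambda>w. translate (c *\<^sub>R vec_of w) (a :: 'd::finite hseq))"
proof -
  interpret prob_space "gauss :: ('d \<Rightarrow> real) measure" by (rule prob_space_gauss)
  show ?thesis
    by (rule integrable_const_bound[of _ "norm a"]) (auto simp: norm_translate_le measurable_translate_gauss)
qed

text \<open>Coefficientwise this is the characteristic function of a Gaussian; the displacement
  \<open>sqrt (2 * t)\<close> is chosen because \<open>c\<^sup>2 / 2 = t\<close> for
  \<open>c = sqrt (2 * t)\<close>.\<close>

lemma heatX_gauss:
  fixes a :: "'d::finite hseq"
  assumes "t \<ge> 0"
  shows "heatX t a = (LINT w|gauss. translate (sqrt (2 * t) *\<^sub>R vec_of w) a)"
proof (rule coef_eqI)
  fix k
  have "coef (LINT w|gauss. translate (sqrt (2 * t) *\<^sub>R vec_of w) a) k =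
      (LINT w|gauss. coef (translate (sqrt (2 * t) *\<^sub>R vec_of w) a) k)"
    by (rule integral_bounded_linear[OF bounded_linear_coef integrable_translate_gauss, symmetric])
  also have "\<dots> = (LINT w|gauss. character k (sqrt (2 * t) *\<^sub>R vec_of w) * coef a k)"
    unfolding translate_def by (simp only: coef_fmul[OF multiplier_character])
  also have "\<dots> = (LINT w|gauss. character k (sqrt (2 * t) *\<^sub>R vec_of w)) * coef a k"
    by (rule integral_mult_left_zero)
  also have "\<dots> = coef (heatX t a) k"
    using assms unfolding gauss_character heatX_def coef_fmul[OF multiplier_heat[OF assms]] by simp
  finally show "coef (heatX t a) k = coef (LINT w|gauss. translate (sqrt (2 * t) *\<^sub>R vec_of w) a) k" by simp
qed

context sobolev_exponent
begin

subsection \<open>The conjugated heat semigroup\<close>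

definition conj_heat :: "'d hseq \<Rightarrow> real \<Rightarrow> real \<Rightarrow> 'd hseq \<Rightarrow> 'd hseq" where
  "conj_heat a \<epsilon> t y = expX (a /\<^sub>R \<epsilon>) (heatX t (expX (- (a /\<^sub>R \<epsilon>)) y))"

text \<open>In this form the singular factor \<open>1 / \<epsilon>\<close> meets only the small
  difference \<open>a - translate v a\<close>.\<close>

definition conj_integrand :: "'d hseq \<Rightarrow> real \<Rightarrow> real ^ 'd \<Rightarrow> 'd hseq \<Rightarrow> 'd hseq" where
  "conj_integrand a \<epsilon> v y = expX ((a - translate v a) /\<^sub>R \<epsilon>) (translate v y)"

lemma conj_integrand_eq:
  "conj_integrand a \<epsilon> v y = expX (a /\<^sub>R \<epsilon>) (translate v (expX (- (a /\<^sub>R \<epsilon>)) y))"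
  by (rule ev_eqI)
     (simp add: conj_integrand_def ev_expX ev_translate ev_scaleR ev_diff ev_neg right_diff_distrib exp_diff exp_minus divide_inverse)

lemma conj_heat_gauss:
  assumes "t \<ge> 0"
  shows "conj_heat a \<epsilon> t y = (LINT w|gauss. conj_integrand a \<epsilon> (sqrt (2 * t) *\<^sub>R vec_of w) y)"
    and "integrable gauss (\<lambda>w. conj_integrand a \<epsilon> (sqrt (2 * t) *\<^sub>R vec_of w) y)"
  unfolding conj_heat_def conj_integrand_eq heatX_gauss[OF assms]
  by (rule integral_bounded_linear[OF bounded_linear_expX integrable_translate_gauss, symmetric]
      integrable_bounded_linear[OF bounded_linear_expX integrable_translate_gauss])+

definition conj_const :: "'d hseq \<Rightarrow> real" where
  "conj_const b = (LINT w|(gauss :: ('d \<Rightarrow> real) measure). exp (mult_const * sqrt 2 * norm b * norm (vec_of w)))"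

text \<open>For \<open>t \<le> \<epsilon>\<^sup>2\<close> the displacement is of order
  \<open>\<epsilon>\<close>, which cancels the \<open>1 / \<epsilon>\<close> in the exponent. The
  bound is thus uniform in \<open>\<epsilon>\<close>, and this dictates the time scale
  \<open>\<epsilon>\<^sup>2\<close>.\<close>

lemma norm_conj_integrand_le:
  assumes "0 \<le> t" "t \<le> \<epsilon>\<^sup>2" "\<epsilon> > 0"
  shows "norm (conj_integrand (resolvent b) \<epsilon> (sqrt (2 * t) *\<^sub>R vec_of w) y)
    \<le> exp (mult_const * sqrt 2 * norm b * norm (vec_of w)) * norm y"
proof -
  let ?v = "sqrt (2 * t) *\<^sub>R vec_of w"
  have "sqrt t \<le> \<epsilon>" using assms by (intro real_le_lsqrt) auto
  then have "norm ?v \<le> sqrt 2 * \<epsilon> * norm (vec_of w)"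
    using assms by (auto simp: real_sqrt_mult intro!: mult_right_mono)
  then have "norm ?v * norm b \<le> sqrt 2 * \<epsilon> * norm (vec_of w) * norm b" by (intro mult_right_mono) auto
  with norm_translate_diff_le[of ?v b]
  have "norm (resolvent b - translate ?v (resolvent b)) \<le> sqrt 2 * \<epsilon> * norm (vec_of w) * norm b"
    by (simp add: norm_minus_commute)
  then have "norm ((resolvent b - translate ?v (resolvent b)) /\<^sub>R \<epsilon>) \<le> sqrt 2 * norm b * norm (vec_of w)"
    using assms(3) unfolding norm_scaleR by (simp add: field_simps)
  then have "mult_const * norm ((resolvent b - translate ?v (resolvent b)) /\<^sub>R \<epsilon>) \<le> mult_const * (sqrt 2 * norm b * norm (vec_of w))"
    by (intro mult_left_mono mult_const_nonneg)
  then show ?thesis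
    unfolding conj_integrand_def
    by (intro order_trans[OF norm_expX_le] mult_mono norm_translate_le) (auto simp: mult_ac)
qed

lemma norm_conj_heat_le:
  assumes "0 \<le> t" "t \<le> \<epsilon>\<^sup>2" "\<epsilon> > 0"
  shows "norm (conj_heat (resolvent b) \<epsilon> t y) \<le> conj_const b * norm y"
proof -
  have "norm (conj_heat (resolvent b) \<epsilon> t y) \<le>
      (LINT w|gauss. norm (conj_integrand (resolvent b) \<epsilon> (sqrt (2 * t) *\<^sub>R vec_of w) y))"
    unfolding conj_heat_gauss(1)[OF assms(1)] by simp
  also have "\<dots> \<le> (LINT w|(gauss :: ('d \<Rightarrow> real) measure). exp (mult_const * sqrt 2 * norm b * norm (vec_of w)) * norm y)"
    by (intro integral_mono integrable_norm conj_heat_gauss assms norm_conj_integrand_le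
        integrable_mult_left integrable_gauss_exp_norm)
  also have "\<dots> = conj_const b * norm y" by (simp add: conj_const_def)
  finally show ?thesis .
qed

text \<open>With \<open>a = resolvent b\<close> and \<open>v = \<epsilon> \<surd>2 w\<close> the exponent \<open>(a - translate v a) / \<epsilon>\<close> tends to
  \<open>- \<surd>2 w \<bullet> \<nabla>a\<close>, and the Gaussian average of \<open>exp (- \<surd>2 w \<bullet> \<nabla>a)\<close> is \<open>exp \<bar>\<nabla>a\<bar>\<^sup>2\<close>.\<close>

lemma conj_heat_tendsto:
  fixes \<epsilon> :: "nat \<Rightarrow> real"
  assumes pos: "\<And>n. \<epsilon> n > 0" and lim: "\<epsilon> \<longlonglongrightarrow> 0"
  shows "(\<lambda>n. conj_heat (resolvent b) (\<epsilon> n) ((\<epsilon> n)\<^sup>2) y) \<longlonglongrightarrow>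
    expX (\<Sum>i\<in>UNIV. mult (deriv_res i b) (deriv_res i b)) y"
proof -
  define g where "g w = (\<Sum>i\<in>UNIV. (- sqrt 2 * w i) *\<^sub>R deriv_res i b)" for w
  have sq: "sqrt (2 * (\<epsilon> n)\<^sup>2) = sqrt 2 * \<epsilon> n" for n
    using pos[of n] by (simp add: real_sqrt_mult)
  have "(\<lambda>n. LINT w|gauss. conj_integrand (resolvent b) (\<epsilon> n) (sqrt (2 * (\<epsilon> n)\<^sup>2) *\<^sub>R vec_of w) y) \<longlonglongrightarrow>
      (LINT w|gauss. expX (g w) y)"
  proof -
    have int_w: "integrable gauss (\<lambda>w. exp (mult_const * sqrt 2 * norm b * norm (vec_of w :: real ^ 'd)) * norm y)"
      by (intro integrable_mult_left integrable_gauss_exp_norm)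
    have bound: "AE w in gauss. norm (conj_integrand (resolvent b) (\<epsilon> n) (sqrt (2 * (\<epsilon> n)\<^sup>2) *\<^sub>R vec_of w) y)
        \<le> exp (mult_const * sqrt 2 * norm b * norm (vec_of w)) * norm y" for n
      using pos[of n] by (intro AE_I2 norm_conj_integrand_le) auto
    have meas: "(\<lambda>w. conj_integrand (resolvent b) (\<epsilon> n) (sqrt (2 * (\<epsilon> n)\<^sup>2) *\<^sub>R vec_of w) y) \<in> borel_measurable gauss" for n
      by (intro borel_measurable_integrable conj_heat_gauss) simp
    have lim_w: "(\<lambda>n. conj_integrand (resolvent b) (\<epsilon> n) (sqrt (2 * (\<epsilon> n)\<^sup>2) *\<^sub>R vec_of w) y) \<longlonglongrightarrow> expX (g w) y" for w
      unfolding conj_integrand_def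
    proof (rule expX_tendsto)
      let ?v = "\<lambda>n. sqrt (2 * (\<epsilon> n)\<^sup>2) *\<^sub>R vec_of w"
      have v: "?v n = (sqrt 2 * \<epsilon> n) *\<^sub>R vec_of w" for n by (simp add: sq)
      have "?v \<longlonglongrightarrow> (sqrt 2 * 0) *\<^sub>R vec_of w"
        unfolding v by (intro tendsto_intros lim)
      then have "?v \<longlonglongrightarrow> 0" by simp
      from translate_tendsto[OF this, of y] show "(\<lambda>n. translate (?v n) y) \<longlonglongrightarrow> y"
      proof -
        have "translate 0 y = y" by (rule ev_eqI) (simp add: ev_translate)
        then show ?thesis using \<open>(\<lambda>n. translate (?v n) y) \<longlonglongrightarrow> translate 0 y\<close> by simp
      qed
      have "(\<lambda>n. (resolvent b - translate (?v n) (resolvent b)) /\<^sub>R \<epsilon> n - g w) \<longlonglongrightarrow> 0"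
      proof (rule Lim_null_comparison)
        \<comment> \<open>The Taylor remainder is quadratic in \<open>?v n\<close>, so division by
          \<open>\<epsilon> n\<close> leaves order \<open>\<epsilon> n\<close>.\<close>
        have "norm ((resolvent b - translate (?v n) (resolvent b)) /\<^sub>R \<epsilon> n - g w) \<le> 2 * \<epsilon> n * (norm (vec_of w))\<^sup>2 * norm b" for n
        proof -
          have "(\<Sum>i\<in>UNIV. (?v n $ i) *\<^sub>R deriv_res i b) = - \<epsilon> n *\<^sub>R g w"
            unfolding v g_def by (simp add: scaleR_sum_right mult_ac)
          then have "(resolvent b - translate (?v n) (resolvent b)) /\<^sub>R \<epsilon> n - g w =
              - ((translate (?v n) (resolvent b) - resolvent b - (\<Sum>i\<in>UNIV. (?v n $ i) *\<^sub>R deriv_res i b)) /\<^sub>R \<epsilon> n)"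
            using pos[of n] by (simp add: algebra_simps)
          then have "norm ((resolvent b - translate (?v n) (resolvent b)) /\<^sub>R \<epsilon> n - g w) =
              norm (translate (?v n) (resolvent b) - resolvent b - (\<Sum>i\<in>UNIV. (?v n $ i) *\<^sub>R deriv_res i b)) / \<epsilon> n"
            using pos[of n] by (simp add: divide_inverse mult.commute)
          also have "\<dots> \<le> ((norm (?v n))\<^sup>2 * norm b) / \<epsilon> n"
            using pos[of n] by (intro divide_right_mono norm_taylor_le) auto
          also have "\<dots> = 2 * \<epsilon> n * (norm (vec_of w))\<^sup>2 * norm b"
            using pos[of n] unfolding v by (simp add: power_mult_distrib power2_eq_square[of "\<epsilon> n"])
          finally show ?thesis .
        qed
        then show "\<forall>\<^sub>F n in sequentially. norm ((resolvent b - translate (?v n) (resolvent b)) /\<^sub>R \<epsilon> n - g w) \<le>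
            2 * \<epsilon> n * (norm (vec_of w))\<^sup>2 * norm b" by simp
        have "(\<lambda>n. 2 * \<epsilon> n * (norm (vec_of w))\<^sup>2 * norm b) \<longlonglongrightarrow> 2 * 0 * (norm (vec_of w))\<^sup>2 * norm b"
          by (intro tendsto_intros lim)
        then show "(\<lambda>n. 2 * \<epsilon> n * (norm (vec_of w))\<^sup>2 * norm b) \<longlonglongrightarrow> 0" by simp
      qed
      then show "(\<lambda>n. (resolvent b - translate (?v n) (resolvent b)) /\<^sub>R \<epsilon> n) \<longlonglongrightarrow> g w"
        by (rule Lim_null[THEN iffD2])
    qed
    then have lim_AE: "AE w in gauss. (\<lambda>n. conj_integrand (resolvent b) (\<epsilon> n) (sqrt (2 * (\<epsilon> n)\<^sup>2) *\<^sub>R vec_of w) y) \<longlonglongrightarrow> expX (g w) y"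
      by (intro AE_I2)
    have meas_lim: "(\<lambda>w. expX (g w) y) \<in> borel_measurable gauss"
      by (rule borel_measurable_LIMSEQ_metric[OF meas lim_w])
    show ?thesis
      by (rule integral_dominated_convergence[OF meas_lim meas int_w lim_AE bound])
  qed
  \<comment> \<open>Evaluation at a point commutes with the integral and leaves the scalar Gaussian
    integral \<open>gauss_exp\<close>.\<close>
  moreover have "(LINT w|gauss. expX (g w) y) = expX (\<Sum>i\<in>UNIV. mult (deriv_res i b) (deriv_res i b)) y"
  proof (rule ev_eqI)
    fix x
    have meas: "(\<lambda>w. expX (g w) y) \<in> borel_measurable gauss"
    proof -
      have "continuous_on UNIV (\<lambda>v :: real ^ 'd. expX (\<Sum>i\<in>UNIV. (- sqrt 2 * v $ i) *\<^sub>R deriv_res i b) y)"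
        unfolding continuous_on_def by (auto intro!: expX_tendsto tendsto_intros)
      from borel_measurable_continuous_on[OF this measurable_vec_of] show ?thesis by (simp add: g_def)
    qed
    have int: "integrable gauss (\<lambda>w. expX (g w) y)"
    proof (rule Bochner_Integration.integrable_bound[OF _ meas])
      let ?C = "mult_const * (sqrt 2 * (\<Sum>i\<in>UNIV. norm (deriv_res i b)))"
      show "integrable gauss (\<lambda>w. exp (?C * norm (vec_of w :: real ^ 'd)) * norm y)"
        by (intro integrable_mult_left integrable_gauss_exp_norm)
      have "norm (expX (g w) y) \<le> exp (?C * norm (vec_of w)) * norm y" for w
      proof -
        have "norm (g w) \<le> (\<Sum>i\<in>UNIV. sqrt 2 * norm (vec_of w) * norm (deriv_res i b))"
          unfolding g_def
        proof (rule sum_norm_le)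
          fix i
          have "\<bar>w i\<bar> \<le> norm (vec_of w)" using component_le_norm_cart[of "vec_of w" i] by simp
          then show "norm ((- sqrt 2 * w i) *\<^sub>R deriv_res i b) \<le> sqrt 2 * norm (vec_of w) * norm (deriv_res i b)"
            by (auto simp: abs_mult intro!: mult_right_mono)
        qed
        then have "norm (g w) \<le> sqrt 2 * (\<Sum>i\<in>UNIV. norm (deriv_res i b)) * norm (vec_of w)"
          by (simp add: sum_distrib_left[symmetric] mult_ac)
        then have "mult_const * norm (g w) \<le> ?C * norm (vec_of w)"
          using mult_left_mono[OF _ mult_const_nonneg, of "norm (g w)"] by (metis mult.assoc)
        then show ?thesis by (intro order_trans[OF norm_expX_le] mult_right_mono) auto
      qed
      then show "AE w in gauss. norm (expX (g w) y) \<le> norm (exp (?C * norm (vec_of w)) * norm y)"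
        by (intro AE_I2) simp
    qed
    have "ev (LINT w|gauss. expX (g w) y) x = (LINT w|gauss. ev (expX (g w) y) x)"
      by (rule integral_bounded_linear[OF bounded_linear_ev int, symmetric])
    also have "\<dots> = (LINT w|gauss. exp (\<Sum>i\<in>UNIV. (- sqrt 2 * ev (deriv_res i b) x) * w i) * ev y x)"
      by (simp add: ev_expX g_def ev_sum ev_scaleR ev_neg mult_ac)
    also have "\<dots> = exp (\<Sum>i\<in>UNIV. (ev (deriv_res i b) x)\<^sup>2) * ev y x"
    proof -
      have "(\<Sum>i\<in>UNIV. (- sqrt 2 * ev (deriv_res i b) x)\<^sup>2) / 2 = (\<Sum>i\<in>UNIV. (ev (deriv_res i b) x)\<^sup>2)"
        by (simp add: power_mult_distrib flip: sum_distrib_left)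
      then show ?thesis using gauss_exp[of "\<lambda>i. - sqrt 2 * ev (deriv_res i b) x"] by (simp only: integral_mult_left_zero)
    qed
    also have "\<dots> = ev (expX (\<Sum>i\<in>UNIV. mult (deriv_res i b) (deriv_res i b)) y) x"
      by (simp add: ev_expX ev_sum ev_mult power2_eq_square)
    finally show "ev (LINT w|gauss. expX (g w) y) x = ev (expX (\<Sum>i\<in>UNIV. mult (deriv_res i b) (deriv_res i b)) y) x" .
  qed
  ultimately show ?thesis using conj_heat_gauss(1) by simp
qed

end

subsection \<open>Mild solutions near approximate ones\<close>

text \<open>With \<open>max 0 (t - r)\<close> in place of \<open>t - r\<close> the integrand is
  continuous on a square and the interval of integration is fixed. The surplus over
  \<open>{t..T}\<close> involves only \<open>L 0\<close> and is subtracted again.\<close>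

lemma continuous_on_convolution:
  fixes L :: "real \<Rightarrow> 'a::banach \<Rightarrow> 'a"
  assumes L: "continuous_on ({0..T} \<times> UNIV) (\<lambda>(t, x). L t x)" and g: "continuous_on {0..T} g"
  shows "continuous_on {0..T} (\<lambda>t. integral {0..t} (\<lambda>r. L (t - r) (g r)))"
    and "t \<in> {0..T} \<Longrightarrow> continuous_on {0..t} (\<lambda>r. L (t - r) (g r))"
proof -
  have G: "continuous_on ({0..T} \<times> {0..T}) (\<lambda>(t, r). L (max 0 (t - r)) (g r))"
  proof -
    have "continuous_on ({0..T} \<times> {0..T}) (\<lambda>p. (max 0 (fst p - snd p), g (snd p)))"
      by (intro continuous_intros continuous_on_compose2[OF g]) auto
    from continuous_on_compose2[OF L this] show ?thesis by (force simp: case_prod_beta)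
  qed
  have c: "continuous_on {0..T} (\<lambda>r. L (max 0 (t - r)) (g r))" if "t \<in> {0..T}" for t
  proof -
    have "continuous_on {0..T} (\<lambda>r. (t, r))" by (intro continuous_intros)
    from continuous_on_compose2[OF G this] show ?thesis using that by (auto simp: image_subset_iff)
  qed
  show conv: "continuous_on {0..t} (\<lambda>r. L (t - r) (g r))" if "t \<in> {0..T}" for t
  proof -
    have "continuous_on {0..t} (\<lambda>r. L (max 0 (t - r)) (g r))"
      using continuous_on_subset[OF c[OF that]] that by auto
    then show ?thesis by (rule continuous_on_eq) auto
  qed
  have eq: "integral {0..t} (\<lambda>r. L (t - r) (g r)) =
      integral {0..T} (\<lambda>r. L (max 0 (t - r)) (g r)) - integral {t..T} (\<lambda>r. L 0 (g r))" if t: "t \<in> {0..T}" for t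
  proof -
    have "integral {0..t} (\<lambda>r. L (max 0 (t - r)) (g r)) + integral {t..T} (\<lambda>r. L (max 0 (t - r)) (g r)) =
        integral {0..T} (\<lambda>r. L (max 0 (t - r)) (g r))"
      using t by (intro Henstock_Kurzweil_Integration.integral_combine integrable_continuous_real c) auto
    moreover have "integral {0..t} (\<lambda>r. L (max 0 (t - r)) (g r)) = integral {0..t} (\<lambda>r. L (t - r) (g r))"
      by (rule Henstock_Kurzweil_Integration.integral_cong) auto
    moreover have "integral {t..T} (\<lambda>r. L (max 0 (t - r)) (g r)) = integral {t..T} (\<lambda>r. L 0 (g r))"
      by (rule Henstock_Kurzweil_Integration.integral_cong) auto
    ultimately show ?thesis by (simp add: algebra_simps)
  qed
  have L0: "(\<lambda>r. L 0 (g r)) integrable_on {0..T}"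
  proof (cases "T \<ge> 0")
    case True
    have "continuous_on {0..T} (\<lambda>r. (0 :: real, g r))" by (intro continuous_intros g)
    from continuous_on_compose2[OF L this] True show ?thesis
      by (intro integrable_continuous_real) (auto simp: image_subset_iff)
  qed (simp add: integrable_on_empty)
  have "continuous_on {0..T} (\<lambda>t. integral {0..T} (\<lambda>r. L (max 0 (t - r)) (g r)))"
    using integral_continuous_on_param[of "{0..T}" 0 T "\<lambda>t r. L (max 0 (t - r)) (g r)"] G by simp
  moreover have "continuous_on {0..T} (\<lambda>t. integral {t..T} (\<lambda>r. L 0 (g r)))"
    by (rule indefinite_integral_continuous_1'[OF L0])
  ultimately have "continuous_on {0..T} (\<lambda>t. integral {0..T} (\<lambda>r. L (max 0 (t - r)) (g r)) - integral {t..T} (\<lambda>r. L 0 (g r)))"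
    by (intro continuous_intros)
  then show "continuous_on {0..T} (\<lambda>t. integral {0..t} (\<lambda>r. L (t - r) (g r)))"
    by (rule continuous_on_eq) (simp add: eq)
qed

text \<open>A Picard step integrates one term of the exponential series into the next.\<close>

lemma has_integral_power_fact:
  fixes c t :: real
  assumes "t \<ge> 0"
  shows "((\<lambda>r. c * ((c * r) ^ n / fact n)) has_integral ((c * t) ^ Suc n / fact (Suc n))) {0..t}"
proof -
  have "((\<lambda>r. (c * r) ^ Suc n / fact (Suc n)) has_vector_derivative (c * ((c * r) ^ n / fact n))) (at r within {0..t})" for r
  proof -
    have "((\<lambda>r. (c * r) ^ Suc n / fact (Suc n)) has_real_derivative (real (Suc n) * (c * r) ^ n * c / fact (Suc n))) (at r within {0..t})"
      by (rule derivative_eq_intros refl | simp)+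
    moreover have "real (Suc n) * (c * r) ^ n * c / fact (Suc n) = c * ((c * r) ^ n / fact n)"
      by (simp add: fact_Suc field_simps del: of_nat_Suc)
    ultimately show ?thesis unfolding has_real_derivative_iff_has_vector_derivative by (simp only:)
  qed
  from fundamental_theorem_of_calculus[OF assms this] show ?thesis by simp
qed

text \<open>Picard iteration started at an approximate solution \<open>z\<close> with residual at most \<open>\<eta>\<close> stays in the
  tube of radius \<open>\<eta> e\<^bsup>CKT\<^esup>\<close> around \<open>z\<close>, so a local Lipschitz bound suffices.\<close>

lemma Picard_near_approximate_solution:
  fixes L :: "real \<Rightarrow> 'a::banach \<Rightarrow> 'a" and N :: "'a \<Rightarrow> 'a" and z :: "real \<Rightarrow> 'a"
  assumes T: "0 \<le> T" and C: "C \<ge> 0" and K: "K \<ge> 0" and \<eta>: "\<eta> \<ge> 0"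
    and lin: "\<And>t. t \<in> {0..T} \<Longrightarrow> linear (L t)"
    and bd: "\<And>t x. t \<in> {0..T} \<Longrightarrow> norm (L t x) \<le> C * norm x"
    and L: "continuous_on ({0..T} \<times> UNIV) (\<lambda>(t, x). L t x)"
    and Lip: "\<And>x y. norm x \<le> R \<Longrightarrow> norm y \<le> R \<Longrightarrow> norm (N x - N y) \<le> K * norm (x - y)"
    and z: "continuous_on {0..T} z" "\<And>t. t \<in> {0..T} \<Longrightarrow> norm (z t) + 1 \<le> R"
    and res: "\<And>t. t \<in> {0..T} \<Longrightarrow> norm (L t y0 + integral {0..t} (\<lambda>r. L (t - r) (N (z r))) - z t) \<le> \<eta>"
    and small: "\<eta> * exp (C * K * T) \<le> 1"
  shows "\<exists>y. continuous_on {0..T} y \<and>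
    (\<forall>t\<in>{0..T}. y t = L t y0 + integral {0..t} (\<lambda>r. L (t - r) (N (y r)))) \<and>
    (\<forall>t\<in>{0..T}. norm (y t - z t) \<le> \<eta> * exp (C * K * T))"
proof -
  define \<Gamma> where "\<Gamma> y t = L t y0 + integral {0..t} (\<lambda>r. L (t - r) (N (y r)))" for y t
  define good where "good y \<longleftrightarrow> continuous_on {0..T} y \<and> (\<forall>t\<in>{0..T}. norm (y t) \<le> R)" for y :: "real \<Rightarrow> 'a"
  have contN: "continuous_on (cball 0 R) N"
    by (rule lipschitz_on_continuous_on[of K]) (use Lip K in \<open>auto simp: lipschitz_on_def dist_norm\<close>)
  have Ny: "continuous_on {0..T} (\<lambda>r. N (y r))" if "good y" for y
    using that unfolding good_def by (intro continuous_on_compose2[OF contN]) auto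
  have cont\<Gamma>: "continuous_on {0..T} (\<Gamma> y)" if "good y" for y
  proof -
    have "continuous_on {0..T} (\<lambda>t. (t, y0))" by (intro continuous_intros)
    from continuous_on_compose2[OF L this] have "continuous_on {0..T} (\<lambda>t. L t y0)" by auto
    then show ?thesis
      unfolding \<Gamma>_def by (intro continuous_intros continuous_on_convolution(1)[OF L Ny[OF that]])
  qed
  \<comment> \<open>The majorant \<open>b\<close> is left free: it is a term of the exponential
    series in the iteration and a constant in the passage to the limit.\<close>
  have diff\<Gamma>: "norm (\<Gamma> y t - \<Gamma> y' t) \<le> B"
    if y: "good y" "good y'" and t: "t \<in> {0..T}"
      and b: "\<And>r. r \<in> {0..t} \<Longrightarrow> norm (y r - y' r) \<le> b r" and B: "((\<lambda>r. C * K * b r) has_integral B) {0..t}" for y y' t b B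
  proof -
    have i: "(\<lambda>r. L (t - r) (N (x r))) integrable_on {0..t}" if "good x" for x
      by (intro integrable_continuous_real continuous_on_convolution(2)[OF L Ny] that t)
    have "\<Gamma> y t - \<Gamma> y' t = integral {0..t} (\<lambda>r. L (t - r) (N (y r)) - L (t - r) (N (y' r)))"
      unfolding \<Gamma>_def by (simp add: Henstock_Kurzweil_Integration.integral_diff[OF i i] y)
    also have "norm \<dots> \<le> integral {0..t} (\<lambda>r. C * K * b r)"
    proof (rule Henstock_Kurzweil_Integration.integral_norm_bound_integral)
      show "(\<lambda>r. L (t - r) (N (y r)) - L (t - r) (N (y' r))) integrable_on {0..t}"
        by (intro Henstock_Kurzweil_Integration.integrable_diff i y)
      show "(\<lambda>r. C * K * b r) integrable_on {0..t}" using B by (rule has_integral_integrable)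
      fix r assume r: "r \<in> {0..t}"
      then have tr: "t - r \<in> {0..T}" "r \<in> {0..T}" using t by auto
      have "norm (L (t - r) (N (y r)) - L (t - r) (N (y' r))) = norm (L (t - r) (N (y r) - N (y' r)))"
        by (simp add: linear_diff[OF lin[OF tr(1)]])
      also have "\<dots> \<le> C * norm (N (y r) - N (y' r))" by (rule bd[OF tr(1)])
      also have "\<dots> \<le> C * (K * norm (y r - y' r))"
        using y tr(2) by (intro mult_left_mono Lip C) (auto simp: good_def)
      also have "\<dots> \<le> C * (K * b r)" by (intro mult_left_mono b r C K)
      finally show "norm (L (t - r) (N (y r)) - L (t - r) (N (y' r))) \<le> C * K * b r" by (simp add: mult_ac)
    qed
    also have "\<dots> = B" using B by (rule integral_unique)
    finally show ?thesis .
  qed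
  \<comment> \<open>The margin 1 between \<open>norm (z t)\<close> and \<open>R\<close> is what
    \<open>small\<close> allows the iterates to use up.\<close>
  have near: "norm x \<le> R" if "t \<in> {0..T}" "norm (x - z t) \<le> \<eta> * exp (C * K * T)" for x t
    using that z(2)[of t] small norm_triangle_sub[of x "z t"] by linarith
  define Y where "Y n = (\<Gamma> ^^ n) z" for n
  have Y: "Y 0 = z" "Y (Suc n) = \<Gamma> (Y n)" for n by (simp_all add: Y_def)
  define e where "e t j = (C * K * t) ^ j / fact j" for t j
  have e_nn: "e t j \<ge> 0" if "t \<ge> 0" for t j using that C K by (simp add: e_def)
  have e_sums: "e t sums exp (C * K * t)" for t
    using exp_converges[of "C * K * t"] unfolding e_def by (simp only: divide_inverse real_scaleR_def mult.commute[of "inverse _"])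
  have e_sum: "(\<Sum>j<n. \<eta> * e t j) \<le> \<eta> * exp (C * K * T)" if "t \<in> {0..T}" for n t
  proof -
    have "(\<Sum>j<n. e t j) \<le> exp (C * K * t)"
      using sum_le_suminf[OF sums_summable[OF e_sums[of t]], of "{..<n}"] sums_unique[OF e_sums[of t]] e_nn that by auto
    also have "\<dots> \<le> exp (C * K * T)" using that C K by (auto intro!: mult_left_mono)
    finally show ?thesis unfolding sum_distrib_left[symmetric] by (intro mult_left_mono \<eta>)
  qed
  \<comment> \<open>The three bounds support each other: the Lipschitz estimate for the next
    difference holds only inside the ball of radius \<open>R\<close>, and the iterates stay there
    because the earlier differences sum to little.\<close>
  have main: "good (Y n) \<and> (\<forall>t\<in>{0..T}. norm (Y (Suc n) t - Y n t) \<le> \<eta> * e t n) \<and>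
      (\<forall>t\<in>{0..T}. norm (Y n t - z t) \<le> (\<Sum>j<n. \<eta> * e t j))" for n
  proof (induction n)
    case 0
    have "norm (z t) \<le> R" if "t \<in> {0..T}" for t using z(2)[OF that] by linarith
    then show ?case using z res by (auto simp: Y good_def \<Gamma>_def e_def)
  next
    case (Suc n)
    have s: "norm (Y (Suc n) t - z t) \<le> (\<Sum>j<Suc n. \<eta> * e t j)" if "t \<in> {0..T}" for t
    proof -
      have "Y (Suc n) t - z t = (Y n t - z t) + (Y (Suc n) t - Y n t)" by simp
      also have "norm \<dots> \<le> (\<Sum>j<n. \<eta> * e t j) + \<eta> * e t n"
        using Suc that by (intro norm_triangle_le add_mono) auto
      finally show ?thesis by simp
    qed
    have g: "good (Y (Suc n))"
      unfolding good_def
    proof (intro conjI ballI)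
      show "continuous_on {0..T} (Y (Suc n))" using Suc cont\<Gamma> by (simp add: Y)
      show "norm (Y (Suc n) t) \<le> R" if "t \<in> {0..T}" for t
        using near[OF that] order_trans[OF s[OF that] e_sum[OF that]] by blast
    qed
    have "norm (Y (Suc (Suc n)) t - Y (Suc n) t) \<le> \<eta> * e t (Suc n)" if t: "t \<in> {0..T}" for t
    proof -
      have "((\<lambda>r. \<eta> * (C * K * ((C * K * r) ^ n / fact n))) has_integral \<eta> * ((C * K * t) ^ Suc n / fact (Suc n))) {0..t}"
        using t by (intro has_integral_mult_right has_integral_power_fact) auto
      then have "((\<lambda>r. C * K * (\<eta> * e r n)) has_integral \<eta> * e t (Suc n)) {0..t}"
        by (simp add: e_def mult_ac)
      then show ?thesis
        unfolding Y(2)[of "Suc n"] Y(2)[of n]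
        using g Suc t by (intro diff\<Gamma>[where b = "\<lambda>r. \<eta> * e r n"]) (auto simp: Y)
    qed
    then show ?case using g s by blast
  qed
  have telescope: "Y n t = z t + (\<Sum>j<n. Y (Suc j) t - Y j t)" for n t
    using sum_lessThan_telescope[of "\<lambda>j. Y j t" n] by (simp add: Y(1))
  define y where "y t = z t + (\<Sum>j. Y (Suc j) t - Y j t)" for t
  have "uniform_limit {0..T} (\<lambda>n t. \<Sum>j<n. Y (Suc j) t - Y j t) (\<lambda>t. \<Sum>j. Y (Suc j) t - Y j t) sequentially"
  proof (rule Weierstrass_m_test)
    show "norm (Y (Suc j) t - Y j t) \<le> \<eta> * e T j" if "t \<in> {0..T}" for j t
    proof -
      have "norm (Y (Suc j) t - Y j t) \<le> \<eta> * e t j" using main that by blast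
      also have "\<dots> \<le> \<eta> * e T j"
        unfolding e_def using that C K \<eta> by (intro mult_left_mono divide_right_mono power_mono) (auto intro: mult_left_mono)
      finally show ?thesis .
    qed
    show "summable (\<lambda>j. \<eta> * e T j)" by (intro summable_mult sums_summable[OF e_sums])
  qed
  moreover have "dist (Y n t) (y t) = dist (\<Sum>j<n. Y (Suc j) t - Y j t) (\<Sum>j. Y (Suc j) t - Y j t)" for n t
    using telescope[of n t] by (simp only: y_def dist_norm add_diff_cancel_left)
  ultimately have ul: "uniform_limit {0..T} Y y sequentially"
    unfolding uniform_limit_iff by (simp only:)
  have lim: "(\<lambda>n. Y n t) \<longlonglongrightarrow> y t" if "t \<in> {0..T}" for t
    using tendsto_uniform_limitI[OF ul that] .
  have yz: "norm (y t - z t) \<le> \<eta> * exp (C * K * T)" if t: "t \<in> {0..T}" for t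
  proof (rule LIMSEQ_le_const2)
    show "(\<lambda>n. norm (Y n t - z t)) \<longlonglongrightarrow> norm (y t - z t)" by (intro tendsto_intros lim t)
    show "\<exists>N. \<forall>n\<ge>N. norm (Y n t - z t) \<le> \<eta> * exp (C * K * T)"
      using main e_sum[OF t] t by (meson order_trans)
  qed
  have cy: "continuous_on {0..T} y"
    by (rule uniform_limit_theorem[OF _ ul]) (use main in \<open>auto simp: good_def\<close>)
  then have gy: "good y" unfolding good_def using near yz by blast
  have "y t = \<Gamma> y t" if t: "t \<in> {0..T}" for t
  proof (rule LIMSEQ_unique)
    show "(\<lambda>n. Y (Suc n) t) \<longlonglongrightarrow> y t" by (rule LIMSEQ_Suc[OF lim[OF t]])
    show "(\<lambda>n. Y (Suc n) t) \<longlonglongrightarrow> \<Gamma> y t"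
    proof (rule metric_LIMSEQ_I)
      fix d :: real assume d: "d > 0"
      define d' where "d' = d / (2 * (C * K * T + 1))"
      have pos: "C * K * T + 1 > 0" using C K T by (simp add: add_nonneg_pos)
      then have d': "d' > 0" using d by (simp add: d'_def)
      have "\<forall>\<^sub>F n in sequentially. \<forall>t\<in>{0..T}. dist (Y n t) (y t) < d'"
        by (rule uniform_limitD[OF ul d'])
      then obtain M where M: "\<And>n t. n \<ge> M \<Longrightarrow> t \<in> {0..T} \<Longrightarrow> dist (Y n t) (y t) < d'"
        unfolding eventually_sequentially by blast
      have "dist (Y (Suc n) t) (\<Gamma> y t) < d" if "n \<ge> M" for n
      proof -
        have "norm (\<Gamma> (Y n) t - \<Gamma> y t) \<le> t * (C * K * d')"
        proof (rule diff\<Gamma>[where b = "\<lambda>_. d'"])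
          show "norm (Y n r - y r) \<le> d'" if "r \<in> {0..t}" for r
            using M[OF \<open>n \<ge> M\<close>, of r] that t by (simp add: dist_norm less_imp_le)
          show "((\<lambda>r. C * K * d') has_integral t * (C * K * d')) {0..t}"
            using has_integral_const_real[of "C * K * d'" 0 t] t by simp
        qed (use main gy t in auto)
        also have "\<dots> \<le> T * (C * K * d')" using t C K d' by (intro mult_right_mono) auto
        also have "\<dots> = (C * K * T) * d'" by simp
        also have "\<dots> < d"
        proof -
          have "c * (d / (2 * c)) = d / 2" if "c > 0" for c using that by simp
          from this[OF pos] have "(C * K * T + 1) * d' = d / 2" unfolding d'_def .
          then show ?thesis using d d' by (simp add: algebra_simps)
        qed
        finally show ?thesis by (simp add: Y dist_norm)
      qed
      then show "\<exists>M. \<forall>n\<ge>M. dist (Y (Suc n) t) (\<Gamma> y t) < d" by blast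
    qed
  qed
  then show ?thesis using cy yz unfolding \<Gamma>_def by blast
qed

subsection \<open>From paths in sequence space to mild solutions\<close>

context sobolev_exponent
begin

lemma linear_ev_fun: "linear (ev :: 'd hseq \<Rightarrow> _)"
  by (rule linearI; rule ext) (simp_all add: ev_add ev_scaleR scaleR_fun_def)

text \<open>\<open>ev\<close> is a linear isometry into \<open>sobolev s\<close>, so it carries the
  approximating simple functions of a Bochner integral over.\<close>

lemma has_sobolev_integral_ev:
  assumes int: "has_bochner_integral M G v" and F: "\<And>r. r \<in> space M \<Longrightarrow> F r = ev (G r)"
  shows "has_sobolev_integral s M F (ev v)"
  using int
proof cases
  case (1 S)
  have ev0: "ev 0 = (0 :: real ^ 'd \<Rightarrow> real)" by (rule linear_0[OF linear_ev_fun])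
  have diff: "ev x - ev y = ev (x - y)" for x y :: "'d hseq" using linear_diff[OF linear_ev_fun] by metis
  have nrm: "sobolev_norm s (F r - ev (S n r)) = norm (G r - S n r)" if "r \<in> space M" for r n
    using that by (simp only: F diff sobolev_norm_ev)
  have meas: "S n \<in> borel_measurable M" for n
    using 1(2)[of n] by (auto elim!: simple_bochner_integrable.cases intro: borel_measurable_simple_function)
  show ?thesis
    unfolding has_sobolev_integral_def
  proof (intro conjI exI[of _ "\<lambda>n r. ev (S n r)"] allI ev_in_sobolev)
    show "AE r in M. F r \<in> sobolev s" by (intro AE_I2) (simp add: F ev_in_sobolev)
    fix n
    show "Bochner_Integration.simple_bochner_integrable M (\<lambda>r. ev (S n r))"
      using simple_bochner_integrable_compose2[of "\<lambda>x y. ev x", OF ev0 1(2) 1(2)] .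
    show "(\<lambda>r. ev (S n r)) ` space M \<subseteq> sobolev s" using ev_in_sobolev by blast
    have "(\<lambda>r. norm (G r - S n r)) \<in> borel_measurable M"
      by (rule measurable_compose[OF borel_measurable_diff[OF 1(1) meas] borel_measurable_norm])
    then show "(\<lambda>r. sobolev_norm s (F r - ev (S n r))) \<in> borel_measurable M"
      using measurable_cong[of M "\<lambda>r. sobolev_norm s (F r - ev (S n r))" "\<lambda>r. norm (G r - S n r)" borel, OF nrm]
      by blast
  next
    have "(\<integral>\<^sup>+r. ennreal (sobolev_norm s (F r - ev (S n r))) \<partial>M) = (\<integral>\<^sup>+r. ennreal (norm (G r - S n r)) \<partial>M)" for n
      by (intro nn_integral_cong) (simp only: nrm)
    then show "(\<lambda>n. \<integral>\<^sup>+r. ennreal (sobolev_norm s (F r - ev (S n r))) \<partial>M) \<longlonglongrightarrow> 0"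
      using 1(3) by (simp only:)
    have "sobolev_norm s (Bochner_Integration.simple_bochner_integral M (\<lambda>r. ev (S n r)) - ev v) =
        norm (Bochner_Integration.simple_bochner_integral M (S n) - v)" for n
      by (simp only: simple_bochner_integral_linear[OF linear_ev_fun 1(2)] diff sobolev_norm_ev)
    then show "(\<lambda>n. sobolev_norm s (Bochner_Integration.simple_bochner_integral M (\<lambda>r. ev (S n r)) - ev v)) \<longlonglongrightarrow> 0"
      using 1(4) by (simp only: LIM_zero tendsto_norm_zero)
  qed
qed

end

subsection \<open>The control system\<close>

text \<open>The Bochner and the Henstock-Kurzweil integral are compared one coefficient at a time,
  where the values are complex numbers.\<close>

lemma has_bochner_integral_continuous_hseq:
  fixes f :: "real \<Rightarrow> 'd::finite hseq"
  assumes "continuous_on {a..b} f"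
  shows "has_bochner_integral lborel (\<lambda>r. indicator {a..b} r *\<^sub>R f r) (integral {a..b} f)"
proof -
  have int: "integrable lborel (\<lambda>r. indicator {a..b} r *\<^sub>R f r)"
    using borel_integrable_atLeastAtMost'[OF assms] by (simp add: set_integrable_def)
  have "(LINT r|lborel. indicator {a..b} r *\<^sub>R f r) = integral {a..b} f"
  proof (rule coef_eqI)
    fix k
    have c: "continuous_on {a..b} (\<lambda>r. coef (f r) k)"
      using bounded_linear.continuous_on[OF bounded_linear_coef assms] .
    have "coef (LINT r|lborel. indicator {a..b} r *\<^sub>R f r) k = (LINT r|lborel. coef (indicator {a..b} r *\<^sub>R f r) k)"
      by (rule integral_bounded_linear[OF bounded_linear_coef int, symmetric])
    also have "\<dots> = (LINT r:{a..b}|lborel. coef (f r) k)"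
      by (simp add: coef_scaleR set_lebesgue_integral_def)
    also have "\<dots> = integral {a..b} (\<lambda>r. coef (f r) k)"
      by (intro set_borel_integral_eq_integral borel_integrable_atLeastAtMost' c)
    also have "\<dots> = coef (integral {a..b} f) k"
      using integral_linear[OF integrable_continuous_real[OF assms] bounded_linear_coef, of k] by (simp add: o_def)
    finally show "coef (LINT r|lborel. indicator {a..b} r *\<^sub>R f r) k = coef (integral {a..b} f) k" .
  qed
  then show ?thesis using int by (simp add: has_bochner_integral_iff)
qed

lemma continuous_on_heatX:
  "continuous_on ({0..T} \<times> UNIV) (\<lambda>(t, x). heatX t (x :: 'd::finite hseq))"
proof -
  have "continuous_on ({0..T} \<times> UNIV) (\<lambda>p. heatX (max 0 (fst p)) (snd p :: 'd hseq))"
    unfolding continuous_on_def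
  proof (intro ballI heatX_tendsto)
    fix p :: "real \<times> 'd hseq"
    assume "p \<in> {0..T} \<times> UNIV"
    show "((\<lambda>p. max 0 (fst p)) \<longlongrightarrow> max 0 (fst p)) (at p within {0..T} \<times> UNIV)"
      "((\<lambda>p. snd p) \<longlongrightarrow> snd p) (at p within {0..T} \<times> UNIV)"
      by (intro tendsto_intros)+
  qed auto
  then show ?thesis by (rule continuous_on_eq) auto
qed

text \<open>By compactness, strong continuity at time 0 is uniform along the curve
  \<open>g\<close>.\<close>

lemma heatX_near_identity:
  fixes g :: "real \<Rightarrow> 'd::finite hseq"
  assumes g: "continuous_on {0..1} g" and e: "e > 0"
  obtains \<delta> where "\<delta> > 0" "\<And>t \<sigma>. 0 \<le> t \<Longrightarrow> t \<le> \<delta> \<Longrightarrow> \<sigma> \<in> {0..1} \<Longrightarrow> norm (heatX t (g \<sigma>) - g \<sigma>) \<le> e"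
proof -
  have "continuous_on ({0..1 :: real} \<times> {0..1 :: real}) (\<lambda>p. (fst p, g (snd p)))"
    by (intro continuous_intros continuous_on_compose2[OF g]) auto
  from continuous_on_compose2[OF continuous_on_heatX[of 1] this]
  have "continuous_on ({0..1} \<times> {0..1}) (\<lambda>p. heatX (fst p) (g (snd p)))"
    by (auto simp: case_prod_beta image_subset_iff)
  from compact_uniformly_continuous[OF this] have "uniformly_continuous_on ({0..1} \<times> {0..1}) (\<lambda>p. heatX (fst p) (g (snd p)))"
    by (simp add: compact_Times)
  then obtain d where d: "d > 0" "\<And>p p'. p \<in> {0..1} \<times> {0..1} \<Longrightarrow> p' \<in> {0..1} \<times> {0..1} \<Longrightarrow> dist p' p < d
      \<Longrightarrow> dist (heatX (fst p') (g (snd p'))) (heatX (fst p) (g (snd p))) < e"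
    using e unfolding uniformly_continuous_on_def by metis
  show thesis
  proof (rule that[of "min 1 (d / 2)"])
    fix t \<sigma> :: real assume t: "0 \<le> t" "t \<le> min 1 (d / 2)" and \<sigma>: "\<sigma> \<in> {0..1}"
    have "dist (t, \<sigma>) (0, \<sigma>) < d" using t d(1) by (simp add: dist_Pair_Pair)
    then show "norm (heatX t (g \<sigma>) - g \<sigma>) \<le> e"
      using d(2)[of "(0, \<sigma>)" "(t, \<sigma>)"] t \<sigma> by (simp add: dist_norm)
  qed (use d(1) in simp)
qed

locale control_system = sobolev_exponent s D for s :: nat and D :: "'d::finite itself" +
  fixes q p :: nat and \<kappa> :: real and Q :: "nat \<Rightarrow> real ^ 'd \<Rightarrow> real"
  assumes Q: "\<forall>j\<in>{1..q}. periodic (Q j) \<and> smooth (Q j)"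
    and one_sat: "(\<lambda>x. 1) \<in> saturation Q q 0"
begin

definition pot :: "(nat \<Rightarrow> real) \<Rightarrow> 'd hseq" where
  "pot c = (\<Sum>j\<in>{1..q}. c j *\<^sub>R emb (Q j))"

definition nl :: "'d hseq \<Rightarrow> 'd hseq \<Rightarrow> 'd hseq" where
  "nl v x = mult v x - \<kappa> *\<^sub>R powX x (p + 1)"

text \<open>Bounded Borel functions on the whole line, since these are stable under shifts and
  concatenation; square integrability follows in \<open>admissible_L2_on\<close>.\<close>

definition admissible :: "(nat \<Rightarrow> real \<Rightarrow> real) \<Rightarrow> bool" where
  "admissible u \<longleftrightarrow> (\<forall>j. u j \<in> borel_measurable borel \<and> bounded (range (u j)))"

text \<open>Integrating over \<open>lborel\<close> with an indicator lets integrals over adjacent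
  intervals add and translate when two solutions are joined.\<close>

definition mild :: "real \<Rightarrow> (nat \<Rightarrow> real \<Rightarrow> real) \<Rightarrow> 'd hseq \<Rightarrow> (real \<Rightarrow> 'd hseq) \<Rightarrow> bool" where
  "mild T u a \<psi> \<longleftrightarrow> continuous_on {0..T} \<psi> \<and>
     (\<forall>t\<in>{0..T}. has_bochner_integral lborel
        (\<lambda>r. indicator {0..t} r *\<^sub>R heatX (t - r) (nl (pot (\<lambda>j. u j r)) (\<psi> r))) (\<psi> t - heatX t a))"

definition reach :: "real \<Rightarrow> 'd hseq \<Rightarrow> 'd hseq \<Rightarrow> bool" where
  "reach T a b \<longleftrightarrow> 0 < T \<and> (\<exists>u \<psi>. admissible u \<and> mild T u a \<psi> \<and> \<psi> T = b)"

lemma Q_in_sobolev: "j \<in> {1..q} \<Longrightarrow> Q j \<in> sobolev s"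
  using smooth_in_smooth_space[of "Q j"] Q s_gt by (simp add: smooth_space_def)

lemma ev_pot: "ev (pot c) x = (\<Sum>j\<in>{1..q}. c j * Q j x)"
  unfolding pot_def ev_sum ev_scaleR by (intro sum.cong) (simp_all add: ev_emb Q_in_sobolev del: One_nat_def)

text \<open>\<open>K\<close> is independent of the potential \<open>v\<close>: in
  \<open>fast_steer_pot\<close> the potential has size \<open>1 / \<delta>\<close>, with
  \<open>\<delta>\<close> chosen only after \<open>K\<close>.\<close>

lemma nl_Lipschitz:
  assumes "R \<ge> 0"
  obtains K where "K \<ge> 0" "\<And>x. norm x \<le> R \<Longrightarrow> norm (\<kappa> *\<^sub>R powX x (p + 1)) \<le> K"
    "\<And>x y. norm x \<le> R \<Longrightarrow> norm y \<le> R \<Longrightarrow> norm (\<kappa> *\<^sub>R powX x (p + 1) - \<kappa> *\<^sub>R powX y (p + 1)) \<le> K * norm (x - y)"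
    "\<And>v x y. norm x \<le> R \<Longrightarrow> norm y \<le> R \<Longrightarrow> norm (nl v x - nl v y) \<le> (mult_const * norm v + K) * norm (x - y)"
proof -
  obtain K where K: "K \<ge> 0" "\<And>x. norm x \<le> R \<Longrightarrow> norm (powX x (p + 1)) \<le> K"
    "\<And>x y. norm x \<le> R \<Longrightarrow> norm y \<le> R \<Longrightarrow> norm (powX x (p + 1) - powX y (p + 1)) \<le> K * norm (x - y)"
    using powX_bounded_Lipschitz[OF assms, of "p + 1"] by blast
  show thesis
  proof (rule that[of "\<bar>\<kappa>\<bar> * K"])
    show "norm (\<kappa> *\<^sub>R powX x (p + 1)) \<le> \<bar>\<kappa>\<bar> * K" if "norm x \<le> R" for x
      using K(2)[OF that] by (simp add: mult_left_mono del: powX.simps)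
    show L: "norm (\<kappa> *\<^sub>R powX x (p + 1) - \<kappa> *\<^sub>R powX y (p + 1)) \<le> \<bar>\<kappa>\<bar> * K * norm (x - y)"
      if "norm x \<le> R" "norm y \<le> R" for x y
      using mult_left_mono[OF K(3)[OF that], of "\<bar>\<kappa>\<bar>"] by (simp only: scaleR_diff_right[symmetric] norm_scaleR mult.assoc)
    show "norm (nl v x - nl v y) \<le> (mult_const * norm v + \<bar>\<kappa>\<bar> * K) * norm (x - y)"
      if "norm x \<le> R" "norm y \<le> R" for v x y
    proof -
      have "nl v x - nl v y = mult v (x - y) - (\<kappa> *\<^sub>R powX x (p + 1) - \<kappa> *\<^sub>R powX y (p + 1))"
        by (simp add: nl_def bounded_bilinear.diff_right[OF bounded_bilinear_mult])
      also have "norm \<dots> \<le> norm (mult v (x - y)) + norm (\<kappa> *\<^sub>R powX x (p + 1) - \<kappa> *\<^sub>R powX y (p + 1))"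
        by (rule norm_triangle_ineq4)
      also have "\<dots> \<le> mult_const * norm v * norm (x - y) + \<bar>\<kappa>\<bar> * K * norm (x - y)"
        by (intro add_mono norm_mult_le L that)
      finally show ?thesis by (simp add: ring_distribs)
    qed
  qed (use K(1) in simp)
qed

lemma continuous_on_nl:
  assumes "continuous_on S x"
  shows "continuous_on S (\<lambda>r. nl v (x r))"
proof -
  have "continuous_on S (\<lambda>r. powX (x r) n)" for n
    by (induction n) (auto intro!: bounded_bilinear.continuous_on[OF bounded_bilinear_mult] assms continuous_intros)
  then show ?thesis
    unfolding nl_def
    by (intro continuous_intros bounded_linear.continuous_on[OF bounded_linear_mult_right] assms)
qed

lemma reach_const_control:
  assumes T: "T > 0" and y: "continuous_on {0..T} y"
    and eq: "\<And>t. t \<in> {0..T} \<Longrightarrow> y t = heatX t a + integral {0..t} (\<lambda>r. heatX (t - r) (nl (pot c) (y r)))"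
  shows "reach T a (y T)"
  unfolding reach_def
proof (intro conjI exI)
  show "admissible (\<lambda>j r. c j)" by (simp add: admissible_def)
  show "mild T (\<lambda>j r. c j) a y"
    unfolding mild_def
  proof (intro conjI ballI y)
    fix t assume t: "t \<in> {0..T}"
    have "continuous_on {0..t} (\<lambda>r. heatX (t - r) (nl (pot c) (y r)))"
      by (rule continuous_on_convolution(2)[OF continuous_on_heatX continuous_on_nl[OF y] t])
    from has_bochner_integral_continuous_hseq[OF this]
    show "has_bochner_integral lborel (\<lambda>r. indicator {0..t} r *\<^sub>R heatX (t - r) (nl (pot c) (y r))) (y t - heatX t a)"
      using eq[OF t] by simp
  qed
qed (use T in auto)

lemma mild_initial:
  assumes "mild T u a \<psi>" "T \<ge> 0"
  shows "\<psi> 0 = a"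
proof -
  have "has_bochner_integral lborel (\<lambda>r. indicator {0..0} r *\<^sub>R heatX (0 - r) (nl (pot (\<lambda>j. u j r)) (\<psi> r))) (\<psi> 0 - heatX 0 a)"
    using assms unfolding mild_def by (elim conjE ballE[of _ _ 0]) auto
  then have "has_bochner_integral lborel (\<lambda>r :: real. 0 :: 'd hseq) (\<psi> 0 - heatX 0 a)"
    by (rule has_bochner_integral_discrete_difference[where X = "{0}", THEN iffD1, rotated -1])
       (auto simp: indicator_def)
  then show ?thesis by (simp add: has_bochner_integral_iff)
qed

lemma reach_trans:
  assumes "reach S a b" "reach T b c"
  shows "reach (S + T) a c"
proof -
  obtain u \<psi> where u: "S > 0" "admissible u" "mild S u a \<psi>" "\<psi> S = b"
    using assms(1) unfolding reach_def by blast
  obtain v \<theta> where v: "T > 0" "admissible v" "mild T v b \<theta>" "\<theta> T = c"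
    using assms(2) unfolding reach_def by blast
  have \<theta>0: "\<theta> 0 = b" using mild_initial[OF v(3)] v(1) by simp
  define w where "w j r = (if r \<le> S then u j r else v j (r - S))" for j r
  define \<xi> where "\<xi> r = (if r \<le> S then \<psi> r else \<theta> (r - S))" for r
  have "admissible w"
    unfolding admissible_def
  proof (intro allI conjI)
    fix j
    have [measurable]: "u j \<in> borel_measurable borel" "v j \<in> borel_measurable borel"
      using u(2) v(2) by (auto simp: admissible_def)
    show "w j \<in> borel_measurable borel" unfolding w_def by measurable
    have "range (w j) \<subseteq> range (u j) \<union> range (v j)" by (auto simp: w_def)
    moreover have "bounded (range (u j) \<union> range (v j))" using u(2) v(2) by (auto simp: admissible_def)
    ultimately show "bounded (range (w j))" by (rule bounded_subset[rotated])
  qed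
  moreover have "mild (S + T) w a \<xi>"
    unfolding mild_def
  proof (intro conjI ballI)
    have "continuous_on ({0..S} \<union> {S..S + T}) \<xi>"
      unfolding \<xi>_def
    proof (rule continuous_on_cases)
      show "continuous_on {0..S} \<psi>" using u(3) by (simp add: mild_def)
      have "continuous_on {0..T} \<theta>" using v(3) by (simp add: mild_def)
      then show "continuous_on {S..S + T} (\<lambda>r. \<theta> (r - S))"
        by (rule continuous_on_compose2) (auto intro!: continuous_intros)
    qed (auto simp: \<theta>0 u(4))
    moreover have "{0..S} \<union> {S..S + T} = {0..S + T}" using u(1) v(1) by auto
    ultimately show "continuous_on {0..S + T} \<xi>" by simp
    fix t assume t: "t \<in> {0..S + T}"
    let ?F = "\<lambda>t r. heatX (t - r) (nl (pot (\<lambda>j. w j r)) (\<xi> r))"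
    have one: "?F t r = heatX (t - r) (nl (pot (\<lambda>j. u j r)) (\<psi> r))" if "r \<le> S" for t r
      using that by (simp add: w_def \<xi>_def)
    show "has_bochner_integral lborel (\<lambda>r. indicator {0..t} r *\<^sub>R ?F t r) (\<xi> t - heatX t a)"
    proof (cases "t \<le> S")
      case True
      have "has_bochner_integral lborel (\<lambda>r. indicator {0..t} r *\<^sub>R heatX (t - r) (nl (pot (\<lambda>j. u j r)) (\<psi> r))) (\<psi> t - heatX t a)"
        using u(3) True t unfolding mild_def by auto
      moreover have "indicator {0..t} r *\<^sub>R ?F t r = indicator {0..t} r *\<^sub>R heatX (t - r) (nl (pot (\<lambda>j. u j r)) (\<psi> r))" for r
        using True one[of r t] by (auto simp: indicator_def)
      moreover have "\<xi> t = \<psi> t" using True by (simp add: \<xi>_def)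
      ultimately show ?thesis by (simp only:)
    next
      case False
      \<comment> \<open>The heat flow over the remaining time \<open>t - S\<close> carries the
        Duhamel formula at time \<open>S\<close> to time \<open>t\<close>.\<close>
      have 1: "has_bochner_integral lborel (\<lambda>r. indicator {0..S} r *\<^sub>R ?F t r) (heatX (t - S) (b - heatX S a))"
      proof -
        have "has_bochner_integral lborel (\<lambda>r. indicator {0..S} r *\<^sub>R heatX (S - r) (nl (pot (\<lambda>j. u j r)) (\<psi> r))) (b - heatX S a)"
          using u(1,3,4) unfolding mild_def by auto
        from has_bochner_integral_bounded_linear[OF bounded_linear_heatX this, of "t - S"]
        have "has_bochner_integral lborel (\<lambda>r. heatX (t - S) (indicator {0..S} r *\<^sub>R heatX (S - r) (nl (pot (\<lambda>j. u j r)) (\<psi> r))))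
            (heatX (t - S) (b - heatX S a))"
          using False by simp
        moreover have "heatX (t - S) (indicator {0..S} r *\<^sub>R heatX (S - r) (nl (pot (\<lambda>j. u j r)) (\<psi> r))) = indicator {0..S} r *\<^sub>R ?F t r" for r
        proof (cases "r \<in> {0..S}")
          case True
          then show ?thesis using False one[of r t] by (simp add: heatX_heatX)
        next
          case r: False
          have "heatX (t - S) 0 = 0"
            using False by (intro linear_0 bounded_linear.linear bounded_linear_heatX) simp
          then show ?thesis using r by simp
        qed
        ultimately show ?thesis by simp
      qed
      \<comment> \<open>The Duhamel formula of the second piece, translated by \<open>S\<close>;
        removing the single point \<open>S\<close> does not change the integral.\<close>
      have 2: "has_bochner_integral lborel (\<lambda>r. indicator {S<..t} r *\<^sub>R ?F t r) (\<theta> (t - S) - heatX (t - S) b)"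
      proof -
        have "has_bochner_integral lborel (\<lambda>r. indicator {0..t - S} r *\<^sub>R heatX (t - S - r) (nl (pot (\<lambda>j. v j r)) (\<theta> r))) (\<theta> (t - S) - heatX (t - S) b)"
          using v(3) False t unfolding mild_def by auto
        then have "has_bochner_integral lborel (\<lambda>r. indicator {0..t - S} (r - S) *\<^sub>R heatX (t - r) (nl (pot (\<lambda>j. v j (r - S))) (\<theta> (r - S)))) (\<theta> (t - S) - heatX (t - S) b)"
          by (subst (asm) lborel_has_bochner_integral_real_affine_iff[of 1 _ _ "- S"]) simp_all
        then show ?thesis
          by (rule has_bochner_integral_discrete_difference[where X = "{S}", THEN iffD1, rotated -1])
             (auto simp: indicator_def w_def \<xi>_def)
      qed
      have "has_bochner_integral lborel (\<lambda>r. indicator {0..S} r *\<^sub>R ?F t r + indicator {S<..t} r *\<^sub>R ?F t r)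
          (heatX (t - S) (b - heatX S a) + (\<theta> (t - S) - heatX (t - S) b))"
        by (rule has_bochner_integral_add[OF 1 2])
      moreover have "indicator {0..S} r *\<^sub>R ?F t r + indicator {S<..t} r *\<^sub>R ?F t r = indicator {0..t} r *\<^sub>R ?F t r" for r
        using False u(1) by (auto simp: indicator_def)
      moreover have "heatX (t - S) (b - heatX S a) + (\<theta> (t - S) - heatX (t - S) b) = \<xi> t - heatX t a"
      proof -
        have "linear (heatX (t - S) :: 'd hseq \<Rightarrow> _)" using False by (intro bounded_linear.linear bounded_linear_heatX) simp
        then show ?thesis using False u(1) by (simp add: linear_diff heatX_heatX \<xi>_def)
      qed
      ultimately show ?thesis by simp
    qed
  qed
  moreover have "\<xi> (S + T) = c" using u(1) v(1,4) by (simp add: \<xi>_def)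
  ultimately show ?thesis using u(1) v(1) unfolding reach_def by auto
qed

lemma reach_near_approximate_solution:
  assumes T: "T > 0" and z: "continuous_on {0..T} z" "\<And>t. t \<in> {0..T} \<Longrightarrow> norm (z t) + 1 \<le> R"
    and K: "K \<ge> 0" "\<And>x y. norm x \<le> R \<Longrightarrow> norm y \<le> R \<Longrightarrow> norm (nl (pot c) x - nl (pot c) y) \<le> K * norm (x - y)"
    and res: "\<And>t. t \<in> {0..T} \<Longrightarrow> norm (heatX t a + integral {0..t} (\<lambda>r. heatX (t - r) (nl (pot c) (z r))) - z t) \<le> \<eta>"
    and small: "\<eta> * exp (K * T) \<le> 1"
  shows "\<exists>b. reach T a b \<and> norm (b - z T) \<le> \<eta> * exp (K * T)"
proof -
  have \<eta>: "\<eta> \<ge> 0" using res[of 0] T by (intro order_trans[OF norm_ge_zero]) auto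
  have "\<exists>y. continuous_on {0..T} y \<and>
      (\<forall>t\<in>{0..T}. y t = heatX t a + integral {0..t} (\<lambda>r. heatX (t - r) (nl (pot c) (y r)))) \<and>
      (\<forall>t\<in>{0..T}. norm (y t - z t) \<le> \<eta> * exp (1 * K * T))"
    using T z K res small \<eta>
    by (intro Picard_near_approximate_solution[where R = R])
       (auto simp: norm_heatX_le continuous_on_heatX bounded_linear.linear[OF bounded_linear_heatX])
  then obtain y where y: "continuous_on {0..T} y"
    "\<And>t. t \<in> {0..T} \<Longrightarrow> y t = heatX t a + integral {0..t} (\<lambda>r. heatX (t - r) (nl (pot c) (y r)))"
    "\<And>t. t \<in> {0..T} \<Longrightarrow> norm (y t - z t) \<le> \<eta> * exp (K * T)"
    by auto
  show ?thesis
    using reach_const_control[OF T y(1,2)] y(3)[of T] T by (intro exI[of _ "y T"]) auto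
qed

text \<open>A solution from \<open>a\<close> is an approximate solution from \<open>a'\<close> with
  residual \<open>heatX t (a' - a)\<close>, so a true solution from \<open>a'\<close> exists next to
  it. The radius \<open>h\<close> serves all durations up to \<open>T\<close>.\<close>

lemma solution_stable:
  assumes T: "T > 0" and z: "continuous_on {0..T} z"
    and eq: "\<And>t. t \<in> {0..T} \<Longrightarrow> z t = heatX t a + integral {0..t} (\<lambda>r. heatX (t - r) (nl (pot c) (z r)))"
    and \<epsilon>: "\<epsilon> > 0"
  obtains h where "h > 0" "\<And>T' a'. 0 < T' \<Longrightarrow> T' \<le> T \<Longrightarrow> norm (a' - a) < h \<Longrightarrow> \<exists>b. reach T' a' b \<and> norm (b - z T') < \<epsilon>"
proof -
  have "bounded (z ` {0..T})" by (intro compact_imp_bounded compact_continuous_image z compact_Icc)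
  then obtain R where R: "\<And>t. t \<in> {0..T} \<Longrightarrow> norm (z t) \<le> R" unfolding bounded_iff by blast
  have "R \<ge> 0" using order_trans[OF norm_ge_zero R[of 0]] T by simp
  then obtain K0 where K0: "K0 \<ge> 0"
    "\<And>v x y. norm x \<le> R + 1 \<Longrightarrow> norm y \<le> R + 1 \<Longrightarrow> norm (nl v x - nl v y) \<le> (mult_const * norm v + K0) * norm (x - y)"
    using nl_Lipschitz[of "R + 1"] by (metis add_nonneg_nonneg zero_le_one)
  define K where "K = mult_const * norm (pot c) + K0"
  have K: "K \<ge> 0" using K0(1) mult_const_nonneg by (simp add: K_def)
  define h where "h = min 1 (\<epsilon> / 2) / exp (K * T)"
  show thesis
  proof (rule that[of h])
    show "h > 0" using \<epsilon> by (simp add: h_def)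
    fix T' a' assume T': "0 < T'" "T' \<le> T" and a': "norm (a' - a) < h"
    have ex: "norm (a' - a) * exp (K * T') \<le> min 1 (\<epsilon> / 2)"
    proof -
      have "norm (a' - a) * exp (K * T') \<le> h * exp (K * T)"
        using a' T' K \<epsilon> by (intro mult_mono) (auto simp: h_def mult_left_mono)
      then show ?thesis by (simp add: h_def)
    qed
    have "\<exists>b. reach T' a' b \<and> norm (b - z T') \<le> norm (a' - a) * exp (K * T')"
    proof (rule reach_near_approximate_solution[OF T'(1)])
      show "continuous_on {0..T'} z" using continuous_on_subset[OF z] T' by auto
      show "norm (z t) + 1 \<le> R + 1" if "t \<in> {0..T'}" for t using R that T' by auto
      show "norm (nl (pot c) x - nl (pot c) y) \<le> K * norm (x - y)" if "norm x \<le> R + 1" "norm y \<le> R + 1" for x y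
        unfolding K_def using that by (rule K0(2))
      show "norm (heatX t a' + integral {0..t} (\<lambda>r. heatX (t - r) (nl (pot c) (z r))) - z t) \<le> norm (a' - a)"
        if t: "t \<in> {0..T'}" for t
      proof -
        have tT: "t \<in> {0..T}" and t0: "t \<ge> 0" using t T' by auto
        have "heatX t a' + integral {0..t} (\<lambda>r. heatX (t - r) (nl (pot c) (z r))) - z t = heatX t (a' - a)"
          using eq[OF tT] by (simp add: linear_diff[OF bounded_linear.linear[OF bounded_linear_heatX[OF t0]]])
        then show ?thesis using norm_heatX_le[OF t0, of "a' - a"] by simp
      qed
    qed (use K ex in auto)
    then show "\<exists>b. reach T' a' b \<and> norm (b - z T') < \<epsilon>"
      using ex \<epsilon> by force
  qed
qed

subsection \<open>Approximate steering\<close>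

text \<open>The time \<open>\<tau>\<close> is fixed before \<open>a'\<close>, while the control may
  depend on \<open>a'\<close>. In \<open>reach_via_const\<close> the duration of the last leg is
  thus known before its starting point.\<close>

definition steer :: "real \<Rightarrow> 'd hseq \<Rightarrow> 'd hseq \<Rightarrow> bool" where
  "steer T a b \<longleftrightarrow> (\<forall>\<epsilon>>0. \<exists>h>0. \<exists>\<tau>. 0 < \<tau> \<and> \<tau> \<le> T \<and>
     (\<forall>a'. norm (a' - a) < h \<longrightarrow> (\<exists>b'. reach \<tau> a' b' \<and> norm (b' - b) < \<epsilon>)))"

definition fast_steer :: "'d hseq \<Rightarrow> 'd hseq \<Rightarrow> bool" where
  "fast_steer a b \<longleftrightarrow> (\<forall>T>0. steer T a b)"

lemma steerI:
  assumes "\<And>\<epsilon>. \<epsilon> > 0 \<Longrightarrow> \<exists>h \<tau>. h > 0 \<and> 0 < \<tau> \<and> \<tau> \<le> T \<and>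
    (\<forall>a'. norm (a' - a) < h \<longrightarrow> (\<exists>b'. reach \<tau> a' b' \<and> norm (b' - b) < \<epsilon>))"
  shows "steer T a b"
  unfolding steer_def using assms by blast

lemma steerE:
  assumes "steer T a b" "\<epsilon> > 0"
  obtains h \<tau> where "h > 0" "0 < \<tau>" "\<tau> \<le> T"
    "\<And>a'. norm (a' - a) < h \<Longrightarrow> \<exists>b'. reach \<tau> a' b' \<and> norm (b' - b) < \<epsilon>"
  using assms unfolding steer_def by metis

lemma steer_mono: "steer S a b \<Longrightarrow> S \<le> T \<Longrightarrow> steer T a b"
  unfolding steer_def by (meson order_trans)

lemma steer_trans:
  assumes "steer S a b" "steer T b c"
  shows "steer (S + T) a c"
proof (rule steerI)
  fix \<epsilon> :: real assume "\<epsilon> > 0"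
  then obtain h \<tau> where h: "h > 0" "0 < \<tau>" "\<tau> \<le> T"
    "\<And>b'. norm (b' - b) < h \<Longrightarrow> \<exists>c'. reach \<tau> b' c' \<and> norm (c' - c) < \<epsilon>"
    using steerE[OF assms(2)] by blast
  obtain k \<sigma> where k: "k > 0" "0 < \<sigma>" "\<sigma> \<le> S"
    "\<And>a'. norm (a' - a) < k \<Longrightarrow> \<exists>b'. reach \<sigma> a' b' \<and> norm (b' - b) < h"
    using steerE[OF assms(1) h(1)] by blast
  have "\<exists>c'. reach (\<sigma> + \<tau>) a' c' \<and> norm (c' - c) < \<epsilon>" if a': "norm (a' - a) < k" for a'
    using k(4)[OF a'] h(4) reach_trans by blast
  moreover have "0 < \<sigma> + \<tau>" "\<sigma> + \<tau> \<le> S + T" using h(2,3) k(2,3) by auto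
  ultimately show "\<exists>h \<tau>. h > 0 \<and> 0 < \<tau> \<and> \<tau> \<le> S + T \<and>
      (\<forall>a'. norm (a' - a) < h \<longrightarrow> (\<exists>b'. reach \<tau> a' b' \<and> norm (b' - c) < \<epsilon>))"
    using k(1) by blast
qed

lemma fast_steer_trans:
  assumes "fast_steer a b" "fast_steer b c"
  shows "fast_steer a c"
  unfolding fast_steer_def
proof (intro allI impI)
  fix T :: real assume "T > 0"
  then have "steer (T / 2 + T / 2) a c"
    using assms unfolding fast_steer_def by (intro steer_trans[of _ _ b]) auto
  then show "steer T a c" by simp
qed

text \<open>Both limits of the argument, \<open>\<epsilon> \<rightarrow> 0\<close> in the
  conjugation and the density of the saturation spaces, are taken on targets by this
  closedness.\<close>

lemma fast_steer_limit:
  assumes "\<And>T \<epsilon>. T > 0 \<Longrightarrow> \<epsilon> > 0 \<Longrightarrow> \<exists>b'. norm (b' - b) < \<epsilon> \<and> steer T a b'"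
  shows "fast_steer a b"
  unfolding fast_steer_def
proof (intro allI impI steerI)
  fix T \<epsilon> :: real assume "T > 0" "\<epsilon> > 0"
  then obtain b' where b': "norm (b' - b) < \<epsilon> / 2" "steer T a b'" using assms[of T "\<epsilon> / 2"] by auto
  obtain h \<tau> where h: "h > 0" "0 < \<tau>" "\<tau> \<le> T"
    "\<And>a'. norm (a' - a) < h \<Longrightarrow> \<exists>c. reach \<tau> a' c \<and> norm (c - b') < \<epsilon> / 2"
    using steerE[OF b'(2), of "\<epsilon> / 2"] \<open>\<epsilon> > 0\<close> by auto
  have "norm (c - b) < \<epsilon>" if "norm (c - b') < \<epsilon> / 2" for c
    using norm_triangle_ineq[of "c - b'" "b' - b"] that b'(1) by simp
  then show "\<exists>h \<tau>. h > 0 \<and> 0 < \<tau> \<and> \<tau> \<le> T \<and>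
      (\<forall>a'. norm (a' - a) < h \<longrightarrow> (\<exists>b'. reach \<tau> a' b' \<and> norm (b' - b) < \<epsilon>))"
    using h by blast
qed

lemma continuous_on_expX_scaleR: "continuous_on S (\<lambda>r. expX (r *\<^sub>R v) y)"
  unfolding continuous_on_def by (auto intro!: expX_tendsto tendsto_intros)

text \<open>\<open>expX (r *\<^sub>R v) y\<close> is the evolution driven by the potential alone,
  without heat flow and nonlinearity; at each point it is a scalar exponential.\<close>

lemma integral_mult_expX:
  assumes "t \<ge> 0"
  shows "integral {0..t} (\<lambda>r. mult v (expX (r *\<^sub>R v) y)) = expX (t *\<^sub>R v) y - y"
proof -
  have c: "continuous_on {0..t} (\<lambda>r. mult v (expX (r *\<^sub>R v) y))"
    by (intro bounded_linear.continuous_on[OF bounded_linear_mult_right] continuous_on_expX_scaleR)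
  show "integral {0..t} (\<lambda>r. mult v (expX (r *\<^sub>R v) y)) = expX (t *\<^sub>R v) y - y"
  proof (rule ev_eqI)
    fix x
    have "ev (integral {0..t} (\<lambda>r. mult v (expX (r *\<^sub>R v) y))) x = integral {0..t} (\<lambda>r. ev (mult v (expX (r *\<^sub>R v) y)) x)"
      using integral_linear[OF integrable_continuous_real[OF c] bounded_linear_ev, of x] by (simp add: o_def)
    also have "\<dots> = integral {0..t} (\<lambda>r. ev v x * (exp (r * ev v x) * ev y x))"
      by (simp add: ev_mult ev_expX ev_scaleR)
    also have "\<dots> = exp (t * ev v x) * ev y x - exp (0 * ev v x) * ev y x"
    proof (intro integral_unique fundamental_theorem_of_calculus assms)
      fix r
      show "((\<lambda>r. exp (r * ev v x) * ev y x) has_vector_derivative ev v x * (exp (r * ev v x) * ev y x)) (at r within {0..t})"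
        unfolding has_real_derivative_iff_has_vector_derivative[symmetric]
        by (rule derivative_eq_intros refl | simp)+
    qed
    finally show "ev (integral {0..t} (\<lambda>r. mult v (expX (r *\<^sub>R v) y))) x = ev (expX (t *\<^sub>R v) y - y) x"
      by (simp add: ev_diff ev_expX ev_scaleR)
  qed
qed

text \<open>A control of size \<open>1 / \<delta>\<close> acting for time \<open>\<delta>\<close> dominates both the heat flow and the nonlinearity.\<close>

lemma fast_steer_pot: "fast_steer \<psi> (expX (pot c) \<psi>)"
  unfolding fast_steer_def
proof (intro allI impI steerI)
  fix T \<epsilon> :: real assume T: "T > 0" and \<epsilon>: "\<epsilon> > 0"
  define F where "F = mult_const * norm (pot c)"
  define R where "R = exp F * norm \<psi> + 1"
  have F: "F \<ge> 0" using mult_const_nonneg by (simp add: F_def)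
  have "R \<ge> 0" by (simp add: R_def)
  then obtain K0 where K0: "K0 \<ge> 0" "\<And>x. norm x \<le> R \<Longrightarrow> norm (\<kappa> *\<^sub>R powX x (p + 1)) \<le> K0"
    "\<And>v x y. norm x \<le> R \<Longrightarrow> norm y \<le> R \<Longrightarrow> norm (nl v x - nl v y) \<le> (mult_const * norm v + K0) * norm (x - y)"
    using nl_Lipschitz[of R] by metis
  define E where "E = exp (F + K0)"
  \<comment> \<open>Four errors of size \<open>e\<close> occur: the displaced initial state, the
    heat flow on \<open>\<psi>\<close>, the heat flow on the control term, and the nonlinearity. The
    Picard factor is at most \<open>E\<close>.\<close>
  define e where "e = min 1 (\<epsilon> / 2) / (4 * E)"
  have e: "e > 0" using \<epsilon> by (simp add: e_def E_def)
  define w where "w \<sigma> = expX (\<sigma> *\<^sub>R pot c) \<psi>" for \<sigma>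
  have cw: "continuous_on S w" for S unfolding w_def by (rule continuous_on_expX_scaleR)
  obtain \<delta>1 where \<delta>1: "\<delta>1 > 0" "\<And>t \<sigma>. 0 \<le> t \<Longrightarrow> t \<le> \<delta>1 \<Longrightarrow> \<sigma> \<in> {0..1 :: real} \<Longrightarrow> norm (heatX t \<psi> - \<psi>) \<le> e"
    using heatX_near_identity[of "\<lambda>_. \<psi>" e] e by (metis continuous_on_const)
  have "continuous_on {0..1} (\<lambda>\<sigma>. mult (pot c) (w \<sigma>))"
    by (intro bounded_linear.continuous_on[OF bounded_linear_mult_right] cw)
  then obtain \<delta>2 where \<delta>2: "\<delta>2 > 0" "\<And>t \<sigma>. 0 \<le> t \<Longrightarrow> t \<le> \<delta>2 \<Longrightarrow> \<sigma> \<in> {0..1} \<Longrightarrow>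
      norm (heatX t (mult (pot c) (w \<sigma>)) - mult (pot c) (w \<sigma>)) \<le> e"
    using heatX_near_identity[OF _ e] by metis
  define \<delta> where "\<delta> = Min {T, 1, \<delta>1, \<delta>2, e / (K0 + 1)}"
  have \<delta>: "\<delta> > 0" "\<delta> \<le> T" "\<delta> \<le> 1" "\<delta> \<le> \<delta>1" "\<delta> \<le> \<delta>2" "\<delta> \<le> e / (K0 + 1)"
    using T e \<delta>1(1) \<delta>2(1) K0(1) by (auto simp: \<delta>_def add_nonneg_pos)
  have \<delta>K: "K0 * \<delta> \<le> e"
  proof -
    have "\<delta> * (K0 + 1) \<le> e" using \<delta>(6) K0(1) by (simp add: pos_le_divide_eq add_nonneg_pos)
    then show ?thesis using \<delta>(1) by (simp add: algebra_simps)
  qed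
  define c' where "c' j = c j / \<delta>" for j
  have pc': "pot c' = (1 / \<delta>) *\<^sub>R pot c" by (simp add: pot_def c'_def scaleR_sum_right)
  \<comment> \<open>The curve \<open>w\<close> traversed at speed
    \<open>1 / \<delta>\<close>.\<close>
  define z where "z r = expX (r *\<^sub>R pot c') \<psi>" for r
  have zw: "z r = w (r / \<delta>)" for r by (simp add: z_def w_def pc')
  have cz: "continuous_on S z" for S unfolding z_def by (rule continuous_on_expX_scaleR)
  have zR: "norm (z r) + 1 \<le> R" if "r \<in> {0..\<delta>}" for r
  proof -
    have "mult_const * norm ((r / \<delta>) *\<^sub>R pot c) = (r / \<delta>) * F" using that \<delta>(1) by (simp add: F_def)
    also have "\<dots> \<le> 1 * F" using that \<delta>(1) F by (intro mult_right_mono) auto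
    finally have "exp (mult_const * norm ((r / \<delta>) *\<^sub>R pot c)) * norm \<psi> \<le> exp F * norm \<psi>" by (intro mult_right_mono) auto
    with norm_expX_le[of "(r / \<delta>) *\<^sub>R pot c" \<psi>] show ?thesis by (simp add: zw w_def R_def)
  qed
  define K where "K = mult_const * norm (pot c') + K0"
  \<comment> \<open>The Lipschitz constant grows like \<open>1 / \<delta>\<close>, but only its
    product with the duration \<open>\<delta>\<close> enters.\<close>
  have Kd: "K * \<delta> \<le> F + K0"
  proof -
    have "K * \<delta> = F + K0 * \<delta>" using \<delta>(1) by (simp add: K_def pc' F_def distrib_right)
    also have "K0 * \<delta> \<le> K0 * 1" using \<delta>(3) K0(1) by (intro mult_left_mono)
    finally show ?thesis by simp
  qed
  have small: "4 * e * exp (K * \<delta>) \<le> min 1 (\<epsilon> / 2)"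
  proof -
    have "4 * e * exp (K * \<delta>) \<le> 4 * e * E" using Kd e by (auto simp: E_def)
    also have "\<dots> = min 1 (\<epsilon> / 2)" by (simp add: e_def E_def)
    finally show ?thesis .
  qed
  have main: "\<exists>b. reach \<delta> a' b \<and> norm (b - z \<delta>) \<le> 4 * e * exp (K * \<delta>)" if a': "norm (a' - \<psi>) < e" for a'
  proof (rule reach_near_approximate_solution[OF \<delta>(1) cz zR])
    show "K \<ge> 0" using K0(1) mult_const_nonneg by (simp add: K_def)
    show "norm (nl (pot c') x - nl (pot c') y) \<le> K * norm (x - y)" if "norm x \<le> R" "norm y \<le> R" for x y
      unfolding K_def using that by (rule K0(3))
    show "4 * e * exp (K * \<delta>) \<le> 1" using small by simp
    fix t assume t: "t \<in> {0..\<delta>}"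
    then have t0: "t \<ge> 0" by simp
    let ?f = "\<lambda>r. heatX (t - r) (nl (pot c') (z r))" and ?g = "\<lambda>r. mult (pot c') (z r)"
    have cf: "continuous_on {0..t} ?f"
      by (rule continuous_on_convolution(2)[OF continuous_on_heatX continuous_on_nl[OF cz] t])
    have cg: "continuous_on {0..t} ?g" by (intro bounded_linear.continuous_on[OF bounded_linear_mult_right] cz)
    have "heatX t a' + integral {0..t} ?f - z t =
        heatX t (a' - \<psi>) + (heatX t \<psi> - \<psi>) + integral {0..t} (\<lambda>r. ?f r - ?g r)"
    proof -
      have "integral {0..t} (\<lambda>r. ?f r - ?g r) = integral {0..t} ?f - integral {0..t} ?g"
        by (intro Henstock_Kurzweil_Integration.integral_diff integrable_continuous_real cf cg)
      moreover have "integral {0..t} ?g = z t - \<psi>" unfolding z_def by (rule integral_mult_expX[OF t0])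
      moreover have "heatX t (a' - \<psi>) = heatX t a' - heatX t \<psi>"
        by (rule linear_diff[OF bounded_linear.linear[OF bounded_linear_heatX[OF t0]]])
      ultimately show ?thesis by simp
    qed
    also have "norm \<dots> \<le> (e + e) + 2 * e"
    proof (intro norm_triangle_le add_mono)
      show "norm (heatX t (a' - \<psi>)) \<le> e" using norm_heatX_le[OF t0, of "a' - \<psi>"] a' by simp
      show "norm (heatX t \<psi> - \<psi>) \<le> e" using \<delta>1(2)[of t 0] t \<delta>(4) by simp
      have "norm (integral {0..t} (\<lambda>r. ?f r - ?g r)) \<le> (e / \<delta> + K0) * (t - 0)"
      proof (rule integral_bound)
        show "continuous_on {0..t} (\<lambda>r. ?f r - ?g r)" by (intro continuous_intros cf cg)
        show "norm (?f r - ?g r) \<le> e / \<delta> + K0" if r: "r \<in> {0..t}" for r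
        proof -
          have tr: "t - r \<ge> 0" "r \<in> {0..\<delta>}" using t r by auto
          note lin = bounded_linear.linear[OF bounded_linear_heatX[OF tr(1)]]
          let ?m = "mult (pot c) (w (r / \<delta>))"
          have g: "?g r = (1 / \<delta>) *\<^sub>R ?m"
            by (simp add: pc' zw bounded_bilinear.scaleR_left[OF bounded_bilinear_mult])
          have "?f r - ?g r = (1 / \<delta>) *\<^sub>R (heatX (t - r) ?m - ?m) - heatX (t - r) (\<kappa> *\<^sub>R powX (z r) (p + 1))"
            unfolding nl_def g linear_diff[OF lin] linear_cmul[OF lin] by (simp add: scaleR_diff_right)
          also have "norm \<dots> \<le> norm ((1 / \<delta>) *\<^sub>R (heatX (t - r) ?m - ?m)) + norm (heatX (t - r) (\<kappa> *\<^sub>R powX (z r) (p + 1)))"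
            by (rule norm_triangle_ineq4)
          also have "\<dots> \<le> e / \<delta> + K0"
          proof (rule add_mono)
            have "norm (heatX (t - r) ?m - ?m) \<le> e"
              using tr t r \<delta>(1,5) by (intro \<delta>2(2)) auto
            then show "norm ((1 / \<delta>) *\<^sub>R (heatX (t - r) ?m - ?m)) \<le> e / \<delta>"
              using \<delta>(1) by (simp add: divide_right_mono)
            have "norm (z r) \<le> R" using zR[OF tr(2)] by linarith
            then show "norm (heatX (t - r) (\<kappa> *\<^sub>R powX (z r) (p + 1))) \<le> K0"
              using norm_heatX_le[OF tr(1)] K0(2) order_trans by blast
          qed
          finally show "norm (?f r - ?g r) \<le> e / \<delta> + K0" .
        qed
      qed (rule t0)
      also have "\<dots> \<le> (e / \<delta> + K0) * \<delta>" using t e \<delta>(1) K0(1) by (intro mult_left_mono) auto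
      also have "\<dots> = e + K0 * \<delta>" using \<delta>(1) by (simp add: distrib_right)
      also have "\<dots> \<le> 2 * e" using \<delta>K by simp
      finally show "norm (integral {0..t} (\<lambda>r. ?f r - ?g r)) \<le> 2 * e" .
    qed
    finally show "norm (heatX t a' + integral {0..t} ?f - z t) \<le> 4 * e" by simp
  qed
  have "z \<delta> = expX (pot c) \<psi>" using \<delta>(1) by (simp add: zw w_def)
  then have "\<exists>b. reach \<delta> a' b \<and> norm (b - expX (pot c) \<psi>) < \<epsilon>" if "norm (a' - \<psi>) < e" for a'
    using main[OF that] small \<epsilon> by force
  then show "\<exists>h \<tau>. h > 0 \<and> 0 < \<tau> \<and> \<tau> \<le> T \<and>
      (\<forall>a'. norm (a' - \<psi>) < h \<longrightarrow> (\<exists>b'. reach \<tau> a' b' \<and> norm (b' - expX (pot c) \<psi>) < \<epsilon>))"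
    using e \<delta>(1,2) by blast
qed

text \<open>Conjugating a free evolution over time \<open>\<epsilon>\<^sup>2\<close> by \<open>exp (a / \<epsilon>)\<close> gives \<open>exp (BB a)\<close> in the limit. The
  contraction hypothesis keeps the conjugated nonlinearity bounded; it is achieved by adding a
  constant to \<open>a\<close>, which does not change \<open>BB a\<close>.\<close>

lemma conj_solution:
  assumes contr: "\<And>l x. l \<ge> 0 \<Longrightarrow> norm (expX (- (l *\<^sub>R resolvent b)) x) \<le> norm x"
  obtains M where "\<And>\<epsilon>. 0 < \<epsilon> \<Longrightarrow> \<epsilon> \<le> 1 \<Longrightarrow> \<epsilon>\<^sup>2 * M \<le> 1 \<Longrightarrow>
    \<exists>y. steer (\<epsilon>\<^sup>2) (expX (- (resolvent b /\<^sub>R \<epsilon>)) \<psi>) (expX (- (resolvent b /\<^sub>R \<epsilon>)) y) \<and>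
      norm (y - conj_heat (resolvent b) \<epsilon> (\<epsilon>\<^sup>2) \<psi>) \<le> \<epsilon>\<^sup>2 * M"
proof -
  let ?a = "resolvent b"
  define C where "C = conj_const b"
  have C: "C \<ge> 0" unfolding C_def conj_const_def by (intro Bochner_Integration.integral_nonneg) simp
  define R where "R = C * norm \<psi> + 1"
  have "R \<ge> 0" using C by (simp add: R_def)
  then obtain K0 where K0: "K0 \<ge> 0" "\<And>x. norm x \<le> R \<Longrightarrow> norm (\<kappa> *\<^sub>R powX x (p + 1)) \<le> K0"
    "\<And>x y. norm x \<le> R \<Longrightarrow> norm y \<le> R \<Longrightarrow> norm (\<kappa> *\<^sub>R powX x (p + 1) - \<kappa> *\<^sub>R powX y (p + 1)) \<le> K0 * norm (x - y)"
    using nl_Lipschitz[of R] by metis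
  \<comment> \<open>The residual is at most \<open>C * K0 * \<epsilon>\<^sup>2\<close>, and the
    Picard factor at most \<open>exp (C * K0)\<close> as \<open>\<epsilon> \<le> 1\<close>.\<close>
  define M where "M = C * K0 * exp (C * K0)"
  show thesis
  proof (rule that[of M])
    fix \<epsilon> :: real assume \<epsilon>: "0 < \<epsilon>" "\<epsilon> \<le> 1" "\<epsilon>\<^sup>2 * M \<le> 1"
    let ?T = "\<epsilon>\<^sup>2"
    have T: "?T > 0" "?T \<le> 1" using \<epsilon> by (auto simp: power_le_one)
    define L where "L = conj_heat ?a \<epsilon>"
    \<comment> \<open>In the variable \<open>y = e^(a/\<epsilon>) x\<close> the power nonlinearity
      acquires the factor \<open>e^(-p a/\<epsilon>)\<close>, a contraction by
      \<open>contr\<close>.\<close>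
    define N where "N y = - expX (- ((real p / \<epsilon>) *\<^sub>R ?a)) (\<kappa> *\<^sub>R powX y (p + 1))" for y
    have linL: "linear (L t)" if "t \<ge> 0" for t
    proof -
      have "linear (\<lambda>y. expX (?a /\<^sub>R \<epsilon>) (heatX t (expX (- (?a /\<^sub>R \<epsilon>)) y)))"
        using linear_compose[OF linear_compose[OF bounded_linear.linear[OF bounded_linear_expX] bounded_linear.linear[OF bounded_linear_heatX[OF that]]]
          bounded_linear.linear[OF bounded_linear_expX], of "?a /\<^sub>R \<epsilon>" "- (?a /\<^sub>R \<epsilon>)"]
        by (simp add: o_def)
      then show ?thesis by (simp add: L_def conj_heat_def[abs_def])
    qed
    have bdL: "norm (L t x) \<le> C * norm x" if "t \<in> {0..?T}" for t x
      using norm_conj_heat_le[of t \<epsilon> b x] that \<epsilon>(1) by (simp add: L_def C_def)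
    have contL: "continuous_on ({0..?T} \<times> UNIV) (\<lambda>(t, x). L t x)"
    proof -
      have "continuous_on ({0..?T} \<times> UNIV) (\<lambda>p. (fst p, expX (- (?a /\<^sub>R \<epsilon>)) (snd p)))"
        by (intro continuous_intros bounded_linear.continuous_on[OF bounded_linear_expX])
      from continuous_on_compose2[OF continuous_on_heatX[of ?T] this]
      have "continuous_on ({0..?T} \<times> UNIV) (\<lambda>p. heatX (fst p) (expX (- (?a /\<^sub>R \<epsilon>)) (snd p)))"
        by (auto simp: case_prod_beta image_subset_iff)
      from bounded_linear.continuous_on[OF bounded_linear_expX this, of "?a /\<^sub>R \<epsilon>"]
      show ?thesis by (simp add: L_def conj_heat_def case_prod_beta)
    qed
    have contr': "norm (expX (- ((real p / \<epsilon>) *\<^sub>R ?a)) x) \<le> norm x" for x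
      using contr[of "real p / \<epsilon>"] \<epsilon>(1) by simp
    have NL: "norm (N x - N y) \<le> K0 * norm (x - y)" if "norm x \<le> R" "norm y \<le> R" for x y
    proof -
      have "N x - N y = - expX (- ((real p / \<epsilon>) *\<^sub>R ?a)) (\<kappa> *\<^sub>R powX x (p + 1) - \<kappa> *\<^sub>R powX y (p + 1))"
        unfolding N_def linear_diff[OF bounded_linear.linear[OF bounded_linear_expX]] by simp
      then have "norm (N x - N y) = norm (expX (- ((real p / \<epsilon>) *\<^sub>R ?a)) (\<kappa> *\<^sub>R powX x (p + 1) - \<kappa> *\<^sub>R powX y (p + 1)))"
        by (simp only: norm_minus_cancel)
      also have "\<dots> \<le> norm (\<kappa> *\<^sub>R powX x (p + 1) - \<kappa> *\<^sub>R powX y (p + 1))" by (rule contr')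
      also have "\<dots> \<le> K0 * norm (x - y)" by (rule K0(3)[OF that])
      finally show ?thesis .
    qed
    have NB: "norm (N x) \<le> K0" if "norm x \<le> R" for x
      unfolding N_def norm_minus_cancel using order_trans[OF contr' K0(2)[OF that]] .
    define z where "z t = L t \<psi>" for t
    have cz: "continuous_on {0..?T} z"
    proof -
      have "continuous_on {0..?T} (\<lambda>t. (t, \<psi>))" by (intro continuous_intros)
      from continuous_on_compose2[OF contL this] show ?thesis by (auto simp: z_def[abs_def] image_subset_iff)
    qed
    have zR: "norm (z t) + 1 \<le> R" if "t \<in> {0..?T}" for t
      using bdL[OF that, of \<psi>] by (simp add: z_def R_def)
    have cN: "continuous_on {0..?T} (\<lambda>r. N (z r))"
    proof -
      \<comment> \<open>With zero potential, \<open>nl\<close> is the negative power nonlinearity,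
        so its continuity yields that of \<open>N\<close> along the path.\<close>
      have "continuous_on {0..?T} (\<lambda>r. nl 0 (z r))" by (rule continuous_on_nl[OF cz])
      from bounded_linear.continuous_on[OF bounded_linear_expX this, of "- ((real p / \<epsilon>) *\<^sub>R ?a)"]
      show ?thesis
        by (simp add: nl_def N_def bounded_bilinear.zero_left[OF bounded_bilinear_mult]
            linear_neg[OF bounded_linear.linear[OF bounded_linear_expX]] del: powX.simps)
    qed
    have KT: "C * K0 * ?T \<le> C * K0" using C K0(1) T by (intro mult_left_le) auto
    have small: "(C * K0 * ?T) * exp (C * K0 * ?T) \<le> \<epsilon>\<^sup>2 * M"
    proof -
      have "(C * K0 * ?T) * exp (C * K0 * ?T) \<le> (C * K0 * ?T) * exp (C * K0)"
        using C K0(1) T KT by (intro mult_left_mono) auto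
      then show ?thesis by (simp add: M_def mult_ac)
    qed
    have "\<exists>y. continuous_on {0..?T} y \<and>
        (\<forall>t\<in>{0..?T}. y t = L t \<psi> + integral {0..t} (\<lambda>r. L (t - r) (N (y r)))) \<and>
        (\<forall>t\<in>{0..?T}. norm (y t - z t) \<le> (C * K0 * ?T) * exp (C * K0 * ?T))"
    proof (rule Picard_near_approximate_solution[OF _ C K0(1) _ linL bdL contL NL cz zR])
      fix t assume t: "t \<in> {0..?T}"
      have "norm (integral {0..t} (\<lambda>r. L (t - r) (N (z r)))) \<le> (C * K0) * (t - 0)"
      proof (rule integral_bound)
        show "continuous_on {0..t} (\<lambda>r. L (t - r) (N (z r)))"
          by (rule continuous_on_convolution(2)[OF contL cN t])
        show "norm (L (t - r) (N (z r))) \<le> C * K0" if r: "r \<in> {0..t}" for r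
        proof -
          have "norm (z r) \<le> R" using zR[of r] r t by auto
          then have "norm (N (z r)) \<le> K0" by (rule NB)
          then have "C * norm (N (z r)) \<le> C * K0" by (rule mult_left_mono[OF _ C])
          with bdL[of "t - r" "N (z r)"] show "norm (L (t - r) (N (z r))) \<le> C * K0" using r t by auto
        qed
      qed (use t in auto)
      also have "\<dots> \<le> C * K0 * ?T" using t C K0(1) by (intro mult_left_mono) auto
      finally show "norm (L t \<psi> + integral {0..t} (\<lambda>r. L (t - r) (N (z r))) - z t) \<le> C * K0 * ?T"
        by (simp add: z_def)
    next
      show "C * K0 * ?T * exp (C * K0 * ?T) \<le> 1" using small \<epsilon>(3) by (rule order_trans)
    qed (use T C K0(1) in auto)
    then obtain y where y: "continuous_on {0..?T} y"
      "\<And>t. t \<in> {0..?T} \<Longrightarrow> y t = L t \<psi> + integral {0..t} (\<lambda>r. L (t - r) (N (y r)))"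
      "norm (y ?T - z ?T) \<le> (C * K0 * ?T) * exp (C * K0 * ?T)"
      using T by auto
    \<comment> \<open>Undoing the conjugation gives a solution of the original equation with zero
      control.\<close>
    define x where "x t = expX (- (?a /\<^sub>R \<epsilon>)) (y t)" for t
    have cx: "continuous_on {0..?T} x"
      unfolding x_def by (intro bounded_linear.continuous_on[OF bounded_linear_expX] y(1))
    have inv: "expX (- (?a /\<^sub>R \<epsilon>)) (L t w) = heatX t (expX (- (?a /\<^sub>R \<epsilon>)) w)" for t w
      by (simp add: L_def conj_heat_def expX_expX)
    have Nx: "expX (- (?a /\<^sub>R \<epsilon>)) (N w) = nl (pot (\<lambda>_. 0)) (expX (- (?a /\<^sub>R \<epsilon>)) w)" for w
    proof (rule ev_eqI)
      fix \<xi>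
      define g where "g = ev ?a \<xi> / \<epsilon>"
      have "exp (- g) * exp (- (real p * g)) = exp (- g) ^ (p + 1)"
        by (simp add: exp_of_nat_mult[symmetric] exp_add[symmetric] algebra_simps flip: exp_minus)
      then show "ev (expX (- (?a /\<^sub>R \<epsilon>)) (N w)) \<xi> = ev (nl (pot (\<lambda>_. 0)) (expX (- (?a /\<^sub>R \<epsilon>)) w)) \<xi>"
        by (simp add: N_def nl_def pot_def ev_expX ev_neg ev_scaleR ev_diff ev_mult ev_powX power_mult_distrib
            g_def divide_inverse mult_ac del: powX.simps)
    qed
    have eqx: "x t = heatX t (expX (- (?a /\<^sub>R \<epsilon>)) \<psi>) + integral {0..t} (\<lambda>r. heatX (t - r) (nl (pot (\<lambda>_. 0)) (x r)))"
      if t: "t \<in> {0..?T}" for t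
    proof -
      have cNy: "continuous_on {0..?T} (\<lambda>r. N (y r))"
      proof -
        have "continuous_on {0..?T} (\<lambda>r. nl 0 (y r))" by (rule continuous_on_nl[OF y(1)])
        from bounded_linear.continuous_on[OF bounded_linear_expX this, of "- ((real p / \<epsilon>) *\<^sub>R ?a)"]
        show ?thesis
          by (simp add: nl_def N_def bounded_bilinear.zero_left[OF bounded_bilinear_mult]
              linear_neg[OF bounded_linear.linear[OF bounded_linear_expX]] del: powX.simps)
      qed
      have i: "(\<lambda>r. L (t - r) (N (y r))) integrable_on {0..t}"
        by (intro integrable_continuous_real continuous_on_convolution(2)[OF contL cNy t])
      have "x t = expX (- (?a /\<^sub>R \<epsilon>)) (L t \<psi>) + expX (- (?a /\<^sub>R \<epsilon>)) (integral {0..t} (\<lambda>r. L (t - r) (N (y r))))"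
        unfolding x_def y(2)[OF t] linear_add[OF bounded_linear.linear[OF bounded_linear_expX]] ..
      also have "expX (- (?a /\<^sub>R \<epsilon>)) (integral {0..t} (\<lambda>r. L (t - r) (N (y r)))) =
          integral {0..t} (\<lambda>r. expX (- (?a /\<^sub>R \<epsilon>)) (L (t - r) (N (y r))))"
        using integral_linear[OF i bounded_linear_expX, of "- (?a /\<^sub>R \<epsilon>)"] by (simp add: o_def)
      finally show ?thesis by (simp add: inv Nx x_def)
    qed
    have "steer ?T (expX (- (?a /\<^sub>R \<epsilon>)) \<psi>) (x ?T)"
    proof (rule steerI)
      fix \<eta> :: real assume "\<eta> > 0"
      then obtain h where "h > 0" "\<And>T' a'. 0 < T' \<Longrightarrow> T' \<le> ?T \<Longrightarrow> norm (a' - expX (- (?a /\<^sub>R \<epsilon>)) \<psi>) < h \<Longrightarrow>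
          \<exists>b. reach T' a' b \<and> norm (b - x T') < \<eta>"
        using solution_stable[OF T(1) cx eqx] by metis
      then show "\<exists>h \<tau>. h > 0 \<and> 0 < \<tau> \<and> \<tau> \<le> ?T \<and>
          (\<forall>a'. norm (a' - expX (- (?a /\<^sub>R \<epsilon>)) \<psi>) < h \<longrightarrow> (\<exists>b'. reach \<tau> a' b' \<and> norm (b' - x ?T) < \<eta>))"
        using T(1) by blast
    qed
    moreover have "norm (y ?T - conj_heat ?a \<epsilon> ?T \<psi>) \<le> \<epsilon>\<^sup>2 * M"
      using y(3) small by (simp add: z_def L_def)
    ultimately show "\<exists>y. steer ?T (expX (- (?a /\<^sub>R \<epsilon>)) \<psi>) (expX (- (?a /\<^sub>R \<epsilon>)) y) \<and>
        norm (y - conj_heat ?a \<epsilon> ?T \<psi>) \<le> \<epsilon>\<^sup>2 * M"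
      unfolding x_def by blast
  qed
qed

text \<open>First \<open>\<epsilon> n\<close> is fixed so that the solution error and the distance
  to the Gaussian limit are both below \<open>\<eta> / 2\<close>. After that the multiplier
  \<open>e^(-a/\<epsilon>)\<close>, the uncontrolled evolution and the multiplier
  \<open>e^(a/\<epsilon>)\<close> get a third of the time each.\<close>

lemma fast_steer_BB:
  assumes st: "\<And>c y. fast_steer y (expX (c *\<^sub>R resolvent b) y)"
    and contr: "\<And>l x. l \<ge> 0 \<Longrightarrow> norm (expX (- (l *\<^sub>R resolvent b)) x) \<le> norm x"
  shows "fast_steer \<psi> (expX (\<Sum>i\<in>UNIV. mult (deriv_res i b) (deriv_res i b)) \<psi>)"
proof (rule fast_steer_limit)
  fix T \<eta> :: real assume T: "T > 0" and \<eta>: "\<eta> > 0"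
  let ?a = "resolvent b" and ?lim = "expX (\<Sum>i\<in>UNIV. mult (deriv_res i b) (deriv_res i b)) \<psi>"
  obtain M where M: "\<And>\<epsilon>. 0 < \<epsilon> \<Longrightarrow> \<epsilon> \<le> 1 \<Longrightarrow> \<epsilon>\<^sup>2 * M \<le> 1 \<Longrightarrow>
      \<exists>y. steer (\<epsilon>\<^sup>2) (expX (- (?a /\<^sub>R \<epsilon>)) \<psi>) (expX (- (?a /\<^sub>R \<epsilon>)) y) \<and>
        norm (y - conj_heat ?a \<epsilon> (\<epsilon>\<^sup>2) \<psi>) \<le> \<epsilon>\<^sup>2 * M"
    using conj_solution[OF contr] by metis
  define \<epsilon> where "\<epsilon> n = 1 / real (Suc n)" for n
  have \<epsilon>: "\<epsilon> n > 0" "\<epsilon> n \<le> 1" for n by (auto simp: \<epsilon>_def)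
  have lim: "\<epsilon> \<longlonglongrightarrow> 0" unfolding \<epsilon>_def using LIMSEQ_Suc[OF lim_1_over_n] by simp
  have "(\<lambda>n. (\<epsilon> n)\<^sup>2) \<longlonglongrightarrow> 0\<^sup>2" by (intro tendsto_intros lim)
  then have "\<forall>\<^sub>F n in sequentially. (\<epsilon> n)\<^sup>2 < T / 3" by (rule order_tendstoD) (use T in simp)
  moreover have "(\<lambda>n. (\<epsilon> n)\<^sup>2 * M) \<longlonglongrightarrow> 0\<^sup>2 * M" by (intro tendsto_intros lim)
  then have "\<forall>\<^sub>F n in sequentially. (\<epsilon> n)\<^sup>2 * M < min 1 (\<eta> / 2)" by (rule order_tendstoD) (use \<eta> in simp)
  moreover have "\<forall>\<^sub>F n in sequentially. dist (conj_heat ?a (\<epsilon> n) ((\<epsilon> n)\<^sup>2) \<psi>) ?lim < \<eta> / 2"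
    using \<eta> by (intro tendstoD[OF conj_heat_tendsto] \<epsilon> lim) auto
  ultimately have "\<forall>\<^sub>F n in sequentially. (\<epsilon> n)\<^sup>2 < T / 3 \<and> (\<epsilon> n)\<^sup>2 * M < min 1 (\<eta> / 2) \<and>
      dist (conj_heat ?a (\<epsilon> n) ((\<epsilon> n)\<^sup>2) \<psi>) ?lim < \<eta> / 2"
    by (simp add: eventually_conj_iff)
  then obtain n where n: "(\<epsilon> n)\<^sup>2 < T / 3" "(\<epsilon> n)\<^sup>2 * M < min 1 (\<eta> / 2)"
    "dist (conj_heat ?a (\<epsilon> n) ((\<epsilon> n)\<^sup>2) \<psi>) ?lim < \<eta> / 2"
    unfolding eventually_sequentially by blast
  then obtain y where y: "steer ((\<epsilon> n)\<^sup>2) (expX (- (?a /\<^sub>R \<epsilon> n)) \<psi>) (expX (- (?a /\<^sub>R \<epsilon> n)) y)"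
    "norm (y - conj_heat ?a (\<epsilon> n) ((\<epsilon> n)\<^sup>2) \<psi>) \<le> (\<epsilon> n)\<^sup>2 * M"
    using M[OF \<epsilon>, of n] by auto
  have 1: "steer (T / 3) \<psi> (expX (- (?a /\<^sub>R \<epsilon> n)) \<psi>)"
    using st[of \<psi> "- (1 / \<epsilon> n)"] T unfolding fast_steer_def by (simp add: inverse_eq_divide)
  have 2: "steer (T / 3) (expX (- (?a /\<^sub>R \<epsilon> n)) \<psi>) (expX (- (?a /\<^sub>R \<epsilon> n)) y)"
    by (rule steer_mono[OF y(1)]) (use n(1) in simp)
  have 3: "steer (T / 3) (expX (- (?a /\<^sub>R \<epsilon> n)) y) y"
    using st[of "expX (- (?a /\<^sub>R \<epsilon> n)) y" "1 / \<epsilon> n"] T unfolding fast_steer_def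
    by (simp add: inverse_eq_divide expX_expX)
  have "steer T \<psi> y" using steer_trans[OF steer_trans[OF 1 2] 3] by simp
  moreover have "norm (y - ?lim) < \<eta>"
    using norm_triangle_ineq[of "y - conj_heat ?a (\<epsilon> n) ((\<epsilon> n)\<^sup>2) \<psi>" "conj_heat ?a (\<epsilon> n) ((\<epsilon> n)\<^sup>2) \<psi> - ?lim"] y(2) n(2,3)
    by (simp add: dist_norm)
  ultimately show "\<exists>b'. norm (b' - ?lim) < \<eta> \<and> steer T \<psi> b'" by blast
qed

subsection \<open>Steering along the saturation spaces\<close>

lemma saturation_mono: "saturation Q q j \<subseteq> saturation Q q (Suc j)"
proof -
  have "saturation Q q j \<subseteq> BB_sums (saturation Q q j)"
  proof
    fix f assume "f \<in> saturation Q q j"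
    then show "f \<in> BB_sums (saturation Q q j)"
      unfolding BB_sums_def by (intro CollectI exI[of _ f] exI[of _ "\<lambda>_. f"] exI[of _ "0 :: nat"]) simp
  qed
  then show ?thesis
    using largest_subspace(3)[OF subspace_saturation subspace_saturation] by simp
qed

lemma one_in_saturation: "(\<lambda>x. 1) \<in> saturation Q q j"
  by (induction j) (use one_sat saturation_mono in auto)

lemma saturation_in_sobolev: "saturation Q q j \<subseteq> sobolev m" if "real m > real CARD('d) / 2"
  using saturation_smooth_space[OF Q, of j] that by (auto simp: smooth_space_def)

lemma emb_add: "f \<in> sobolev s \<Longrightarrow> g \<in> sobolev s \<Longrightarrow> emb (f + g) = emb f + emb g"
  by (rule ev_eqI) (simp add: ev_emb add_in_sobolev ev_add)

lemma emb_scaleR: "f \<in> sobolev s \<Longrightarrow> emb (c *\<^sub>R f) = c *\<^sub>R emb f"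
  by (rule ev_eqI) (simp only: ev_emb scaleR_in_sobolev ev_scaleR, simp add: scaleR_fun_def)

lemma saturation_0_pot:
  assumes "\<phi> \<in> saturation Q q 0"
  obtains c where "emb \<phi> = pot c"
proof -
  let ?S = "{\<phi> \<in> sobolev s. \<exists>c. emb \<phi> = pot c}"
  have "span (Q ` {1..q}) \<subseteq> ?S"
  proof (rule span_minimal)
    show "Q ` {1..q} \<subseteq> ?S"
    proof (clarsimp simp del: One_nat_def)
      fix j assume j: "1 \<le> j" "j \<le> q"
      have "pot (\<lambda>i. if i = j then 1 else 0) = (\<Sum>i\<in>{1..q}. if i = j then emb (Q j) else 0)"
        unfolding pot_def by (intro sum.cong) auto
      then have "emb (Q j) = pot (\<lambda>i. if i = j then 1 else 0)" using j by simp
      then show "Q j \<in> sobolev s \<and> (\<exists>c. emb (Q j) = pot c)" using Q_in_sobolev j by auto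
    qed
    show "subspace ?S"
    proof (rule subspaceI)
      have "emb 0 = pot (\<lambda>_. 0)"
        using ev_emb[OF zero_in_sobolev] by (intro ev_eqI) (simp add: pot_def)
      then show "0 \<in> ?S" using zero_in_sobolev by auto
      show "f + g \<in> ?S" if fg: "f \<in> ?S" "g \<in> ?S" for f g
      proof -
        obtain c d where "emb f = pot c" "emb g = pot d" using fg by auto
        then have "emb (f + g) = pot (\<lambda>j. c j + d j)"
          using fg by (simp add: emb_add pot_def sum.distrib scaleR_add_left)
        then show ?thesis using fg add_in_sobolev by auto
      qed
      show "l *\<^sub>R f \<in> ?S" if f: "f \<in> ?S" for l f
      proof -
        obtain c where "emb f = pot c" using f by auto
        then have "emb (l *\<^sub>R f) = pot (\<lambda>j. l * c j)"
          using f by (simp add: emb_scaleR pot_def scaleR_sum_right)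
        then show ?thesis using f scaleR_in_sobolev by auto
      qed
    qed
  qed
  then show thesis using assms that by auto
qed

lemma BB_add_const: "BB (\<lambda>x. ev (resolvent b) x + c) = BB (ev (resolvent b))"
proof -
  have "partial_deriv i (\<lambda>x. ev (resolvent b) x + c) x = partial_deriv i (ev (resolvent b)) x" for i x
  proof -
    note D = has_derivative_ev_resolvent[of b x]
    have "((\<lambda>x. ev (resolvent b) x + c) has_derivative (\<lambda>w. \<Sum>i\<in>UNIV. w $ i * ev (deriv_res i b) x)) (at x)"
      using has_derivative_add[OF D has_derivative_const[of c]] by simp
    from frechet_derivative_at[OF this] frechet_derivative_at[OF D] show ?thesis
      by (simp add: partial_deriv_def)
  qed
  then show ?thesis by (simp add: BB_def fun_eq_iff)
qed

text \<open>The shift \<open>c\<close> is the rate in \<open>norm_expX_le\<close> for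
  \<open>emb \<phi>\<close>: the scalar \<open>exp (- (l * c))\<close> compensates the bound
  \<open>exp (l * c)\<close> exactly, so multiplication by \<open>e^(-l \<xi>)\<close> is a
  contraction, while \<open>BB \<xi> = BB \<phi>\<close>.\<close>

lemma fast_steer_BB_saturation:
  assumes \<phi>: "\<phi> \<in> saturation Q q j"
    and IH: "\<And>\<xi> y. \<xi> \<in> saturation Q q j \<Longrightarrow> fast_steer y (expX (emb \<xi>) y)"
  shows "fast_steer y (expX (emb (BB \<phi>)) y)"
proof -
  define c where "c = mult_const * norm (emb \<phi>)"
  define \<xi> where "\<xi> = \<phi> + c *\<^sub>R (\<lambda>x. 1)"
  have s2: "real (s + 2) > real CARD('d) / 2" using s_gt by simp
  have \<xi>: "\<xi> \<in> saturation Q q j"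
    unfolding \<xi>_def by (intro subspace_add subspace_scale subspace_saturation \<phi> one_in_saturation)
  obtain b0 where b0: "\<phi> = ev (resolvent b0)"
    using sobolev_plus_2_imp_resolvent \<phi> saturation_in_sobolev[OF s2] by blast
  obtain b where b: "\<xi> = ev (resolvent b)"
    using sobolev_plus_2_imp_resolvent \<xi> saturation_in_sobolev[OF s2] by blast
  have eb: "emb \<xi> = resolvent b" by (simp add: b)
  have split: "resolvent b = emb \<phi> + const c"
    by (rule ev_eqI) (simp add: b[symmetric] b0 ev_add \<xi>_def scaleR_fun_def)
  have st: "fast_steer y (expX (l *\<^sub>R resolvent b) y)" for l y
  proof -
    have "emb (l *\<^sub>R \<xi>) = l *\<^sub>R resolvent b"
      using \<xi> saturation_in_sobolev[OF s_gt] by (subst emb_scaleR) (auto simp: eb)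
    then show ?thesis using IH[of "l *\<^sub>R \<xi>" y] subspace_scale[OF subspace_saturation \<xi>] by simp
  qed
  have contr: "norm (expX (- (l *\<^sub>R resolvent b)) x) \<le> norm x" if l: "l \<ge> 0" for l x
  proof -
    have "expX (- (l *\<^sub>R resolvent b)) x = exp (- (l * c)) *\<^sub>R expX (- (l *\<^sub>R emb \<phi>)) x"
      by (rule ev_eqI) (simp add: split ev_expX ev_neg ev_add ev_scaleR distrib_left mult.assoc[symmetric] exp_add[symmetric] del: minus_add_distrib)
    then have "norm (expX (- (l *\<^sub>R resolvent b)) x) \<le> exp (- (l * c)) * (exp (mult_const * norm (- (l *\<^sub>R emb \<phi>))) * norm x)"
      by (simp add: mult_left_mono norm_expX_le del: norm_minus_cancel)
    also have "mult_const * norm (- (l *\<^sub>R emb \<phi>)) = l * c" using l by (simp add: c_def)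
    also have "exp (- (l * c)) * (exp (l * c) * norm x) = norm x"
      by (simp add: mult.assoc[symmetric] mult_exp_exp)
    finally show ?thesis .
  qed
  have "BB \<phi> = ev (\<Sum>i\<in>UNIV. mult (deriv_res i b) (deriv_res i b))"
  proof -
    have "\<xi> = (\<lambda>x. ev (resolvent b0) x + c)" by (simp add: \<xi>_def b0 fun_eq_iff scaleR_fun_def)
    then have "BB \<xi> = BB \<phi>" using BB_add_const[of b0 c] b0 by simp
    then show ?thesis using BB_ev_resolvent[of b] b by simp
  qed
  then show ?thesis using fast_steer_BB[OF st contr, of y] by simp
qed

text \<open>Concatenation turns sums of exponents into successive multipliers, so one
  \<open>BB\<close> term is added at a time. The partial sums may leave the saturation spaces and
  are therefore tracked in \<open>sobolev s\<close>.\<close>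

lemma fast_steer_saturation:
  assumes "\<phi> \<in> saturation Q q j"
  shows "fast_steer y (expX (emb \<phi>) y)"
  using assms
proof (induction j arbitrary: \<phi> y)
  case 0
  then show ?case using saturation_0_pot fast_steer_pot by metis
next
  case (Suc j)
  note hyp = Suc.IH
  have "\<phi> \<in> BB_sums (saturation Q q j)"
    using Suc.prems largest_subspace(2)[OF subspace_saturation] by auto
  then obtain \<phi>0 \<xi> and n :: nat where \<phi>: "\<phi> = \<phi>0 + (\<Sum>k\<in>{1..n}. BB (\<xi> k))" "\<phi>0 \<in> saturation Q q j"
    "\<forall>k\<in>{1..n}. \<xi> k \<in> saturation Q q j"
    unfolding BB_sums_def by blast
  have sob: "BB (\<xi> k) \<in> sobolev s" if "k \<in> {1..n}" for k
  proof -
    have "BB (\<xi> k) \<in> smooth_space"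
      using \<phi>(3) that saturation_smooth_space[OF Q, of j] by (intro BB_smooth_space) auto
    then show ?thesis using s_gt by (simp add: smooth_space_def)
  qed
  have "m \<le> n \<Longrightarrow> \<phi>0 + (\<Sum>k\<in>{1..m}. BB (\<xi> k)) \<in> sobolev s \<and>
      fast_steer y (expX (emb (\<phi>0 + (\<Sum>k\<in>{1..m}. BB (\<xi> k)))) y)" for m
  proof (induction m)
    case 0
    then show ?case using Suc.IH[OF \<phi>(2)] \<phi>(2) saturation_in_sobolev[OF s_gt] by auto
  next
    case (Suc m)
    let ?f = "\<phi>0 + (\<Sum>k\<in>{1..m}. BB (\<xi> k))" and ?g = "BB (\<xi> (Suc m))"
    have f: "?f \<in> sobolev s" "fast_steer y (expX (emb ?f) y)" using Suc.IH[OF Suc_leD[OF Suc.prems]] by blast+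
    have k: "Suc m \<in> {1..n}" using Suc.prems by simp
    have g: "?g \<in> sobolev s" by (rule sob[OF k])
    have eq: "\<phi>0 + (\<Sum>k\<in>{1..Suc m}. BB (\<xi> k)) = ?f + ?g"
      by (subst sum.nat_ivl_Suc') (simp, simp only: add.assoc add.commute[of ?g])
    have "fast_steer (expX (emb ?f) y) (expX (emb ?g) (expX (emb ?f) y))"
      by (rule fast_steer_BB_saturation[OF bspec[OF \<phi>(3) k] hyp])
    from fast_steer_trans[OF f(2) this] have "fast_steer y (expX (emb (?f + ?g)) y)"
      unfolding emb_add[OF f(1) g] expX_expX add.commute[of "emb ?g"] .
    then show ?case unfolding eq by (intro conjI add_in_sobolev f(1) g)
  qed
  from this[OF order_refl] show ?case unfolding \<phi>(1) by (rule conjunct2)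
qed

lemma fast_steer_exp:
  assumes dense: "dense_in_sobolev s (saturation_inf Q q)"
  shows "fast_steer y (expX f y)"
proof (rule fast_steer_limit)
  fix T \<epsilon> :: real assume T: "T > 0" and \<epsilon>: "\<epsilon> > 0"
  have "((\<lambda>f'. expX f' y) \<longlongrightarrow> expX f y) (nhds f)" by (intro expX_tendsto tendsto_intros filterlim_ident)
  then have "\<forall>\<^sub>F f' in nhds f. dist (expX f' y) (expX f y) < \<epsilon>" using \<epsilon> by (rule tendstoD)
  then obtain d where d: "d > 0" "\<And>f'. dist f' f < d \<Longrightarrow> dist (expX f' y) (expX f y) < \<epsilon>"
    unfolding eventually_nhds_metric by blast
  obtain g where g: "g \<in> saturation_inf Q q" "g \<in> sobolev s" "sobolev_norm s (ev f - g) < d"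
    using dense d(1) ev_in_sobolev[of f] unfolding dense_in_sobolev_def by blast
  have "ev f - g = ev (f - emb g)" by (rule ext) (simp add: ev_diff ev_emb g(2))
  then have "dist (emb g) f < d" using g(3) by (simp add: sobolev_norm_ev dist_norm norm_minus_commute)
  moreover obtain j where "g \<in> saturation Q q j" using g(1) by (auto simp: saturation_inf_def)
  ultimately show "\<exists>b'. norm (b' - expX f y) < \<epsilon> \<and> steer T y b'"
    using d(2) fast_steer_saturation T unfolding fast_steer_def dist_norm by blast
qed

section \<open>Transfer from paths in sequence space to mild solutions\<close>

lemma mild_imp_mild_solution:
  assumes "mild T u a \<psi>"
  shows "mild_solution s \<kappa> p (q + 2) (append2 q Q \<mu>1 \<mu>2) T (ev a)
    (append2 q u (\<lambda>t. 0) (\<lambda>t. 0)) (\<lambda>t. ev (\<psi> t))"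
  unfolding mild_solution_def
proof (intro conjI ballI ev_in_sobolev)
  have diff: "ev x - ev y = ev (x - y)" for x y :: "'d hseq" using linear_diff[OF linear_ev_fun] by metis
  fix t assume t: "t \<in> {0..T}"
  let ?F = "\<lambda>r x. (\<Sum>j\<in>{1..q + 2}. append2 q u (\<lambda>t. 0) (\<lambda>t. 0) j r * append2 q Q \<mu>1 \<mu>2 j x) * ev (\<psi> r) x
    - \<kappa> * ev (\<psi> r) x ^ (p + 1)"
  have "(\<psi> \<longlongrightarrow> \<psi> t) (at t within {0..T})"
    using assms t unfolding mild_def continuous_on_def by blast
  then show "((\<lambda>r. sobolev_norm s (ev (\<psi> r) - ev (\<psi> t))) \<longlongrightarrow> 0) (at t within {0..T})"
    unfolding diff sobolev_norm_ev by (intro tendsto_norm_zero LIM_zero)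
  define G where "G r = heatX (t - r) (nl (pot (\<lambda>j. u j r)) (\<psi> r))" for r
  have "has_bochner_integral lborel (\<lambda>r. indicator {0..t} r *\<^sub>R G r) (\<psi> t - heatX t a)"
    using assms t unfolding mild_def G_def by blast
  then have int: "integrable lborel (\<lambda>r. indicator {0..t} r *\<^sub>R G r)"
    and eq: "(LINT r|lborel. indicator {0..t} r *\<^sub>R G r) = \<psi> t - heatX t a"
    by (simp_all add: has_bochner_integral_iff)
  have m: "(\<lambda>r. indicator {0..t} r *\<^sub>R G r) \<in> borel_measurable lborel" using int by simp
  have "has_bochner_integral (lebesgue_on {0..t}) G (\<psi> t - heatX t a)"
    unfolding has_bochner_integral_iff
    using int eq by (simp add: integrable_restrict_space integral_restrict_space
        integrable_completion[OF m] integral_completion[OF m])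
  moreover have "heat (t - r) (?F r) = ev (G r)" if "r \<in> space (lebesgue_on {0..t})" for r
  proof -
    \<comment> \<open>The last two controls are 0, so \<open>\<mu>1\<close> and
      \<open>\<mu>2\<close> drop out of the sum.\<close>
    have "(\<Sum>j\<in>{1..q + 2}. append2 q u (\<lambda>t. 0) (\<lambda>t. 0) j r * append2 q Q \<mu>1 \<mu>2 j x) = ev (pot (\<lambda>j. u j r)) x" for x
      unfolding ev_pot by (rule sum.mono_neutral_cong_right) (auto simp: append2_def)
    then have "?F r = ev (nl (pot (\<lambda>j. u j r)) (\<psi> r))"
      by (intro ext) (simp only: nl_def ev_diff ev_mult ev_scaleR ev_powX)
    then show ?thesis using that by (simp only: G_def) (simp add: heat_ev)
  qed
  ultimately have "has_sobolev_integral s (lebesgue_on {0..t})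
     (\<lambda>r. heat (t - r) (?F r)) (ev (\<psi> t - heatX t a))"
    by (rule has_sobolev_integral_ev)
  moreover have "ev (\<psi> t - heatX t a) = ev (\<psi> t) - heat t (ev a)" using t by (simp add: heat_ev diff)
  ultimately show "has_sobolev_integral s (lebesgue_on {0..t})
     (\<lambda>r. heat (t - r) (?F r)) (ev (\<psi> t) - heat t (ev a))" by (simp only:)
qed

lemma admissible_L2_on:
  assumes "admissible u"
  shows "L2_on {0<..<T} (u j)"
proof -
  have m: "u j \<in> borel_measurable (lebesgue_on {0<..<T})"
    using assms unfolding admissible_def
    by (intro measurable_restrict_space1 measurable_completion) auto
  obtain B where B: "\<And>t. \<bar>u j t\<bar> \<le> B" using assms unfolding admissible_def bounded_iff by force
  interpret finite_measure "lebesgue_on {0<..<T}"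
    by (rule finite_measureI, cases "0 \<le> T") (auto simp: emeasure_restrict_space space_restrict_space)
  have "integrable (lebesgue_on {0<..<T}) (\<lambda>t. (u j t)\<^sup>2)"
  proof (rule integrable_const_bound[where B = "B\<^sup>2"])
    show "AE t in lebesgue_on {0<..<T}. norm ((u j t)\<^sup>2) \<le> B\<^sup>2"
      using power_mono[OF B abs_ge_zero, of _ 2] by (intro AE_I2) simp
  qed (use m in measurable)
  then show ?thesis using m by (simp add: L2_on_def)
qed

lemma reach_imp_mild_solution:
  assumes "reach T a b"
  obtains u \<psi> where "\<And>j. L2_on {0<..<T} (u j)"
    "mild_solution s \<kappa> p (q + 2) (append2 q Q \<mu>1 \<mu>2) T (ev a) (append2 q u (\<lambda>t. 0) (\<lambda>t. 0)) \<psi>"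
    "\<psi> T = ev b"
proof -
  obtain u \<psi> where "admissible u" "mild T u a \<psi>" "\<psi> T = b"
    using assms unfolding reach_def by blast
  then show thesis
    using that[of u "\<lambda>t. ev (\<psi> t)"] admissible_L2_on mild_imp_mild_solution by blast
qed

subsection \<open>Waiting at a constant\<close>

lemma emb_const_fun: "emb (\<lambda>x. c) = const c"
proof -
  have "(\<lambda>x. c) = ev (const c)" by (simp add: fun_eq_iff)
  then show ?thesis by simp
qed

lemma freq_sq_0: "freq_sq 0 = 0"
  by (simp add: freq_sq_def)

lemma heatX_const: "t \<ge> 0 \<Longrightarrow> heatX t (const c) = const c"
  by (rule fc_eqI) (simp only: heatX_def fc_fmul[OF multiplier_heat], simp add: const_def fc_single freq_sq_0)

text \<open>Since 1 is in the span of the potentials, the constant potential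
  \<open>\<kappa> * \<sigma> ^ p\<close> is available; it makes \<open>const \<sigma>\<close>
  stationary. Stability around it is uniform over all waiting times up to \<open>T\<close>.\<close>

lemma hold:
  assumes T: "T > 0" and \<epsilon>: "\<epsilon> > 0"
  obtains h where "h > 0" "\<And>T' a. 0 < T' \<Longrightarrow> T' \<le> T \<Longrightarrow> norm (a - const \<sigma>) < h \<Longrightarrow>
    \<exists>b. reach T' a b \<and> norm (b - const \<sigma>) < \<epsilon>"
proof -
  have "(\<kappa> * \<sigma> ^ p) *\<^sub>R (\<lambda>x. 1) \<in> saturation Q q 0"
    by (intro subspace_scale subspace_saturation one_sat)
  then obtain c where c: "emb ((\<kappa> * \<sigma> ^ p) *\<^sub>R (\<lambda>x. 1)) = pot c" by (rule saturation_0_pot)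
  then have "pot c = const (\<kappa> * \<sigma> ^ p)" by (simp add: scaleR_fun_def emb_const_fun)
  then have "nl (pot c) (const \<sigma>) = 0"
    by (intro ev_eqI) (simp add: nl_def ev_diff ev_mult ev_scaleR ev_powX del: powX.simps)
  moreover have "integral {0..t} (\<lambda>r. heatX (t - r) (0 :: 'd hseq)) = integral {0..t} (\<lambda>r. 0)" for t :: real
    by (intro Henstock_Kurzweil_Integration.integral_cong linear_0 bounded_linear.linear bounded_linear_heatX) simp
  ultimately have "const \<sigma> = heatX t (const \<sigma>) + integral {0..t} (\<lambda>r. heatX (t - r) (nl (pot c) (const \<sigma>)))"
    if "t \<in> {0..T}" for t
    using that by (simp add: heatX_const)
  from solution_stable[OF T continuous_on_const this \<epsilon>] show thesis using that by blast
qed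

text \<open>The tolerances are chosen backwards: \<open>h\<close> for the last leg, \<open>k\<close>
  for the wait, \<open>l\<close> for the first leg. The two moving legs take at most
  \<open>T / 3\<close> each, so the wait \<open>T - \<rho> - \<tau>\<close> is positive and makes
  the total time exactly \<open>T\<close>.\<close>

lemma reach_via_const:
  assumes ac: "fast_steer a (const \<sigma>)" and cb: "fast_steer (const \<sigma>) b" and T: "T > 0" and \<epsilon>: "\<epsilon> > 0"
  obtains b' where "reach T a b'" "norm (b' - b) < \<epsilon>"
proof -
  have T3: "T / 3 > 0" using T by simp
  obtain h \<tau> where h: "h > 0" "0 < \<tau>" "\<tau> \<le> T / 3"
    "\<And>c. norm (c - const \<sigma>) < h \<Longrightarrow> \<exists>b'. reach \<tau> c b' \<and> norm (b' - b) < \<epsilon>"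
    using cb[unfolded fast_steer_def] steerE[OF _ \<epsilon>] T3 by metis
  obtain k where k: "k > 0" "\<And>T' a. 0 < T' \<Longrightarrow> T' \<le> T \<Longrightarrow> norm (a - const \<sigma>) < k \<Longrightarrow>
      \<exists>b. reach T' a b \<and> norm (b - const \<sigma>) < h"
    using hold[OF T h(1)] by metis
  obtain l \<rho> where l: "l > 0" "0 < \<rho>" "\<rho> \<le> T / 3"
    "\<And>a'. norm (a' - a) < l \<Longrightarrow> \<exists>c. reach \<rho> a' c \<and> norm (c - const \<sigma>) < k"
    using ac[unfolded fast_steer_def] steerE[OF _ k(1)] T3 by metis
  obtain c where c: "reach \<rho> a c" "norm (c - const \<sigma>) < k" using l(1) l(4)[of a] by auto
  obtain d where d: "reach (T - \<rho> - \<tau>) c d" "norm (d - const \<sigma>) < h"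
    using k(2)[OF _ _ c(2), of "T - \<rho> - \<tau>"] h(2,3) l(2,3) T by auto
  obtain b' where b': "reach \<tau> d b'" "norm (b' - b) < \<epsilon>" using h(4)[OF d(2)] by blast
  have "reach (\<rho> + (T - \<rho> - \<tau>) + \<tau>) a b'"
    by (rule reach_trans[OF reach_trans[OF c(1) d(1)] b'(1)])
  then show thesis using that b'(2) by simp
qed

end

section \<open>The two controllability statements\<close>

theorem theorem3p3:
  fixes q p s :: nat and \<kappa> :: real
    and Q :: "nat \<Rightarrow> real ^ 'd \<Rightarrow> real" and \<mu>1 \<mu>2 :: "real ^ 'd \<Rightarrow> real"
  assumes "q \<ge> 1"
    and "s \<ge> 1" and "real s > real CARD('d) / 2"
    and "\<forall>j\<in>{1..q}. periodic (Q j) \<and> smooth (Q j)"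
    and "(\<lambda>x. 1) \<in> saturation Q q 0"
    and "dense_in_sobolev s (saturation_inf Q q)"
    and "bounded_measurable \<mu>1" and "bounded_measurable \<mu>2"
  shows "(\<forall>\<psi>0\<in>sobolev s. \<forall>\<psi>1\<in>sobolev s. (\<forall>x. sgn (\<psi>0 x) = sgn (\<psi>1 x)) \<longrightarrow>
            (\<forall>\<epsilon>>0. \<forall>T>0. \<exists>\<tau>\<in>{0<..T}. \<exists>u. (\<forall>j\<in>{1..q}. L2_on {0<..<\<tau>} (u j)) \<and>
               (\<exists>\<psi>. mild_solution s \<kappa> p (q + 2) (append2 q Q \<mu>1 \<mu>2) \<tau> \<psi>0
                       (append2 q u (\<lambda>t. 0) (\<lambda>t. 0)) \<psi> \<and>
                    L2_norm (\<psi> \<tau> - \<psi>1) < \<epsilon>)))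
       \<and> (\<forall>\<psi>0\<in>sobolev s. \<forall>\<psi>1\<in>sobolev s.
            (\<forall>x. \<psi>0 x > 0 \<and> \<psi>1 x > 0) \<or> (\<forall>x. \<psi>0 x < 0 \<and> \<psi>1 x < 0) \<longrightarrow>
            (\<forall>\<epsilon>>0. \<forall>T>0. \<exists>u. (\<forall>j\<in>{1..q}. L2_on {0<..<T} (u j)) \<and>
               (\<exists>\<psi>. mild_solution s \<kappa> p (q + 2) (append2 q Q \<mu>1 \<mu>2) T \<psi>0
                       (append2 q u (\<lambda>t. 0) (\<lambda>t. 0)) \<psi> \<and>
                    sobolev_norm s (\<psi> T - \<psi>1) < \<epsilon>)))"
proof -
  interpret control_system s "TYPE('d)" q p \<kappa> Q
    by unfold_locales (use assms in auto)
  have fast: "fast_steer y (expX f y)" for f y by (rule fast_steer_exp) fact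
  have diff: "ev x - ev y = ev (x - y)" for x y :: "'d hseq" using linear_diff[OF linear_ev_fun] by metis
  show ?thesis
  proof (intro conjI ballI allI impI)
    fix \<psi>0 \<psi>1 :: "real ^ 'd \<Rightarrow> real" and \<epsilon> T :: real
    assume \<psi>: "\<psi>0 \<in> sobolev s" "\<psi>1 \<in> sobolev s" and sgn: "\<forall>x. sgn (\<psi>0 x) = sgn (\<psi>1 x)"
      and pos: "\<epsilon> > 0" "T > 0"
    define a b where "a = emb \<psi>0" and "b = emb \<psi>1"
    have ab: "\<psi>0 = ev a" "\<psi>1 = ev b" using \<psi> by (simp_all add: a_def b_def ev_emb)
    have "sgn (ev a x) = sgn (ev b x)" for x using sgn by (simp only: ab)
    from expX_L2_approx[OF this pos(1)] obtain f \<delta> where \<delta>: "\<delta> > 0"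
      "\<And>c. norm (c - expX f a) < \<delta> \<Longrightarrow> L2_norm (ev c - ev b) < \<epsilon>"
      by blast
    have "steer T a (expX f a)" using fast pos(2) by (simp only: fast_steer_def)
    from steerE[OF this \<delta>(1)] obtain h \<tau> where h: "h > 0" "0 < \<tau>" "\<tau> \<le> T"
      "\<And>a'. norm (a' - a) < h \<Longrightarrow> \<exists>c. reach \<tau> a' c \<and> norm (c - expX f a) < \<delta>"
      by blast
    obtain c where c: "reach \<tau> a c" "norm (c - expX f a) < \<delta>" using h(4)[of a] h(1) by auto
    show "\<exists>\<tau>\<in>{0<..T}. \<exists>u. (\<forall>j\<in>{1..q}. L2_on {0<..<\<tau>} (u j)) \<and>
        (\<exists>\<psi>. mild_solution s \<kappa> p (q + 2) (append2 q Q \<mu>1 \<mu>2) \<tau> \<psi>0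
          (append2 q u (\<lambda>t. 0) (\<lambda>t. 0)) \<psi> \<and> L2_norm (\<psi> \<tau> - \<psi>1) < \<epsilon>)"
    proof (rule reach_imp_mild_solution[OF c(1), of \<mu>1 \<mu>2], intro bexI exI conjI ballI)
      fix u \<psi>
      assume "\<psi> \<tau> = ev c"
      then show "L2_norm (\<psi> \<tau> - \<psi>1) < \<epsilon>" using \<delta>(2)[OF c(2)] by (simp only: ab)
    qed (use h(2,3) in \<open>simp_all add: ab\<close>)
  next
    fix \<psi>0 \<psi>1 :: "real ^ 'd \<Rightarrow> real" and \<epsilon> T :: real
    assume \<psi>: "\<psi>0 \<in> sobolev s" "\<psi>1 \<in> sobolev s"
      and sgn: "(\<forall>x. \<psi>0 x > 0 \<and> \<psi>1 x > 0) \<or> (\<forall>x. \<psi>0 x < 0 \<and> \<psi>1 x < 0)"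
      and pos: "\<epsilon> > 0" "T > 0"
    define a b where "a = emb \<psi>0" and "b = emb \<psi>1"
    have ab: "\<psi>0 = ev a" "\<psi>1 = ev b" using \<psi> by (simp_all add: a_def b_def ev_emb)
    obtain f g \<sigma> where fg: "a = expX f (const \<sigma>)" "b = expX g (const \<sigma>)"
      using same_sign_imp_expX[OF sgn[unfolded ab]] by blast
    \<comment> \<open>The inverse multiplier \<open>e^(-f)\<close> takes \<open>a\<close> back to
      the constant.\<close>
    have "fast_steer a (const \<sigma>)" using fast[of a "- f"] by (simp add: fg expX_expX)
    moreover have "fast_steer (const \<sigma>) b" using fast by (simp add: fg)
    ultimately obtain c where c: "reach T a c" "norm (c - b) < \<epsilon>"
      using reach_via_const[OF _ _ pos(2,1)] by blast
    show "\<exists>u. (\<forall>j\<in>{1..q}. L2_on {0<..<T} (u j)) \<and>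
        (\<exists>\<psi>. mild_solution s \<kappa> p (q + 2) (append2 q Q \<mu>1 \<mu>2) T \<psi>0
          (append2 q u (\<lambda>t. 0) (\<lambda>t. 0)) \<psi> \<and> sobolev_norm s (\<psi> T - \<psi>1) < \<epsilon>)"
    proof (rule reach_imp_mild_solution[OF c(1), of \<mu>1 \<mu>2], intro exI conjI ballI)
      fix u \<psi>
      assume "\<psi> T = ev c"
      then show "sobolev_norm s (\<psi> T - \<psi>1) < \<epsilon>" using c(2) by (simp only: ab diff sobolev_norm_ev)
    qed (simp_all add: ab)
  qed
qed

end
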